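(* Let $0<T\le\infty$ and let the coefficients $a_n$, $b_{n,j}$, $k_{n,j}$, the weight $w$, the number $\kappa$, the exponent $\alpha$ and the weight $\widetilde w$ satisfy all the standing assumptions listed in the context (including one of the cases (CI) or (CII)). Let $\mathring u=(\mathring u_n)_{n=1}^\infty\in(\ell^1_{\widetilde w})_+$. Then: (i) There exists $t_{\max}\in(0,T]$ such that the problem $u'(t)=G^{(w)}u(t)+K(t,u(t))$, $u(0)=\mathring u$, has a unique maximal positive mild solution $u\in C([0,t_{\max}),\ell^1_{\widetilde w})$. (ii) If $t_{\max}<T$, then $\|u(t)\|_{\widetilde w}\to\infty$ as $t\to t_{\max}^-$. (iii) For every $\tau\in(0,t_{\max})$ there exist $r_\tau>0$ and $M_\tau>0$ such that, whenever $\mathring v\in(\ell^1_{\widetilde w})_+$ satisfies $\|\mathring v-\mathring u\|_{\widetilde w}\le r_\tau$ and $v$ is the corresponding maximal mild solution (with initial value $\mathring v$), then $v$ is defined on $[0,\tau]$ and $\|v(t)-u(t)\|_{\widetilde w}\le M_\tau\|\mathring v-\mathring u\|_{\widetilde w}$ for all $t\in[0,\tau]$. (iv) Let $\phi_{[1]}(f)=\sum_{n=1}^\infty nf_n$. If $\sum_{n=1}^{j-1}nb_{n,j}\le j$ for all $j\ge2$, then $\phi_{[1]}(u(t))\le\phi_{[1]}(\mathring u)$ for all $t\in[0,t_{\max})$. If $a_1=0$ and $\sum_{n=1}^{j-1}nb_{n,j}=j$ for all $j\ge 2$, then $\phi_{[1]}(u(t))=\phi_{[1]}(\mathring u)$ for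 all $t\in[0,t_{\max})$.
   Context: Standing assumptions. Let $0<T\le\infty$. Let $a_n\ge0$ for $n\in\mathbb N$, $b_{n,j}\ge0$ for $n,j\in\mathbb N$ with $b_{n,j}=0$ whenever $j\le n$, and $k_{n,j}:[0,T)\to[0,\infty)$ with $k_{n,j}(t)=k_{j,n}(t)$ for all $n,j\in\mathbb N$, $t\in[0,T)$. For a sequence $v=(v_n)_{n\ge1}$ of positive reals, $\ell^1_v$ denotes the space of real sequences $f=(f_n)$ with $\|f\|_v=\sum_{n}v_n|f_n|<\infty$; it is a Banach lattice with the componentwise order, and $(\ell^1_v)_+$ denotes its non-negative elements. Weight: $w=(w_n)$ satisfies $w_n\ge n$ for all $n$, $(w_n)$ is monotone increasing, and there is $\kappa\in(0,1]$ with $\sum_{n=1}^{j-1}w_nb_{n,j}\le\kappa w_j$ for all $j\ge2$. Fragmentation operator: on $\ell^1_w$ let $A^{(w)}f=(-a_nf_n)_{n}$ and $B^{(w)}f=(\sum_{j=n+1}^\infty a_jb_{n,j}f_j)_n$, each with maximal domain $\{f\in\ell^1_w:$ the image lies in $\ell^1_w\}$, and let $G^{(w)}$ be the closure of $A^{(w)}+B^{(w)}$. It is known that $G^{(w)}$ generates a substochastic $C_0$-semigroup $(S^{(w)}(t))_{t\ge0}$ on $\ell^1_w$ (and if $\kappa<1$ no closure is needed and the semigroup is analytic). Coagulation: $\alpha\in[0,1)$ and either (CI) $\kappa\in(0,1]$ and $\alpha=0$, or (CII) $\kappa\in(0,1)$ and $\alpha\in(0,1)$. Each $k_{n,j}$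 is continuous on $[0,T)$, and for every $t'\in(0,T)$ there is $c(t')>0$ with $k_{n,j}(t)\le c(t')\widetilde w_n\widetilde w_j/w_{n+j}$ for all $n,j\in\mathbb N$, $t\in[0,t']$, where $\widetilde w_n=(1+a_n)^\alpha w_n$ and $\widetilde w=(\widetilde w_n)$. The coagulation operator is $K(t,f)=\bigl(\tfrac12\sum_{j=1}^{n-1}k_{n-j,j}(t)f_{n-j}f_j-\sum_{j=1}^\infty k_{n,j}(t)f_nf_j\bigr)_{n=1}^\infty$ for $t\in[0,T)$, $f\in\ell^1_{\widetilde w}$; it maps $[0,T)\times\ell^1_{\widetilde w}$ continuously into $\ell^1_w$. A mild solution on $[0,t_1)$, $t_1\in(0,T]$, is a function $u\in C([0,t_1),\ell^1_{\widetilde w})$ with $u(t)=S^{(w)}(t)\mathring u+\int_0^tS^{(w)}(t-s)K(s,u(s))\,ds$ in $\ell^1_w$ for all $t\in[0,t_1)$; it is maximal if it admits no extension to a mild solution on a strictly larger interval $[0,\tilde t_1)$ with $\tilde t_1\le T$. It is positive if $u(t)\ge0$ for all $t$. *)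

theory Defs
  imports "HOL-Analysis.Analysis"
begin

text \<open>Sequences f = (f_n)_{n>=1} are represented as functions nat => real with the
  convention f 0 = 0 (index 0 is a dummy).\<close>

definition lsp :: "(nat \<Rightarrow> real) \<Rightarrow> (nat \<Rightarrow> real) set" where
  "lsp v = {f. f 0 = 0 \<and> summable (\<lambda>n. v n * \<bar>f n\<bar>)}"

definition wnorm :: "(nat \<Rightarrow> real) \<Rightarrow> (nat \<Rightarrow> real) \<Rightarrow> real" where
  "wnorm v f = (\<Sum>n. v n * \<bar>f n\<bar>)"

definition sadd :: "(nat \<Rightarrow> real) \<Rightarrow> (nat \<Rightarrow> real) \<Rightarrow> nat \<Rightarrow> real" where
  "sadd f g = (\<lambda>n. f n + g n)"

definition ssub :: "(nat \<Rightarrow> real) \<Rightarrow> (nat \<Rightarrow> real) \<Rightarrow> nat \<Rightarrow> real" where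
  "ssub f g = (\<lambda>n. f n - g n)"

definition sscale :: "real \<Rightarrow> (nat \<Rightarrow> real) \<Rightarrow> nat \<Rightarrow> real" where
  "sscale c f = (\<lambda>n. c * f n)"

definition nonneg_seq :: "(nat \<Rightarrow> real) \<Rightarrow> bool" where
  "nonneg_seq f \<longleftrightarrow> (\<forall>n. 0 \<le> f n)"

definition wtil :: "real \<Rightarrow> (nat \<Rightarrow> real) \<Rightarrow> (nat \<Rightarrow> real) \<Rightarrow> nat \<Rightarrow> real" where
  "wtil \<alpha> a w n = (1 + a n) powr \<alpha> * w n"

definition Aop :: "(nat \<Rightarrow> real) \<Rightarrow> (nat \<Rightarrow> real) \<Rightarrow> nat \<Rightarrow> real" where
  "Aop a f = (\<lambda>n. if n = 0 then 0 else - a n * f n)"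

definition Bop :: "(nat \<Rightarrow> real) \<Rightarrow> (nat \<Rightarrow> nat \<Rightarrow> real) \<Rightarrow> (nat \<Rightarrow> real) \<Rightarrow> nat \<Rightarrow> real" where
  "Bop a b f = (\<lambda>n. if n = 0 then 0 else (\<Sum>j. a j * b n j * f j))"

definition domA :: "(nat \<Rightarrow> real) \<Rightarrow> (nat \<Rightarrow> real) \<Rightarrow> (nat \<Rightarrow> real) set" where
  "domA w a = {f \<in> lsp w. Aop a f \<in> lsp w}"

definition domB :: "(nat \<Rightarrow> real) \<Rightarrow> (nat \<Rightarrow> real) \<Rightarrow> (nat \<Rightarrow> nat \<Rightarrow> real) \<Rightarrow> (nat \<Rightarrow> real) set" where
  "domB w a b = {f \<in> lsp w. (\<forall>n\<ge>1. summable (\<lambda>j. a j * b n j * f j)) \<and> Bop a b f \<in> lsp w}"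

definition graphAB :: "(nat \<Rightarrow> real) \<Rightarrow> (nat \<Rightarrow> real) \<Rightarrow> (nat \<Rightarrow> nat \<Rightarrow> real)
    \<Rightarrow> ((nat \<Rightarrow> real) \<times> (nat \<Rightarrow> real)) set" where
  "graphAB w a b = {(f, sadd (Aop a f) (Bop a b f)) | f. f \<in> domA w a \<inter> domB w a b}"

definition graphG :: "(nat \<Rightarrow> real) \<Rightarrow> (nat \<Rightarrow> real) \<Rightarrow> (nat \<Rightarrow> nat \<Rightarrow> real)
    \<Rightarrow> ((nat \<Rightarrow> real) \<times> (nat \<Rightarrow> real)) set" where
  "graphG w a b = {(f, g). f \<in> lsp w \<and> g \<in> lsp w \<and>
      (\<exists>F Gs. (\<forall>i. (F i, Gs i) \<in> graphAB w a b) \<and>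
         (\<lambda>i. wnorm w (ssub (F i) f)) \<longlonglongrightarrow> 0 \<and> (\<lambda>i. wnorm w (ssub (Gs i) g)) \<longlonglongrightarrow> 0)}"

definition C0_semigroup :: "(nat \<Rightarrow> real) \<Rightarrow> (real \<Rightarrow> (nat \<Rightarrow> real) \<Rightarrow> (nat \<Rightarrow> real)) \<Rightarrow> bool" where
  "C0_semigroup v S \<longleftrightarrow>
     (\<forall>t\<ge>0. \<forall>f\<in>lsp v. S t f \<in> lsp v) \<and>
     (\<forall>t\<ge>0. \<forall>f\<in>lsp v. \<forall>g\<in>lsp v. \<forall>c. S t (sadd f g) = sadd (S t f) (S t g) \<and> S t (sscale c f) = sscale c (S t f)) \<and>
     (\<forall>t\<ge>0. \<exists>M. \<forall>f\<in>lsp v. wnorm v (S t f) \<le> M * wnorm v f) \<and>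
     (\<forall>f\<in>lsp v. S 0 f = f) \<and>
     (\<forall>s\<ge>0. \<forall>t\<ge>0. \<forall>f\<in>lsp v. S (s + t) f = S s (S t f)) \<and>
     (\<forall>f\<in>lsp v. ((\<lambda>h. wnorm v (ssub (S h f) f)) \<longlongrightarrow> 0) (at_right 0))"

definition generator_graph :: "(nat \<Rightarrow> real) \<Rightarrow> (real \<Rightarrow> (nat \<Rightarrow> real) \<Rightarrow> (nat \<Rightarrow> real))
    \<Rightarrow> ((nat \<Rightarrow> real) \<times> (nat \<Rightarrow> real)) set" where
  "generator_graph v S = {(f, g). f \<in> lsp v \<and> g \<in> lsp v \<and>
      ((\<lambda>h. wnorm v (ssub (sscale (1 / h) (ssub (S h f) f)) g)) \<longlongrightarrow> 0) (at_right 0)}"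

definition frag_semigroup :: "(nat \<Rightarrow> real) \<Rightarrow> (nat \<Rightarrow> real) \<Rightarrow> (nat \<Rightarrow> nat \<Rightarrow> real)
    \<Rightarrow> (real \<Rightarrow> (nat \<Rightarrow> real) \<Rightarrow> (nat \<Rightarrow> real)) \<Rightarrow> bool" where
  "frag_semigroup w a b S \<longleftrightarrow> C0_semigroup w S \<and> generator_graph w S = graphG w a b"

definition Kop :: "(nat \<Rightarrow> nat \<Rightarrow> real \<Rightarrow> real) \<Rightarrow> real \<Rightarrow> (nat \<Rightarrow> real) \<Rightarrow> nat \<Rightarrow> real" where
  "Kop k t f = (\<lambda>n. if n = 0 then 0 else
      (1/2) * (\<Sum>j=1..n-1. k (n-j) j t * f (n-j) * f j) - (\<Sum>j. k n j t * f n * f j))"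

definition tint :: "ereal \<Rightarrow> real set" where
  "tint t1 = {t. 0 \<le> t \<and> ereal t < t1}"

text \<open>Mild solution on [0,t1), t1 in (0,T]. The l^1_w-valued integral is expressed
  componentwise (coordinate functionals are continuous on l^1_w).\<close>
definition mild_sol :: "(real \<Rightarrow> (nat \<Rightarrow> real) \<Rightarrow> (nat \<Rightarrow> real)) \<Rightarrow> (nat \<Rightarrow> nat \<Rightarrow> real \<Rightarrow> real)
    \<Rightarrow> (nat \<Rightarrow> real) \<Rightarrow> ereal \<Rightarrow> (nat \<Rightarrow> real) \<Rightarrow> ereal \<Rightarrow> (real \<Rightarrow> nat \<Rightarrow> real) \<Rightarrow> bool" where
  "mild_sol S k wt T u0 t1 u \<longleftrightarrow> 0 < t1 \<and> t1 \<le> T \<and>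
     (\<forall>t\<in>tint t1. u t \<in> lsp wt) \<and>
     (\<forall>t\<in>tint t1. ((\<lambda>s. wnorm wt (ssub (u s) (u t))) \<longlongrightarrow> 0) (at t within tint t1)) \<and>
     (\<forall>t\<in>tint t1. \<forall>n. (\<lambda>s. S (t - s) (Kop k s (u s)) n) integrable_on {0..t}) \<and>
     (\<forall>t\<in>tint t1. \<forall>n. u t n = S t u0 n + integral {0..t} (\<lambda>s. S (t - s) (Kop k s (u s)) n))"

definition max_mild_sol :: "(real \<Rightarrow> (nat \<Rightarrow> real) \<Rightarrow> (nat \<Rightarrow> real)) \<Rightarrow> (nat \<Rightarrow> nat \<Rightarrow> real \<Rightarrow> real)
    \<Rightarrow> (nat \<Rightarrow> real) \<Rightarrow> ereal \<Rightarrow> (nat \<Rightarrow> real) \<Rightarrow> ereal \<Rightarrow> (real \<Rightarrow> nat \<Rightarrow> real) \<Rightarrow> bool" where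
  "max_mild_sol S k wt T u0 t1 u \<longleftrightarrow> mild_sol S k wt T u0 t1 u \<and>
     \<not> (\<exists>t2 v. t1 < t2 \<and> t2 \<le> T \<and> mild_sol S k wt T u0 t2 v \<and> (\<forall>t\<in>tint t1. v t = u t))"

definition max_pos_mild_sol where
  "max_pos_mild_sol S k wt T u0 t1 u \<longleftrightarrow> max_mild_sol S k wt T u0 t1 u \<and>
     (\<forall>t\<in>tint t1. nonneg_seq (u t))"

definition phi1 :: "(nat \<Rightarrow> real) \<Rightarrow> real" where
  "phi1 f = (\<Sum>n. real n * f n)"

end

theory Submission
  imports Defs
begin

text \<open>
  The fragmentation matrix is triangular, so every unit vector lies in a finite-dimensional invariant
  subspace of the generator, and the semigroup is determined by its columns, which solve finite linear
  systems. These give positivity and contractivity in \<open>\<ell>\<^sup>1\<^sub>w\<close>. For \<open>\<kappa> < 1\<close> the total loss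
  \<open>\<integral> \<parallel>A S(t) f\<parallel> dt\<close> is bounded by a multiple of \<open>\<parallel>f\<parallel>\<close>, while \<open>\<parallel>G S(t) f\<parallel>\<close> is nonincreasing in \<open>t\<close>; hence
  \<open>\<parallel>A S(t) f\<parallel> \<le> C \<parallel>f\<parallel> / t\<close>, and \<open>x\<^sup>\<alpha> \<le> 1 + x\<close> interpolates this to the smoothing bound of order \<open>t\<^sup>-\<^sup>\<alpha>\<close>
  from weight \<open>w\<close> to the larger weight. Since the coagulation operator is locally Lipschitz from the larger
  weight to \<open>w\<close>, Picard iteration of the mild equation converges on an interval whose length depends only
  on the norm of the data; uniqueness, stability, continuation and blow-up follow by repeating short steps.
  Positivity and the mass balance are first obtained for truncated kernels and finitely supported data,
  where the equation is an ordinary differential equation, and are then carried to the limit.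
\<close>

subsection \<open>Weighted sequence spaces\<close>

text \<open>The generator is known only through the closure of A + B, and
  \<open>C0_semigroup\<close> bounds each S(t) separately. The hypotheses on \<open>S\<close>
  therefore enter through the generator on unit vectors and one uniform boundedness argument. For
  columns it is right difference quotients that come directly from the semigroup law, so all
  differential inequalities are run with right derivatives.

  Truncation is forced by the loss term: its rate \<Sum> k_{n,j} f_j is controlled only by a
  multiple of (1 + a_n)^\<alpha>, so for \<alpha> > 0 adding a constant multiple of f does not make
  K positive on a ball. In a finite system the sign can instead be read off the squared negative
  parts. The passage back works because mild solutions depend in a Lipschitz way on kernel and data,
  and the weight dominates n, so mass is continuous in the norm.

  The singular kernel t^(-\<alpha>) has an integral that tends to 0 with the step length. Each
  comparison of solutions thus reduces to absorbing half of a finite supremum.\<close>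

lemma lsp_zero: "f \<in> lsp v \<Longrightarrow> f 0 = 0"
  by (simp add: lsp_def)

lemma lsp_term_nonneg:
  assumes "f \<in> lsp v" "\<And>n. n \<ge> 1 \<Longrightarrow> 0 < v n"
  shows "0 \<le> v n * \<bar>f n\<bar>"
  using assms by (cases "n = 0") (auto simp: lsp_def less_imp_le)

lemma wnorm_nonneg:
  assumes "f \<in> lsp v" "\<And>n. n \<ge> 1 \<Longrightarrow> 0 < v n"
  shows "0 \<le> wnorm v f"
  using assms lsp_term_nonneg[OF assms] unfolding wnorm_def
  by (intro suminf_nonneg) (auto simp: lsp_def)

text \<open>Weights are known to be positive only from index 1 on; \<open>f 0 = 0\<close> removes
  the dummy term whatever \<open>v 0\<close> is. Bounds on finite sums yield membership and norm
  together, so no infinite series has to be estimated before it is known to converge.\<close>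

lemma lsp_boundI:
  assumes "f 0 = 0" "\<And>n. n \<ge> 1 \<Longrightarrow> 0 < v n" "\<And>N. (\<Sum>n=1..N. v n * \<bar>f n\<bar>) \<le> C"
  shows "f \<in> lsp v" "wnorm v f \<le> C"
proof -
  have nn: "0 \<le> v n * \<bar>f n\<bar>" for n
    using assms(1,2) by (cases "n = 0") (auto simp: less_imp_le)
  have ps: "(\<Sum>i<n. v i * \<bar>f i\<bar>) \<le> C" for n
  proof -
    have "(\<Sum>i<n. v i * \<bar>f i\<bar>) \<le> (\<Sum>i\<in>insert 0 {1..n}. v i * \<bar>f i\<bar>)"
      by (rule sum_mono2) (auto simp: nn)
    also have "\<dots> \<le> C" using assms(1) assms(3)[of n] by simp
    finally show ?thesis .
  qed
  have s: "summable (\<lambda>n. v n * \<bar>f n\<bar>)"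
    by (rule summableI_nonneg_bounded[OF nn ps])
  show "f \<in> lsp v" using s assms(1) by (simp add: lsp_def)
  show "wnorm v f \<le> C" unfolding wnorm_def by (rule suminf_le_const[OF s ps])
qed

lemma wnorm_sum_le:
  assumes "f \<in> lsp v" "\<And>n. n \<ge> 1 \<Longrightarrow> 0 < v n" "finite I"
  shows "(\<Sum>n\<in>I. v n * \<bar>f n\<bar>) \<le> wnorm v f"
  using assms lsp_term_nonneg[OF assms(1,2)] unfolding wnorm_def
  by (intro sum_le_suminf) (auto simp: lsp_def)

lemma wnorm_comp_le:
  assumes "f \<in> lsp v" "\<And>n. n \<ge> 1 \<Longrightarrow> 0 < v n"
  shows "v n * \<bar>f n\<bar> \<le> wnorm v f"
  using wnorm_sum_le[OF assms, of "{n}"] by simp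

lemma lsp_le:
  assumes "g \<in> lsp v" "\<And>n. n \<ge> 1 \<Longrightarrow> 0 < v n" "f 0 = 0" "\<And>n. \<bar>f n\<bar> \<le> \<bar>g n\<bar>"
  shows "f \<in> lsp v" "wnorm v f \<le> wnorm v g"
proof -
  have "(\<Sum>n=1..N. v n * \<bar>f n\<bar>) \<le> wnorm v g" for N
  proof -
    have "(\<Sum>n=1..N. v n * \<bar>f n\<bar>) \<le> (\<Sum>n=1..N. v n * \<bar>g n\<bar>)"
      using assms by (intro sum_mono mult_left_mono) (auto simp: less_imp_le)
    also have "\<dots> \<le> wnorm v g" using wnorm_sum_le[OF assms(1,2)] by simp
    finally show ?thesis .
  qed
  from lsp_boundI[OF assms(3,2) this] show "f \<in> lsp v" "wnorm v f \<le> wnorm v g" by auto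
qed

lemma lsp_zero_fun: "(\<lambda>n. 0) \<in> lsp v" "wnorm v (\<lambda>n. 0) = 0"
  by (auto simp: lsp_def wnorm_def)

lemma lsp_add:
  assumes "f \<in> lsp v" "g \<in> lsp v" "\<And>n. n \<ge> 1 \<Longrightarrow> 0 < v n"
  shows "(\<lambda>n. f n + g n) \<in> lsp v" "wnorm v (\<lambda>n. f n + g n) \<le> wnorm v f + wnorm v g"
proof -
  have "(\<Sum>n=1..N. v n * \<bar>f n + g n\<bar>) \<le> wnorm v f + wnorm v g" for N
  proof -
    have "(\<Sum>n=1..N. v n * \<bar>f n + g n\<bar>) \<le> (\<Sum>n=1..N. v n * \<bar>f n\<bar> + v n * \<bar>g n\<bar>)"
      using assms(3) by (intro sum_mono) (auto simp: less_imp_le simp flip: distrib_left intro!: mult_left_mono)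
    also have "\<dots> \<le> wnorm v f + wnorm v g"
      using wnorm_sum_le[OF assms(1,3), of "{1..N}"] wnorm_sum_le[OF assms(2,3), of "{1..N}"]
      by (simp add: sum.distrib)
    finally show ?thesis .
  qed
  from lsp_boundI[OF _ assms(3) this] show "(\<lambda>n. f n + g n) \<in> lsp v" "wnorm v (\<lambda>n. f n + g n) \<le> wnorm v f + wnorm v g"
    using assms by (auto simp: lsp_def)
qed

lemma lsp_scale:
  assumes "f \<in> lsp v"
  shows "(\<lambda>n. c * f n) \<in> lsp v" "wnorm v (\<lambda>n. c * f n) = \<bar>c\<bar> * wnorm v f"
proof -
  have e: "(\<lambda>n. v n * \<bar>c * f n\<bar>) = (\<lambda>n. \<bar>c\<bar> * (v n * \<bar>f n\<bar>))" by (auto simp: abs_mult)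
  have s: "summable (\<lambda>n. v n * \<bar>f n\<bar>)" using assms by (simp add: lsp_def)
  show "(\<lambda>n. c * f n) \<in> lsp v" unfolding lsp_def mem_Collect_eq e using assms s by (auto simp: lsp_def)
  show "wnorm v (\<lambda>n. c * f n) = \<bar>c\<bar> * wnorm v f" unfolding wnorm_def e by (rule suminf_mult[OF s])
qed

lemma lsp_diff:
  assumes "f \<in> lsp v" "g \<in> lsp v" "\<And>n. n \<ge> 1 \<Longrightarrow> 0 < v n"
  shows "(\<lambda>n. f n - g n) \<in> lsp v" "wnorm v (\<lambda>n. f n - g n) \<le> wnorm v f + wnorm v g"
  using lsp_add[OF assms(1) lsp_scale(1)[OF assms(2), of "-1"] assms(3)] lsp_scale(2)[OF assms(2), of "-1"]
  by simp_all

lemma wnorm_diff_commute: "wnorm v (\<lambda>n. f n - g n) = wnorm v (\<lambda>n. g n - f n)"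
  by (simp add: wnorm_def abs_minus_commute)

lemma wnorm_triangle:
  assumes "f \<in> lsp v" "g \<in> lsp v" "h \<in> lsp v" "\<And>n. n \<ge> 1 \<Longrightarrow> 0 < v n"
  shows "wnorm v (\<lambda>n. f n - h n) \<le> wnorm v (\<lambda>n. f n - g n) + wnorm v (\<lambda>n. g n - h n)"
  using lsp_add(2)[OF lsp_diff(1)[OF assms(1,2,4)] lsp_diff(1)[OF assms(2,3,4)] assms(4)] by simp

lemma wnorm_triangle_sub:
  assumes "f \<in> lsp v" "g \<in> lsp v" "\<And>n. n \<ge> 1 \<Longrightarrow> 0 < v n"
  shows "wnorm v f \<le> wnorm v g + wnorm v (\<lambda>n. f n - g n)"
  using lsp_add(2)[OF assms(2) lsp_diff(1)[OF assms(1,2,3)] assms(3)] by simp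

lemma wnorm_zero_imp:
  assumes "f \<in> lsp v" "\<And>n. n \<ge> 1 \<Longrightarrow> 0 < v n" "wnorm v f \<le> 0"
  shows "f = (\<lambda>n. 0)"
proof
  fix n
  show "f n = 0"
  proof (cases "n = 0")
    case False
    then have "0 < v n" using assms(2) by simp
    moreover have "v n * \<bar>f n\<bar> \<le> 0" using wnorm_comp_le[OF assms(1,2), of n] assms(3) by simp
    ultimately show ?thesis by (simp add: mult_le_0_iff)
  qed (use assms in \<open>simp add: lsp_def\<close>)
qed

text \<open>Completeness with an explicit rate: the limit is taken coordinate by coordinate, and the
  bound \<open>\<rho> k\<close> passes to it through the finite partial sums as m tends to infinity.
  The rate is what iteration arguments need afterwards.\<close>

lemma lsp_Cauchy_limit:
  assumes x: "\<And>k. x k \<in> lsp v" and v: "\<And>n. n \<ge> 1 \<Longrightarrow> 0 < v n"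
    and c: "\<And>k m. k \<le> m \<Longrightarrow> wnorm v (\<lambda>n. x m n - x k n) \<le> \<rho> k" and \<rho>: "\<rho> \<longlonglongrightarrow> 0"
  obtains l where "l \<in> lsp v" "\<And>k. wnorm v (\<lambda>n. l n - x k n) \<le> \<rho> k" "\<And>n. (\<lambda>k. x k n) \<longlonglongrightarrow> l n"
proof -
  have conv: "convergent (\<lambda>k. x k n)" for n
  proof (cases "n = 0")
    case True
    then show ?thesis using x by (simp add: lsp_def convergent_const)
  next
    case False
    then have vn: "0 < v n" using v by simp
    have d: "\<bar>x m n - x k n\<bar> \<le> \<rho> k / v n" if "k \<le> m" for k m
      using wnorm_comp_le[OF lsp_diff(1)[OF x[of m] x[of k] v] v, of n] c[OF that] vn
      by (simp add: field_simps)
    have "Cauchy (\<lambda>k. x k n)"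
    proof (rule metric_CauchyI)
      fix e :: real assume "e > 0"
      then have "\<forall>\<^sub>F k in sequentially. \<rho> k < v n * e / 2"
        using \<rho> vn by (intro order_tendstoD(2)) auto
      then obtain K where K: "\<And>k. k \<ge> K \<Longrightarrow> \<rho> k < v n * e / 2" by (auto simp: eventually_sequentially)
      have "dist (x m n) (x k n) < e" if "m \<ge> K" "k \<ge> K" for m k
      proof -
        have "\<rho> K / v n < e / 2" using K[of K] vn by (simp add: field_simps)
        then show ?thesis using d[OF that(1)] d[OF that(2)] unfolding dist_real_def by linarith
      qed
      then show "\<exists>M. \<forall>m\<ge>M. \<forall>k\<ge>M. dist (x m n) (x k n) < e" by blast
    qed
    then show ?thesis by (simp add: Cauchy_convergent_iff)
  qed
  define l where "l n = lim (\<lambda>k. x k n)" for n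
  have lim: "(\<lambda>k. x k n) \<longlonglongrightarrow> l n" for n
    using conv[of n] by (simp add: l_def convergent_LIMSEQ_iff)
  have l0: "l 0 = 0" using x by (simp add: l_def lsp_def)
  have bd: "(\<Sum>n=1..N. v n * \<bar>l n - x k n\<bar>) \<le> \<rho> k" for N k
  proof (rule tendsto_upperbound)
    show "(\<lambda>m. \<Sum>n=1..N. v n * \<bar>x m n - x k n\<bar>) \<longlonglongrightarrow> (\<Sum>n=1..N. v n * \<bar>l n - x k n\<bar>)"
      by (intro tendsto_intros lim)
    show "\<forall>\<^sub>F m in sequentially. (\<Sum>n=1..N. v n * \<bar>x m n - x k n\<bar>) \<le> \<rho> k"
      using eventually_ge_at_top[of k]
      by eventually_elim (use wnorm_sum_le[OF lsp_diff(1)[OF x x v] v] c order_trans in \<open>blast\<close>)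
  qed simp
  have dl: "(\<lambda>n. l n - x k n) \<in> lsp v" "wnorm v (\<lambda>n. l n - x k n) \<le> \<rho> k" for k
    using lsp_boundI[OF _ v bd, of k] l0 x[of k] by (auto simp: lsp_def)
  have "l \<in> lsp v" using lsp_add(1)[OF dl(1)[of 0] x[of 0] v] by simp
  with dl(2) lim show thesis using that by blast
qed

lemma lsp_finite_support:
  assumes "f 0 = 0" "\<And>n. n > N \<Longrightarrow> f n = 0"
  shows "f \<in> lsp v"
proof -
  have "summable (\<lambda>n. v n * \<bar>f n\<bar>)"
    by (rule summable_finite[of "{..N}"]) (simp_all add: assms(2))
  then show ?thesis using assms(1) by (simp add: lsp_def)
qed

definition strunc :: "nat \<Rightarrow> (nat \<Rightarrow> real) \<Rightarrow> nat \<Rightarrow> real" where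
  "strunc N f n = (if n \<le> N then f n else 0)"

lemma strunc_lsp: "f \<in> lsp v \<Longrightarrow> strunc N f \<in> lsp v"
  by (rule lsp_finite_support[of _ N]) (auto simp: strunc_def lsp_def)

lemma strunc_norm_le:
  assumes "f \<in> lsp v" "\<And>n. n \<ge> 1 \<Longrightarrow> 0 < v n"
  shows "wnorm v (strunc N f) \<le> wnorm v f"
  by (rule lsp_le[OF assms]) (use assms(1) in \<open>auto simp: strunc_def lsp_def\<close>)

lemma strunc_tendsto:
  assumes "f \<in> lsp v"
  shows "(\<lambda>N. wnorm v (\<lambda>n. f n - strunc N f n)) \<longlonglongrightarrow> 0"
proof -
  let ?g = "\<lambda>n. v n * \<bar>f n\<bar>"
  have s: "summable ?g" using assms by (simp add: lsp_def)
  \<comment> \<open>Since \<open>strunc N\<close> keeps the coordinate N, the removed partial sum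
    runs over \<open>{..<Suc N}\<close>.\<close>
  have "wnorm v (\<lambda>n. f n - strunc N f n) = suminf ?g - sum ?g {..<Suc N}" for N
  proof -
    have "(\<lambda>n. ?g n - (if n \<in> {..<Suc N} then ?g n else 0)) sums (suminf ?g - sum ?g {..<Suc N})"
      by (intro sums_diff summable_sums s sums_If_finite_set) auto
    moreover have "(\<lambda>n. ?g n - (if n \<in> {..<Suc N} then ?g n else 0)) = (\<lambda>n. v n * \<bar>f n - strunc N f n\<bar>)"
      by (auto simp: strunc_def)
    ultimately show ?thesis unfolding wnorm_def by (simp add: sums_iff)
  qed
  moreover have "(\<lambda>N. suminf ?g - sum ?g {..<Suc N}) \<longlonglongrightarrow> suminf ?g - suminf ?g"
    by (intro tendsto_intros LIMSEQ_Suc summable_LIMSEQ s)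
  ultimately show ?thesis by simp
qed

subsection \<open>One-sided derivatives\<close>

text \<open>A slope e > 0 is granted to f. The points up to which f stays below the line of slope e
  through the initial value have a supremum that still satisfies the bound by continuity from the
  left; a right derivative below e pushes it further unless it is b. Letting e tend to 0 gives the
  claim.\<close>

lemma right_deriv_nonpos_imp_le:
  fixes f :: "real \<Rightarrow> real"
  assumes ab: "a \<le> b" and cont: "continuous_on {a..b} f"
    and der: "\<And>x. a \<le> x \<Longrightarrow> x < b \<Longrightarrow> (f has_real_derivative f' x) (at_right x)"
    and neg: "\<And>x. a \<le> x \<Longrightarrow> x < b \<Longrightarrow> f' x \<le> 0"
  shows "f b \<le> f a"
proof (rule field_le_epsilon)
  fix e0 :: real assume "e0 > 0"
  \<comment> \<open>The total rise e * (b - a) must be at most \<open>e0\<close>; the summand 1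
    covers a = b.\<close>
  define e where "e = e0 / (b - a + 1)"
  have e: "e > 0" using \<open>e0 > 0\<close> ab by (simp add: e_def)
  define A where "A = {x \<in> {a..b}. \<forall>y\<in>{a..x}. f y \<le> f a + e * (y - a)}"
  define c where "c = Sup A"
  have aA: "a \<in> A" using ab by (auto simp: A_def)
  have bdd: "bdd_above A" by (auto simp: A_def intro!: bdd_aboveI[of _ b])
  have ac: "a \<le> c" using aA bdd by (simp add: c_def cSup_upper)
  have cb: "c \<le> b" using aA unfolding c_def by (intro cSup_least) (auto simp: A_def)
  have lt: "f y \<le> f a + e * (y - a)" if y: "a \<le> y" "y < c" for y
  proof -
    obtain x where "x \<in> A" "y < x" using y(2) less_cSup_iff[of A y] aA bdd unfolding c_def by blast
    then show ?thesis using y(1) by (auto simp: A_def)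
  qed
  have fc: "f c \<le> f a + e * (c - a)"
  proof (cases "c = a")
    case False
    with ac have "a < c" by simp
    have "((\<lambda>y. f y - e * (y - a)) \<longlongrightarrow> f c - e * (c - a)) (at c within {a..b})"
      using cont ac cb by (intro tendsto_intros) (auto simp: continuous_on)
    then have "((\<lambda>y. f y - e * (y - a)) \<longlongrightarrow> f c - e * (c - a)) (at c within {a..c})"
      by (rule tendsto_within_subset) (use cb in auto)
    moreover have "at c within {a..c} = at_left c"
      using \<open>a < c\<close> by (simp add: at_within_Icc_at_left)
    ultimately have "((\<lambda>y. f y - e * (y - a)) \<longlongrightarrow> f c - e * (c - a)) (at_left c)" by simp
    moreover have "\<forall>\<^sub>F y in at_left c. f y - e * (y - a) \<le> f a"
      using eventually_at_left_real[OF \<open>a < c\<close>] by eventually_elim (use lt in \<open>auto simp: algebra_simps\<close>)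
    ultimately have "f c - e * (c - a) \<le> f a" by (intro tendsto_upperbound[of _ _ "at_left c"]) auto
    then show ?thesis by simp
  qed simp
  have "c = b"
  proof (rule ccontr)
    assume "c \<noteq> b"
    with cb have "c < b" by simp
    from der[OF ac this] have "((\<lambda>y. (f y - f c) / (y - c)) \<longlongrightarrow> f' c) (at_right c)"
      by (simp add: has_field_derivative_iff)
    moreover have "f' c < e" using neg[OF ac \<open>c < b\<close>] e by simp
    ultimately have "\<forall>\<^sub>F y in at_right c. (f y - f c) / (y - c) < e" by (rule order_tendstoD(2))
    then obtain d where d: "d > c" "\<And>y. c < y \<Longrightarrow> y < d \<Longrightarrow> (f y - f c) / (y - c) < e"
      unfolding eventually_at_right_field by blast
    \<comment> \<open>A point strictly beyond c where all quotients based at c are still below e; it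
      belongs to A and contradicts the choice of c as supremum.\<close>
    define x where "x = min ((c + d) / 2) b"
    have x: "c < x" "x < d" "x \<le> b" using d(1) \<open>c < b\<close> by (auto simp: x_def min_def field_simps)
    have "x \<in> A"
    proof -
      have "f y \<le> f a + e * (y - a)" if "a \<le> y" "y \<le> x" for y
      proof (cases "y \<le> c")
        case True
        then show ?thesis using lt[OF that(1)] fc by (cases "y = c") auto
      next
        case False
        then have "(f y - f c) / (y - c) < e" using d(2) x that by auto
        then have "f y - f c < e * (y - c)" using False by (simp add: field_simps)
        then show ?thesis using fc by (simp add: algebra_simps)
      qed
      then show ?thesis using x ac by (auto simp: A_def)
    qed
    then have "x \<le> c" using bdd by (simp add: c_def cSup_upper)
    with x show False by simp
  qed
  with fc have "f b \<le> f a + e * (b - a)" by simp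
  also have "e * (b - a) \<le> e0" using ab \<open>e0 > 0\<close> by (simp add: e_def field_simps)
  finally show "f b \<le> f a + e0" by simp
qed

lemma right_deriv_zero_imp_eq:
  fixes f :: "real \<Rightarrow> real"
  assumes "a \<le> b" "continuous_on {a..b} f"
    and "\<And>x. a \<le> x \<Longrightarrow> x < b \<Longrightarrow> (f has_real_derivative 0) (at_right x)"
  shows "f b = f a"
proof (rule antisym)
  show "f b \<le> f a" by (rule right_deriv_nonpos_imp_le[OF assms]) auto
  have "- f b \<le> - f a"
  proof (rule right_deriv_nonpos_imp_le[of a b "\<lambda>x. - f x" "\<lambda>x. - 0"])
    show "((\<lambda>x. - f x) has_real_derivative - 0) (at_right x)" if "a \<le> x" "x < b" for x
      using DERIV_minus[OF assms(3)[OF that]] .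
  qed (use assms(1,2) in \<open>auto intro!: continuous_intros\<close>)
  then show "f a \<le> f b" by simp
qed

subsection \<open>Uniform boundedness and strong continuity\<close>

text \<open>A gliding hump: each radius is chosen after the operator it has to control, so operator norms
  are not needed.\<close>

lemma lsp_uniform_boundedness:
  fixes T :: "nat \<Rightarrow> (nat \<Rightarrow> real) \<Rightarrow> nat \<Rightarrow> real"
  assumes v: "\<And>n. n \<ge> 1 \<Longrightarrow> 0 < v n"
    and maps: "\<And>i f. f \<in> lsp v \<Longrightarrow> T i f \<in> lsp v"
    and add: "\<And>i f g. f \<in> lsp v \<Longrightarrow> g \<in> lsp v \<Longrightarrow> T i (\<lambda>n. f n + g n) = (\<lambda>n. T i f n + T i g n)"
    and scale: "\<And>i f c. f \<in> lsp v \<Longrightarrow> T i (\<lambda>n. c * f n) = (\<lambda>n. c * T i f n)"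
    and bd: "\<And>i. \<exists>M. \<forall>f\<in>lsp v. wnorm v (T i f) \<le> M * wnorm v f"
    and pt: "\<And>f. f \<in> lsp v \<Longrightarrow> \<exists>B. \<forall>i. wnorm v (T i f) \<le> B"
  shows "\<exists>M. \<forall>i. \<forall>f\<in>lsp v. wnorm v (T i f) \<le> M * wnorm v f"
proof (rule ccontr)
  assume "\<not> ?thesis"
  then have unb: "\<exists>i. \<exists>f\<in>lsp v. M * wnorm v f < wnorm v (T i f)" for M by (auto simp: not_le)
  have "\<exists>Mb. \<forall>i. \<forall>f\<in>lsp v. wnorm v (T i f) \<le> Mb i * wnorm v f"
    using bd by metis
  then obtain Mb0 where Mb0: "\<And>i f. f \<in> lsp v \<Longrightarrow> wnorm v (T i f) \<le> Mb0 i * wnorm v f" by blast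
  define Mb where "Mb i = \<bar>Mb0 i\<bar> + 1" for i
  have Mb: "wnorm v (T i f) \<le> Mb i * wnorm v f" if "f \<in> lsp v" for i f
  proof -
    have "Mb0 i * wnorm v f \<le> Mb i * wnorm v f"
      using wnorm_nonneg[OF that v] by (intro mult_right_mono) (auto simp: Mb_def)
    then show ?thesis using Mb0[OF that, of i] by simp
  qed
  have Mbpos: "Mb i > 0" for i by (simp add: Mb_def add_nonneg_pos)
  have diff: "T i (\<lambda>n. f n - g n) = (\<lambda>n. T i f n - T i g n)" if "f \<in> lsp v" "g \<in> lsp v" for i f g
    using add[OF that(1) lsp_scale(1)[OF that(2), of "-1"], of i] scale[OF that(2), of i "-1"] by simp
  \<comment> \<open>Every ball contains a vector with a large image. If \<open>T i h\<close> is
    large for some h of norm r, it is half the difference of the images of x + h and x - h, so one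
    of these two is at least as large.\<close>
  have step: "\<exists>i x'. x' \<in> lsp v \<and> wnorm v (\<lambda>n. x' n - x n) \<le> r \<and> K < wnorm v (T i x')"
    if x: "x \<in> lsp v" and r: "r > 0" and K: "K > 0" for x r K
  proof -
    obtain i g where g: "g \<in> lsp v" "K / r * wnorm v g < wnorm v (T i g)" using unb by blast
    have gpos: "0 < wnorm v g"
    proof (rule ccontr)
      assume "\<not> ?thesis"
      then have "wnorm v g = 0" using wnorm_nonneg[OF g(1) v] by simp
      then show False using g(2) Mb[OF g(1), of i] by simp
    qed
    define h where "h = (\<lambda>n. r / wnorm v g * g n)"
    have h: "h \<in> lsp v" "wnorm v h = r"
      using lsp_scale[OF g(1), of "r / wnorm v g"] gpos r by (simp_all add: h_def)
    have Th: "T i h = (\<lambda>n. r / wnorm v g * T i g n)"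
      unfolding h_def by (rule scale[OF g(1)])
    have "wnorm v (T i h) = r / wnorm v g * wnorm v (T i g)"
      unfolding Th using lsp_scale(2)[OF maps[OF g(1), of i], of "r / wnorm v g"] gpos r by simp
    then have "wnorm v g * K < wnorm v g * wnorm v (T i h)"
      using g(2) gpos r by (simp add: field_simps)
    then have "K < wnorm v (T i h)" using gpos by (simp add: mult_less_cancel_left_pos)
    have xa: "(\<lambda>n. x n + h n) \<in> lsp v" and xd: "(\<lambda>n. x n - h n) \<in> lsp v"
      using lsp_add[OF x h(1) v] lsp_diff[OF x h(1) v] by auto
    have "T i h = (\<lambda>n. 1/2 * (T i (\<lambda>n. x n + h n) n - T i (\<lambda>n. x n - h n) n))"
      by (simp add: add[OF x h(1)] diff[OF x h(1)])
    then have "wnorm v (T i h) = 1/2 * wnorm v (\<lambda>n. T i (\<lambda>n. x n + h n) n - T i (\<lambda>n. x n - h n) n)"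
      using lsp_scale(2)[OF lsp_diff(1)[OF maps[OF xa, of i] maps[OF xd, of i] v], of "1/2"] by simp
    also have "\<dots> \<le> 1/2 * (wnorm v (T i (\<lambda>n. x n + h n)) + wnorm v (T i (\<lambda>n. x n - h n)))"
      using lsp_diff(2)[OF maps[OF xa] maps[OF xd] v] by simp
    finally have "K < wnorm v (T i (\<lambda>n. x n + h n)) \<or> K < wnorm v (T i (\<lambda>n. x n - h n))"
      using \<open>K < wnorm v (T i h)\<close> by argo
    moreover have "wnorm v (\<lambda>n. - h n) = r" using lsp_scale(2)[OF h(1), of "-1"] h(2) by simp
    ultimately show ?thesis
      using h(2) xa xd by (elim disjE) (rule exI[of _ i]; force)+
  qed
  \<comment> \<open>A state consists of a centre, a radius and an operator index. The condition
    \<open>2 * r * Mb i \<le> 1\<close> says that \<open>T i\<close> varies by at most 1 from the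
    centre over the ball of radius 2r, and halving the radii keeps the final limit inside that
    ball.\<close>
  define P where "P n z \<longleftrightarrow> (case z of (x, r, i) \<Rightarrow> x \<in> lsp v \<and> r > 0 \<and> real n < wnorm v (T i x) \<and> 2 * r * Mb i \<le> 1)"
    for n :: nat and z :: "(nat \<Rightarrow> real) \<times> real \<times> nat"
  define Q where "Q (n::nat) z z' \<longleftrightarrow> (case z of (x, r, i) \<Rightarrow> case z' of (x', r', i') \<Rightarrow>
      wnorm v (\<lambda>n. x' n - x n) \<le> r \<and> r' \<le> r / 2)"
    for n and z z' :: "(nat \<Rightarrow> real) \<times> real \<times> nat"
  have P0: "\<exists>z. P 0 z"
  proof -
    obtain i x' where "x' \<in> lsp v" "1 < wnorm v (T i x')"
      using step[OF lsp_zero_fun(1), of 1 1] by auto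
    then have "P 0 (x', 1 / (2 * Mb i), i)" using Mbpos[of i] by (auto simp: P_def)
    then show ?thesis by blast
  qed
  have PS: "\<exists>z'. P (Suc n) z' \<and> Q n z z'" if "P n z" for n z
  proof -
    obtain x r i where z: "z = (x, r, i)" by (cases z) auto
    have xr: "x \<in> lsp v" "r > 0" using that by (auto simp: P_def z)
    obtain j x' where x': "x' \<in> lsp v" "wnorm v (\<lambda>n. x' n - x n) \<le> r" "real (Suc n) < wnorm v (T j x')"
      using step[OF xr, of "real (Suc n)"] by auto
    define r' where "r' = min (r / 2) (1 / (2 * Mb j))"
    have "r' \<le> 1 / (2 * Mb j)" by (simp add: r'_def)
    then have "2 * r' * Mb j \<le> 1" using Mbpos[of j] by (simp add: field_simps)
    moreover have "r' > 0" "r' \<le> r / 2" using xr Mbpos[of j] by (auto simp: r'_def)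
    ultimately have "P (Suc n) (x', r', j) \<and> Q n z (x', r', j)"
      using x' by (auto simp: P_def Q_def z)
    then show ?thesis by blast
  qed
  obtain Z where Z: "\<And>n. P n (Z n)" "\<And>n. Q n (Z n) (Z (Suc n))"
    using dependent_nat_choice[of P Q, OF P0 PS] by blast
  define x r i where "x n = fst (Z n)" and "r n = fst (snd (Z n))" and "i n = snd (snd (Z n))" for n
  have p: "x n \<in> lsp v" "r n > 0" "real n < wnorm v (T (i n) (x n))" "2 * r n * Mb (i n) \<le> 1" for n
    using Z(1)[of n] by (auto simp: P_def x_def r_def i_def split: prod.splits)
  have q: "wnorm v (\<lambda>m. x (Suc n) m - x n m) \<le> r n" "r (Suc n) \<le> r n / 2" for n
    using Z(2)[of n] by (auto simp: Q_def x_def r_def i_def split: prod.splits)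
  have rk: "r n \<le> r 0 * (1/2)^n" for n
  proof (induction n)
    case (Suc n)
    then show ?case using q(2)[of n] by simp
  qed simp
  have r0: "r \<longlonglongrightarrow> 0"
  proof (rule tendsto_sandwich[of "\<lambda>_. 0" _ _ "\<lambda>n. r 0 * (1/2)^n"])
    show "(\<lambda>n. r 0 * (1/2)^n) \<longlonglongrightarrow> 0"
      using tendsto_mult_left[OF LIMSEQ_power_zero[of "1/2::real"], of "r 0"] by simp
  qed (use p(2) rk in \<open>auto simp: less_imp_le\<close>)
  \<comment> \<open>Telescoping: a step of length at most r m is at most 2 r m - 2 r (m+1), because
    the radii at least halve.\<close>
  have cau: "wnorm v (\<lambda>n. x m n - x k n) \<le> 2 * r k - 2 * r m" if "k \<le> m" for k m
    using that
  proof (induction m rule: dec_induct)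
    case base
    then show ?case by (simp add: lsp_zero_fun)
  next
    case (step m)
    have "wnorm v (\<lambda>n. x (Suc m) n - x k n) \<le> wnorm v (\<lambda>n. x (Suc m) n - x m n) + wnorm v (\<lambda>n. x m n - x k n)"
      by (rule wnorm_triangle[OF p(1) p(1) p(1) v])
    then show ?case using step q[of m] by linarith
  qed
  obtain l where l: "l \<in> lsp v" "\<And>k. wnorm v (\<lambda>n. l n - x k n) \<le> 2 * r k"
  proof (rule lsp_Cauchy_limit[of x v "\<lambda>k. 2 * r k"])
    show "wnorm v (\<lambda>n. x m n - x k n) \<le> 2 * r k" if "k \<le> m" for k m
      using cau[OF that] p(2)[of m] by simp
    show "(\<lambda>k. 2 * r k) \<longlonglongrightarrow> 0" using tendsto_mult_left[OF r0, of 2] by simp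
  qed (use p v that in auto)
  obtain B where B: "\<And>i. wnorm v (T i l) \<le> B" using pt[OF l(1)] by blast
  \<comment> \<open>At the k-th centre the operator exceeds k, and at the limit l it differs from
    that by at most 1, so the bound B for the orbit of l would bound all integers.\<close>
  have "real k \<le> B + 1" for k
  proof -
    have "wnorm v (T (i k) (x k)) \<le> wnorm v (T (i k) l) + wnorm v (\<lambda>n. T (i k) (x k) n - T (i k) l n)"
      by (rule wnorm_triangle_sub[OF maps[OF p(1)] maps[OF l(1)] v])
    also have "wnorm v (\<lambda>n. T (i k) (x k) n - T (i k) l n) = wnorm v (T (i k) (\<lambda>n. x k n - l n))"
      by (simp add: diff[OF p(1) l(1)])
    also have "\<dots> \<le> Mb (i k) * wnorm v (\<lambda>n. x k n - l n)"
      by (rule Mb[OF lsp_diff(1)[OF p(1) l(1) v]])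
    also have "\<dots> \<le> Mb (i k) * (2 * r k)"
      using l(2)[of k] Mbpos[of "i k"] by (simp add: wnorm_diff_commute[of v "x k" l])
    also have "\<dots> \<le> 1" using p(4)[of k] by (simp add: mult.commute)
    finally show ?thesis using p(3)[of k] B[of "i k"] by simp
  qed
  then show False using reals_Archimedean2[of "B + 1"] by (meson not_le)
qed

section \<open>Local boundedness and orbit continuity of strongly continuous semigroups\<close>

locale c0_semigroup =
  fixes w :: "nat \<Rightarrow> real" and S :: "real \<Rightarrow> (nat \<Rightarrow> real) \<Rightarrow> nat \<Rightarrow> real"
  assumes wpos: "\<And>n. n \<ge> 1 \<Longrightarrow> 0 < w n" and C0: "C0_semigroup w S"
begin

lemma S_lsp: "t \<ge> 0 \<Longrightarrow> f \<in> lsp w \<Longrightarrow> S t f \<in> lsp w"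
  using C0 by (simp add: C0_semigroup_def)

lemma S_add: "t \<ge> 0 \<Longrightarrow> f \<in> lsp w \<Longrightarrow> g \<in> lsp w \<Longrightarrow> S t (\<lambda>n. f n + g n) = (\<lambda>n. S t f n + S t g n)"
  using C0 unfolding C0_semigroup_def sadd_def by blast

lemma S_scale: "t \<ge> 0 \<Longrightarrow> f \<in> lsp w \<Longrightarrow> S t (\<lambda>n. c * f n) = (\<lambda>n. c * S t f n)"
  using C0 unfolding C0_semigroup_def sscale_def by blast

lemma S_diff: "t \<ge> 0 \<Longrightarrow> f \<in> lsp w \<Longrightarrow> g \<in> lsp w \<Longrightarrow> S t (\<lambda>n. f n - g n) = (\<lambda>n. S t f n - S t g n)"
  using S_add[OF _ _ lsp_scale(1), of t f g "-1"] S_scale[of t g "-1"] by simp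

lemma S_zero_time: "f \<in> lsp w \<Longrightarrow> S 0 f = f"
  using C0 by (simp add: C0_semigroup_def)

lemma S_semigroup: "s \<ge> 0 \<Longrightarrow> t \<ge> 0 \<Longrightarrow> f \<in> lsp w \<Longrightarrow> S (s + t) f = S s (S t f)"
  using C0 by (simp add: C0_semigroup_def)

lemma S_bounded: "t \<ge> 0 \<Longrightarrow> \<exists>M. \<forall>f\<in>lsp w. wnorm w (S t f) \<le> M * wnorm w f"
  using C0 by (simp add: C0_semigroup_def)

lemma S_tendsto: "f \<in> lsp w \<Longrightarrow> ((\<lambda>h. wnorm w (\<lambda>n. S h f n - f n)) \<longlongrightarrow> 0) (at_right 0)"
  using C0 by (simp add: C0_semigroup_def ssub_def)

text \<open>If no uniform bound held near 0, there would be times \<open>t n\<close> tending to 0 at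
  which S exceeds the factor n. Each single orbit is bounded along these times, since it converges
  to its initial value, which contradicts uniform boundedness.\<close>

lemma S_locally_bounded:
  "\<exists>d>0. \<exists>M. \<forall>t\<in>{0..d}. \<forall>f\<in>lsp w. wnorm w (S t f) \<le> M * wnorm w f"
proof (rule ccontr)
  assume neg: "\<not> ?thesis"
  have "\<exists>t\<in>{0..1 / real (Suc n)}. \<exists>f\<in>lsp w. real n * wnorm w f < wnorm w (S t f)" for n
  proof (rule ccontr)
    assume "\<not> ?thesis"
    then have "\<forall>t\<in>{0..1 / real (Suc n)}. \<forall>f\<in>lsp w. wnorm w (S t f) \<le> real n * wnorm w f"
      by (auto simp only: bex_simps not_less)
    moreover have "1 / real (Suc n) > 0" by simp
    ultimately show False using neg by blast
  qed
  then obtain t f where tf: "\<And>n. t n \<in> {0..1 / real (Suc n)}" "\<And>n. f n \<in> lsp w"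
      "\<And>n. real n * wnorm w (f n) < wnorm w (S (t n) (f n))"
    by metis
  have t0: "0 \<le> t n" for n using tf(1)[of n] by simp
  have "\<exists>M. \<forall>i. \<forall>f\<in>lsp w. wnorm w (S (t i) f) \<le> M * wnorm w f"
  proof (rule lsp_uniform_boundedness[OF wpos])
    fix g assume g: "g \<in> lsp w"
    have "\<forall>\<^sub>F h in at_right 0. wnorm w (\<lambda>n. S h g n - g n) < 1"
      using S_tendsto[OF g] by (rule order_tendstoD(2)) simp
    then obtain d where d: "d > 0" "\<And>h. 0 < h \<Longrightarrow> h < d \<Longrightarrow> wnorm w (\<lambda>n. S h g n - g n) < 1"
      unfolding eventually_at_right_field by auto
    obtain N where N: "1 / d < real N" using reals_Archimedean2 by blast
    \<comment> \<open>Times with index above N are so small that the orbit is within 1 of g; the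
      remaining finitely many are covered by the maximum.\<close>
    define B where "B = Max (insert (wnorm w g + 1) ((\<lambda>i. wnorm w (S (t i) g)) ` {..N}))"
    have "wnorm w (S (t i) g) \<le> B" for i
    proof (cases "i \<le> N")
      case True
      then show ?thesis unfolding B_def by (intro Max_ge) auto
    next
      case False
      have "1 < real N * d" using N d(1) by (simp add: field_simps)
      also have "\<dots> \<le> real (Suc i) * d" using False d(1) by (intro mult_right_mono) auto
      finally have "1 / real (Suc i) < d" by (simp add: divide_less_eq mult.commute del: of_nat_Suc)
      then have "t i < d" using tf(1)[of i] by simp
      then have "wnorm w (S (t i) g) \<le> wnorm w g + 1"
        using d(2)[of "t i"] t0[of i] S_zero_time[OF g] wnorm_triangle_sub[OF S_lsp[OF t0 g] g wpos, of i]
        by (cases "t i = 0") auto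
      also have "\<dots> \<le> B" unfolding B_def by (intro Max_ge) auto
      finally show ?thesis .
    qed
    then show "\<exists>B. \<forall>i. wnorm w (S (t i) g) \<le> B" by blast
  qed (use t0 S_lsp S_add S_scale S_bounded in auto)
  then obtain M where M: "\<And>i f. f \<in> lsp w \<Longrightarrow> wnorm w (S (t i) f) \<le> M * wnorm w f" by blast
  obtain n where n: "M < real n" using reals_Archimedean2 by blast
  have "M * wnorm w (f n) \<le> real n * wnorm w (f n)"
    using n wnorm_nonneg[OF tf(2) wpos, of n] by (intro mult_right_mono) auto
  then show False using M[OF tf(2), of n n] tf(3)[of n] by simp
qed

text \<open>A time up to b is cut into k pieces of length at most d, each costing a factor M. Taking
  M at least 1 makes \<open>M ^ k\<close> valid for shorter times too.\<close>

lemma S_bounded_on: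
  "\<exists>M\<ge>0. \<forall>t\<in>{0..b}. \<forall>f\<in>lsp w. wnorm w (S t f) \<le> M * wnorm w f"
proof -
  obtain d M0 where d: "d > 0" and M0: "\<And>t f. 0 \<le> t \<Longrightarrow> t \<le> d \<Longrightarrow> f \<in> lsp w \<Longrightarrow> wnorm w (S t f) \<le> M0 * wnorm w f"
    using S_locally_bounded by fastforce
  define M where "M = max M0 1"
  have M: "M \<ge> 1" by (simp add: M_def)
  have MM: "wnorm w (S t f) \<le> M * wnorm w f" if "0 \<le> t" "t \<le> d" "f \<in> lsp w" for t f
    using M0[OF that] mult_right_mono[OF _ wnorm_nonneg[OF that(3) wpos], of M0 M] by (simp add: M_def)
  have st: "wnorm w (S t f) \<le> M ^ k * wnorm w f" if "0 \<le> t" "t \<le> real k * d" "f \<in> lsp w" for t f k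
    using that
  proof (induction k arbitrary: t f)
    case 0
    then show ?case by (simp add: S_zero_time)
  next
    case (Suc k)
    define r where "r = min t d"
    have r: "0 \<le> r" "r \<le> d" "0 \<le> t - r" "t - r \<le> real k * d"
      using Suc.prems d by (auto simp: r_def min_def algebra_simps)
    have "S t f = S (t - r) (S r f)" using S_semigroup[OF r(3,1) Suc.prems(3)] by simp
    then have "wnorm w (S t f) \<le> M ^ k * wnorm w (S r f)"
      using Suc.IH[OF r(3,4) S_lsp[OF r(1) Suc.prems(3)]] by simp
    also have "\<dots> \<le> M ^ k * (M * wnorm w f)"
      using MM[OF r(1,2) Suc.prems(3)] M by (intro mult_left_mono) auto
    finally show ?case by (simp add: mult.assoc mult.left_commute mult.commute)
  qed
  obtain k :: nat where k: "b / d < real k" using reals_Archimedean2 by blast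
  then have "b \<le> real k * d" using d by (simp add: field_simps)
  then have "\<forall>t\<in>{0..b}. \<forall>f\<in>lsp w. wnorm w (S t f) \<le> M ^ k * wnorm w f"
    using st by force
  then show ?thesis using M by (intro exI[of _ "M ^ k"]) auto
qed

text \<open>Strong continuity is assumed only at 0 from the right. For p < q the difference of the
  orbit is S(p) applied to S(q - p) f - f; with the local bound on S(p) this is small whichever of p
  and q is the fixed time, so continuity is two-sided.\<close>

lemma S_comp_continuous:
  assumes f: "f \<in> lsp w"
  shows "continuous_on {0..} (\<lambda>t. S t f n)"
proof (cases "n = 0")
  case True
  have "S t f 0 = 0" if "t \<in> {0..}" for t using S_lsp[OF _ f] that by (auto simp: lsp_def)
  then have "continuous_on {0..} (\<lambda>t. S t f 0)"
    by (intro continuous_on_eq[OF continuous_on_const[of "{0..}" 0]]) auto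
  then show ?thesis using True by simp
next
  case False
  then have wn: "0 < w n" using wpos by simp
  show ?thesis unfolding continuous_on_iff
  proof (intro ballI allI impI)
    fix t e :: real assume t: "t \<in> {0..}" and e: "e > 0"
    obtain M where M: "M \<ge> 0" "\<And>s f. 0 \<le> s \<Longrightarrow> s \<le> t + 1 \<Longrightarrow> f \<in> lsp w \<Longrightarrow> wnorm w (S s f) \<le> M * wnorm w f"
      using S_bounded_on[of "t + 1"] by force
    have "\<forall>\<^sub>F h in at_right 0. wnorm w (\<lambda>n. S h f n - f n) < e * w n / (M + 1)"
      using S_tendsto[OF f] by (rule order_tendstoD(2)) (use e wn M in auto)
    then obtain d where d: "d > 0" "\<And>h. 0 < h \<Longrightarrow> h < d \<Longrightarrow> wnorm w (\<lambda>n. S h f n - f n) < e * w n / (M + 1)"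
      unfolding eventually_at_right_field by auto
    have key: "\<bar>S q f n - S p f n\<bar> < e" if "0 \<le> p" "p < q" "q - p < d" "p \<le> t + 1" for p q
    proof -
      have hl: "(\<lambda>n. S (q - p) f n - f n) \<in> lsp w" using lsp_diff(1)[OF S_lsp f wpos] that f by simp
      have eq: "(\<lambda>n. S q f n - S p f n) = S p (\<lambda>n. S (q - p) f n - f n)"
        using S_diff[OF _ S_lsp f, of p "q-p" f] S_semigroup[of p "q-p" f] that f by simp
      have "w n * \<bar>S q f n - S p f n\<bar> \<le> wnorm w (S p (\<lambda>n. S (q - p) f n - f n))"
        using wnorm_comp_le[OF S_lsp[OF that(1) hl] wpos, of n] unfolding eq[symmetric] by simp
      also have "\<dots> \<le> M * wnorm w (\<lambda>n. S (q - p) f n - f n)"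
        using M(2)[OF that(1,4) hl] .
      also have "\<dots> \<le> M * (e * w n / (M + 1))"
        using d(2)[of "q-p"] that M by (intro mult_left_mono) auto
      also have "\<dots> < e * w n" using M e wn by (simp add: field_simps)
      finally show ?thesis using wn by (simp add: mult.commute)
    qed
    show "\<exists>d>0. \<forall>s\<in>{0..}. dist s t < d \<longrightarrow> dist (S s f n) (S t f n) < e"
    proof (intro exI[of _ "min d 1"] conjI ballI impI)
      fix s assume s: "s \<in> {0..}" "dist s t < min d 1"
      consider "s < t" | "s = t" | "t < s" by linarith
      then show "dist (S s f n) (S t f n) < e"
        using key[of s t] key[of t s] s t e by cases (auto simp: dist_real_def abs_minus_commute)
    qed (use d in auto)
  qed
qed

end

subsection \<open>The columns of the fragmentation semigroup\<close>

definition basis_seq :: "nat \<Rightarrow> nat \<Rightarrow> real" where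
  "basis_seq j n = (if n = j then 1 else 0)"

lemma basis_seq_lsp: "j \<ge> 1 \<Longrightarrow> basis_seq j \<in> lsp v"
  by (rule lsp_finite_support[of _ j]) (auto simp: basis_seq_def)

lemma finite_support_expand:
  assumes "f 0 = 0" "\<And>n. n > N \<Longrightarrow> f n = 0"
  shows "f = (\<lambda>n. \<Sum>j\<in>{1..N}. f j * basis_seq j n)"
proof
  fix n
  have "(\<Sum>j\<in>{1..N}. f j * basis_seq j n) = (\<Sum>j\<in>{1..N}. if j = n then f j else 0)"
    by (rule sum.cong) (auto simp: basis_seq_def)
  then show "f n = (\<Sum>j\<in>{1..N}. f j * basis_seq j n)" using assms by (auto simp: not_le Suc_le_eq)
qed

lemma powr_le_one_plus:
  assumes "0 \<le> x" "0 \<le> \<alpha>" "\<alpha> \<le> 1"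
  shows "x powr \<alpha> \<le> 1 + (x::real)"
proof (cases "x \<le> 1")
  case True
  then have "x powr \<alpha> \<le> 1" using assms by (simp add: powr_le1)
  then show ?thesis using assms by simp
next
  case False
  then have "x powr \<alpha> \<le> x powr 1" using assms by (intro powr_mono) auto
  then show ?thesis using False by simp
qed

lemma has_right_derivI:
  fixes f :: "real \<Rightarrow> real"
  assumes "((\<lambda>h. (f (h + t) - f t) / h) \<longlongrightarrow> D) (at_right 0)"
  shows "(f has_real_derivative D) (at_right t)"
  unfolding has_field_derivative_iff by (subst at_right_to_0) (use assms in \<open>simp add: filterlim_filtermap\<close>)

text \<open>Fragmentation without coagulation. The only link between \<open>S\<close> and the
  coefficients is \<open>gen\<close>; positivity and contractivity are consequences proved
  below.\<close>

locale frag_columns = c0_semigroup w S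
  for w :: "nat \<Rightarrow> real" and S :: "real \<Rightarrow> (nat \<Rightarrow> real) \<Rightarrow> nat \<Rightarrow> real" +
  fixes a :: "nat \<Rightarrow> real" and b :: "nat \<Rightarrow> nat \<Rightarrow> real" and \<kappa> :: real
  assumes a_nn: "\<And>n. n \<ge> 1 \<Longrightarrow> 0 \<le> a n"
    and b_nn: "\<And>n j. n \<ge> 1 \<Longrightarrow> j \<ge> 1 \<Longrightarrow> 0 \<le> b n j"
    and b_z: "\<And>n j. n \<ge> 1 \<Longrightarrow> j \<le> n \<Longrightarrow> b n j = 0"
    and kap: "0 < \<kappa>" "\<kappa> \<le> 1"
    and w_frag: "\<And>j. j \<ge> 2 \<Longrightarrow> (\<Sum>n=1..j-1. w n * b n j) \<le> \<kappa> * w j"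
    and gen: "generator_graph w S = graphG w a b"
begin

definition col :: "nat \<Rightarrow> nat \<Rightarrow> real \<Rightarrow> real" where
  "col n j t = S t (basis_seq j) n"

definition Gm :: "nat \<Rightarrow> nat \<Rightarrow> real" where
  "Gm n j = (if n = j then - a j else 0) + a j * b n j"

text \<open>The image of the j-th unit vector under A + B. The values \<open>b 0 j\<close> are
  arbitrary, so the entry at the dummy index has to be cut off.\<close>

definition Gcol :: "nat \<Rightarrow> nat \<Rightarrow> real" where
  "Gcol j n = (if n = 0 then 0 else Gm n j)"

lemma S_sum:
  assumes "finite J" "J \<subseteq> {1..}" "t \<ge> 0"
  shows "(\<lambda>n. \<Sum>j\<in>J. c j * basis_seq j n) \<in> lsp w \<and>
    S t (\<lambda>n. \<Sum>j\<in>J. c j * basis_seq j n) = (\<lambda>n. \<Sum>j\<in>J. c j * col n j t)"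
  using assms
proof (induction J rule: finite_induct)
  case empty
  have "S t (\<lambda>n. 0 * 0) = (\<lambda>n. 0 * S t (\<lambda>n. 0) n)"
    by (rule S_scale[OF empty(2) lsp_zero_fun(1)])
  then show ?case by (simp add: lsp_zero_fun)
next
  case (insert i J)
  then have i: "basis_seq i \<in> lsp w" by (intro basis_seq_lsp) auto
  have IH: "(\<lambda>n. \<Sum>j\<in>J. c j * basis_seq j n) \<in> lsp w"
      "S t (\<lambda>n. \<Sum>j\<in>J. c j * basis_seq j n) = (\<lambda>n. \<Sum>j\<in>J. c j * col n j t)"
    using insert by auto
  show ?case
    using lsp_add(1)[OF lsp_scale(1)[OF i, of "c i"] IH(1) wpos]
      S_add[OF \<open>t \<ge> 0\<close> lsp_scale(1)[OF i, of "c i"] IH(1)] S_scale[OF \<open>t \<ge> 0\<close> i, of "c i"] IH(2) insert(1,2)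
    by (simp add: col_def)
qed

lemma S_finite:
  assumes "f 0 = 0" "\<And>n. n > N \<Longrightarrow> f n = 0" "t \<ge> 0"
  shows "S t f n = (\<Sum>j=1..N. f j * col n j t)"
proof -
  have "S t f = S t (\<lambda>n. \<Sum>j\<in>{1..N}. f j * basis_seq j n)"
    using finite_support_expand[of f N, OF assms(1,2)] by simp
  then show ?thesis using S_sum[of "{1..N}" t f] assms(3) by auto
qed

text \<open>A unit vector and its image under A + B have finite support, hence lie in every weighted
  space, and a constant sequence witnesses membership in the closure. This is where
  \<open>gen\<close> is exploited: it turns the closed graph into convergence of difference
  quotients.\<close>

lemma generator_basis:
  assumes j: "j \<ge> 1"
  shows "((\<lambda>h. wnorm w (\<lambda>n. (1 / h) * (S h (basis_seq j) n - basis_seq j n) - Gcol j n)) \<longlongrightarrow> 0) (at_right 0)"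
proof -
  have sm: "(\<lambda>i. a i * b n i * basis_seq j i) sums (a j * b n j)" for n
    using sums_single[of j "\<lambda>i. a i * b n i"] by (simp add: basis_seq_def if_distrib cong: if_cong)
  have B: "Bop a b (basis_seq j) = (\<lambda>n. if n = 0 then 0 else a j * b n j)"
    using sums_unique[OF sm] by (auto simp: Bop_def)
  have A: "Aop a (basis_seq j) = (\<lambda>n. if n = j then - a j else 0)"
    using j by (auto simp: Aop_def basis_seq_def)
  have "basis_seq j \<in> domA w a"
    using basis_seq_lsp[OF j] lsp_finite_support[of "\<lambda>n. if n = j then - a j else 0" j] j by (auto simp: domA_def A)
  moreover have "basis_seq j \<in> domB w a b"
    using basis_seq_lsp[OF j] sums_summable[OF sm] lsp_finite_support[of "\<lambda>n. if n = 0 then 0 else a j * b n j" j] j b_z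
    by (auto simp: domB_def B)
  moreover have G: "sadd (Aop a (basis_seq j)) (Bop a b (basis_seq j)) = Gcol j"
    unfolding A B using j by (auto simp: sadd_def Gcol_def Gm_def)
  ultimately have AB: "(basis_seq j, Gcol j) \<in> graphAB w a b"
    unfolding graphAB_def by (auto intro!: exI[of _ "basis_seq j"])
  have GL: "Gcol j \<in> lsp w" by (rule lsp_finite_support[of _ j]) (use j b_z in \<open>auto simp: Gcol_def Gm_def\<close>)
  have "(basis_seq j, Gcol j) \<in> graphG w a b"
    unfolding graphG_def mem_Collect_eq split_conv
    by (intro conjI exI[of _ "\<lambda>i::nat. basis_seq j"] exI[of _ "\<lambda>i::nat. Gcol j"])
      (use basis_seq_lsp[OF j] GL AB in \<open>auto simp: ssub_def lsp_zero_fun\<close>)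
  then have "(basis_seq j, Gcol j) \<in> generator_graph w S" using gen by simp
  then show ?thesis by (simp add: generator_graph_def sscale_def ssub_def)
qed

lemma Gcol_support: "j \<ge> 1 \<Longrightarrow> n > j \<Longrightarrow> Gcol j n = 0"
  using b_z by (auto simp: Gcol_def Gm_def)

lemma Gcol_lsp: "j \<ge> 1 \<Longrightarrow> Gcol j \<in> lsp w"
  by (rule lsp_finite_support[of _ j]) (use Gcol_support in \<open>auto simp: Gcol_def\<close>)

section \<open>Kolmogorov equations, positivity and triangularity of the columns\<close>

lemma col_0: "j \<ge> 1 \<Longrightarrow> col n j 0 = basis_seq j n"
  by (simp add: col_def S_zero_time basis_seq_lsp)

lemma col_zero_index: "j \<ge> 1 \<Longrightarrow> t \<ge> 0 \<Longrightarrow> col 0 j t = 0"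
  using S_lsp[OF _ basis_seq_lsp] by (simp add: col_def lsp_def)

lemma col_continuous: "j \<ge> 1 \<Longrightarrow> continuous_on {0..} (col n j)"
  unfolding col_def by (rule S_comp_continuous[OF basis_seq_lsp])

text \<open>The backward equation, with the generator acting first: S(t + h) e_j - S(t) e_j is S(t)
  applied to S(h) e_j - e_j, and the bounded operator S(t) preserves the limit of the quotient.
  Since G e_j is supported in \<open>{1..j}\<close>, only columns of index at most j appear, which
  permits recursion on j.\<close>

lemma col_right_deriv_backward:
  assumes n: "n \<ge> 1" and j: "j \<ge> 1" and t: "t \<ge> 0"
  shows "(col n j has_real_derivative (\<Sum>m=1..j. Gm m j * col n m t)) (at_right t)"
proof -
  let ?D = "\<Sum>m=1..j. Gm m j * col n m t"
  let ?q = "\<lambda>h n. (1 / h) * (S h (basis_seq j) n - basis_seq j n) - Gcol j n"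
  obtain M where M: "\<And>f. f \<in> lsp w \<Longrightarrow> wnorm w (S t f) \<le> M * wnorm w f" using S_bounded[OF t] by blast
  have wn: "0 < w n" using wpos n by simp
  have D: "S t (Gcol j) n = ?D"
    using S_finite[of "Gcol j" j t n] Gcol_support[OF j] t by (simp add: Gcol_def)
  have est: "\<bar>(col n j (h + t) - col n j t) / h - ?D\<bar> \<le> M / w n * wnorm w (?q h)" if h: "h > 0" for h
  proof -
    have l: "(\<lambda>n. S h (basis_seq j) n - basis_seq j n) \<in> lsp w"
      using lsp_diff(1)[OF S_lsp basis_seq_lsp wpos] basis_seq_lsp j h by simp
    have l2: "?q h \<in> lsp w" by (rule lsp_diff(1)[OF lsp_scale(1)[OF l] Gcol_lsp[OF j] wpos])
    have "S t (?q h) = (\<lambda>n. (1/h) * S t (\<lambda>n. S h (basis_seq j) n - basis_seq j n) n - S t (Gcol j) n)"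
      using S_diff[OF t lsp_scale(1)[OF l, of "1/h"] Gcol_lsp[OF j]] S_scale[OF t l, of "1/h"] by simp
    also have "S t (\<lambda>n. S h (basis_seq j) n - basis_seq j n) = (\<lambda>n. S (h + t) (basis_seq j) n - S t (basis_seq j) n)"
      using S_diff[OF t S_lsp basis_seq_lsp, of h "basis_seq j" j] S_semigroup[of t h "basis_seq j"] basis_seq_lsp[OF j] h j t
      by (simp add: add.commute)
    finally have "S t (?q h) n = (col n j (h + t) - col n j t) / h - ?D"
      using D by (simp add: col_def)
    then have "w n * \<bar>(col n j (h + t) - col n j t) / h - ?D\<bar> \<le> wnorm w (S t (?q h))"
      using wnorm_comp_le[OF S_lsp[OF t l2] wpos, of n] by simp
    also have "\<dots> \<le> M * wnorm w (?q h)" by (rule M[OF l2])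
    finally show ?thesis using wn by (simp add: field_simps)
  qed
  have "((\<lambda>h. M / w n * wnorm w (?q h)) \<longlongrightarrow> 0) (at_right 0)"
    using tendsto_mult_left[OF generator_basis[OF j], of "M / w n"] by simp
  then have "((\<lambda>h. (col n j (h + t) - col n j t) / h - ?D) \<longlongrightarrow> 0) (at_right 0)"
    by (rule Lim_null_comparison[rotated])
      (use est in \<open>auto simp: eventually_at_right_field intro!: exI[of _ 1]\<close>)
  then have "((\<lambda>h. (col n j (h + t) - col n j t) / h) \<longlongrightarrow> ?D) (at_right 0)"
    by (simp add: LIM_zero_iff)
  then show ?thesis by (rule has_right_derivI)
qed

text \<open>By induction on j the backward equation is a scalar linear equation with decay rate a_j
  and a forcing made of earlier columns. The forcing is nonnegative, and zero when n > j, so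
  multiplying by exp(a_j t) gives both claims.\<close>

lemma col_nonneg_triangular:
  assumes "n \<ge> 1" "j \<ge> 1" "t \<ge> 0"
  shows "0 \<le> col n j t \<and> (n > j \<longrightarrow> col n j t = 0)"
  using assms(2,3)
proof (induction j arbitrary: t rule: less_induct)
  case (less j)
  let ?F = "\<lambda>t. \<Sum>m\<in>{1..<j}. a j * b m j * col n m t"
  have split: "(\<Sum>m=1..j. Gm m j * col n m t) = - a j * col n j t + ?F t" for t
  proof -
    have "{1..j} = insert j {1..<j}" using less.prems by auto
    then have "(\<Sum>m=1..j. Gm m j * col n m t) = Gm j j * col n j t + (\<Sum>m\<in>{1..<j}. Gm m j * col n m t)" by simp
    also have "(\<Sum>m\<in>{1..<j}. Gm m j * col n m t) = ?F t" by (rule sum.cong) (auto simp: Gm_def)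
    finally show ?thesis using b_z[of j j] less.prems by (simp add: Gm_def)
  qed
  let ?y = "\<lambda>t. exp (a j * t) * col n j t"
  have dy: "(?y has_real_derivative exp (a j * x) * ?F x) (at_right x)" if "x \<ge> 0" for x
  proof -
    have "(col n j has_real_derivative - a j * col n j x + ?F x) (at_right x)"
      using col_right_deriv_backward[OF assms(1) less.prems(1) that] unfolding split .
    then show ?thesis by (auto intro!: derivative_eq_intros simp: algebra_simps sum_distrib_left)
  qed
  have cy: "continuous_on {0..x} ?y" for x
    using continuous_on_subset[OF col_continuous[OF less.prems(1)], of "{0..x}"] by (intro continuous_intros) auto
  have F0: "0 \<le> ?F x" if "x \<ge> 0" for x
    using less.IH that a_nn[OF less.prems(1)] b_nn less.prems(1) by (intro sum_nonneg mult_nonneg_nonneg) auto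
  have "- ?y t \<le> - ?y 0"
  proof (rule right_deriv_nonpos_imp_le[of 0 t "\<lambda>t. - ?y t" "\<lambda>x. - (exp (a j * x) * ?F x)"])
    show "((\<lambda>t. - ?y t) has_real_derivative - (exp (a j * x) * ?F x)) (at_right x)" if "0 \<le> x" "x < t" for x
      by (rule DERIV_minus[OF dy[OF that(1)]])
    show "continuous_on {0..t} (\<lambda>t. - ?y t)" by (rule continuous_on_minus[OF cy])
    show "- (exp (a j * x) * ?F x) \<le> 0" if "0 \<le> x" "x < t" for x
      using F0[OF that(1)] by simp
  qed (use less.prems in auto)
  moreover have "0 \<le> ?y 0" using less.prems by (simp add: col_0 basis_seq_def)
  ultimately have "0 \<le> ?y t" by linarith
  then have pos: "0 \<le> col n j t" by (simp add: zero_le_mult_iff)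
  have "col n j t = 0" if "n > j"
  proof -
    have Fz: "?F x = 0" if "x \<ge> 0" for x
      using less.IH that \<open>n > j\<close> by (intro sum.neutral) auto
    have "?y t = ?y 0"
      by (rule right_deriv_zero_imp_eq[OF less.prems(2) cy]) (use dy Fz in force)
    then show ?thesis using that less.prems by (simp add: col_0 basis_seq_def)
  qed
  with pos show ?case by blast
qed

lemma col_nonneg: "n \<ge> 1 \<Longrightarrow> j \<ge> 1 \<Longrightarrow> t \<ge> 0 \<Longrightarrow> 0 \<le> col n j t"
  and col_triangular: "n \<ge> 1 \<Longrightarrow> j \<ge> 1 \<Longrightarrow> t \<ge> 0 \<Longrightarrow> n > j \<Longrightarrow> col n j t = 0"
  using col_nonneg_triangular by blast+

lemma col_semigroup:
  assumes "j \<ge> 1" "t \<ge> 0" "r \<ge> 0"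
  shows "col n j (t + r) = (\<Sum>m=1..j. col n m t * col m j r)"
proof -
  have "S (t + r) (basis_seq j) n = S t (\<lambda>m. col m j r) n"
    using S_semigroup[OF assms(2,3) basis_seq_lsp[OF assms(1)]] by (simp add: col_def)
  also have "\<dots> = (\<Sum>m=1..j. col m j r * col n m t)"
    by (rule S_finite) (use assms col_zero_index col_triangular in auto)
  finally show ?thesis by (simp add: col_def mult.commute)
qed

lemma col_right_deriv_zero:
  assumes "n \<ge> 1" "m \<ge> 1"
  shows "(col n m has_real_derivative Gm n m) (at_right 0)"
proof -
  have "(\<Sum>i=1..m. Gm i m * col n i 0) = (\<Sum>i=1..m. if i = n then Gm i m else 0)"
    by (rule sum.cong) (auto simp: col_0 basis_seq_def)
  also have "\<dots> = Gm n m" using assms b_z by (auto simp: Gm_def)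
  finally show ?thesis using col_right_deriv_backward[OF assms, of 0] by simp
qed

text \<open>The forward equation, with the generator acting last. It is available only after
  triangularity, which makes S(t) e_j a finite combination of unit vectors. This form is the one
  that interacts with weighted sums over n.\<close>

lemma col_right_deriv_forward:
  assumes "n \<ge> 1" "j \<ge> 1" "t \<ge> 0"
  shows "(col n j has_real_derivative (\<Sum>m=1..j. Gm n m * col m j t)) (at_right t)"
proof -
  have eq: "(col n j (h + t) - col n j t) / h = (\<Sum>m=1..j. (col n m h - col n m 0) / h * col m j t)" if "h > 0" for h
  proof -
    have "col n j t = (\<Sum>m=1..j. col n m 0 * col m j t)" using col_semigroup[of j 0 t n] assms by simp
    moreover have "col n j (h + t) = (\<Sum>m=1..j. col n m h * col m j t)" using col_semigroup[of j h t n] assms that by simp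
    ultimately show ?thesis
      by (simp add: left_diff_distrib sum_subtractf diff_divide_distrib sum_divide_distrib)
  qed
  have "((\<lambda>h. \<Sum>m=1..j. (col n m h - col n m 0) / h * col m j t) \<longlongrightarrow> (\<Sum>m=1..j. Gm n m * col m j t)) (at_right 0)"
    using col_right_deriv_zero[OF assms(1)] by (intro tendsto_intros) (auto simp: has_field_derivative_iff)
  then have "((\<lambda>h. (col n j (h + t) - col n j t) / h) \<longlongrightarrow> (\<Sum>m=1..j. Gm n m * col m j t)) (at_right 0)"
    by (rule Lim_transform_eventually) (use eq in \<open>auto simp: eventually_at_right_field intro!: exI[of _ 1]\<close>)
  then show ?thesis by (rule has_right_derivI)
qed

text \<open>Forward and backward equation compute the same right derivative, so G and S(t) commute
  on unit vectors.\<close>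

lemma Gm_col_commute:
  assumes "n \<ge> 1" "j \<ge> 1" "t \<ge> 0"
  shows "(\<Sum>m=1..j. Gm n m * col m j t) = (\<Sum>m=1..j. Gm m j * col n m t)"
  using col_right_deriv_forward[OF assms] col_right_deriv_backward[OF assms]
  unfolding has_field_derivative_iff by (intro tendsto_unique[of "at_right t"]) auto

section \<open>Weighted column sums\<close>

lemma weighted_Gm_column:
  assumes "1 \<le> m" "m \<le> N"
  shows "(\<Sum>n=1..N. \<theta> n * Gm n m) = a m * ((\<Sum>n=1..m-1. \<theta> n * b n m) - \<theta> m)"
proof -
  have "(\<Sum>n=1..N. \<theta> n * Gm n m) = (\<Sum>n=1..N. (if n = m then - \<theta> n * a n else 0) + a m * (\<theta> n * b n m))"
    by (rule sum.cong) (auto simp: Gm_def algebra_simps)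
  also have "\<dots> = - \<theta> m * a m + a m * (\<Sum>n=1..N. \<theta> n * b n m)"
    using assms by (simp add: sum.distrib sum_distrib_left)
  also have "(\<Sum>n=1..N. \<theta> n * b n m) = (\<Sum>n=1..m-1. \<theta> n * b n m)"
    by (rule sum.mono_neutral_right) (use assms b_z in auto)
  finally show ?thesis by (simp add: algebra_simps)
qed

lemma weighted_col_right_deriv:
  assumes "j \<ge> 1" "t \<ge> 0"
  shows "((\<lambda>t. \<Sum>n=1..j. \<theta> n * col n j t) has_real_derivative
     (\<Sum>m=1..j. a m * ((\<Sum>n=1..m-1. \<theta> n * b n m) - \<theta> m) * col m j t)) (at_right t)"
proof -
  have "((\<lambda>t. \<Sum>n=1..j. \<theta> n * col n j t) has_real_derivative
     (\<Sum>n=1..j. \<theta> n * (\<Sum>m=1..j. Gm n m * col m j t))) (at_right t)"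
    using col_right_deriv_forward[OF _ assms] by (intro DERIV_sum DERIV_cmult) auto
  also have "(\<Sum>n=1..j. \<theta> n * (\<Sum>m=1..j. Gm n m * col m j t)) = (\<Sum>m=1..j. (\<Sum>n=1..j. \<theta> n * Gm n m) * col m j t)"
    by (simp add: sum_distrib_left sum_distrib_right mult.assoc) (rule sum.swap)
  also have "\<dots> = (\<Sum>m=1..j. a m * ((\<Sum>n=1..m-1. \<theta> n * b n m) - \<theta> m) * col m j t)"
    by (rule sum.cong) (use weighted_Gm_column[of _ j \<theta>] in auto)
  finally show ?thesis .
qed

lemma weighted_col_continuous:
  "j \<ge> 1 \<Longrightarrow> continuous_on {0..t} (\<lambda>t. \<Sum>n=1..j. \<theta> n * col n j t)"
  using continuous_on_subset[OF col_continuous, of j "{0..t}"] by (intro continuous_intros) auto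

lemma weighted_col_zero: "j \<ge> 1 \<Longrightarrow> (\<Sum>n=1..j. \<theta> n * col n j 0) = \<theta> j"
  by (simp add: col_0 basis_seq_def if_distrib cong: if_cong)

text \<open>A weight that a breakup never increases is a Lyapunov function: the derivative of the
  weighted column sum is a nonpositive balance times nonnegative entries. With \<theta> = w this is
  contractivity.\<close>

lemma weighted_col_le:
  assumes "j \<ge> 1" "t \<ge> 0" "\<And>m. m \<ge> 1 \<Longrightarrow> (\<Sum>n=1..m-1. \<theta> n * b n m) \<le> \<theta> m"
  shows "(\<Sum>n=1..j. \<theta> n * col n j t) \<le> \<theta> j"
proof -
  have "(\<Sum>n=1..j. \<theta> n * col n j t) \<le> (\<Sum>n=1..j. \<theta> n * col n j 0)"
  proof (rule right_deriv_nonpos_imp_le[OF assms(2) weighted_col_continuous[OF assms(1)] weighted_col_right_deriv[OF assms(1)]])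
    fix x :: real assume "0 \<le> x"
    then show "(\<Sum>m=1..j. a m * ((\<Sum>n=1..m-1. \<theta> n * b n m) - \<theta> m) * col m j x) \<le> 0"
      using a_nn assms(3) col_nonneg assms(1)
      by (intro sum_nonpos mult_nonpos_nonneg mult_nonneg_nonpos) auto
  qed auto
  then show ?thesis using weighted_col_zero[OF assms(1)] by simp
qed

lemma w_frag': "m \<ge> 1 \<Longrightarrow> (\<Sum>n=1..m-1. w n * b n m) \<le> \<kappa> * w m"
  using w_frag[of m] wpos[of m] kap by (cases "m = 1") auto

lemma col_w_le: "j \<ge> 1 \<Longrightarrow> t \<ge> 0 \<Longrightarrow> (\<Sum>n=1..j. w n * col n j t) \<le> w j"
proof (rule weighted_col_le)
  fix m :: nat assume "m \<ge> 1"
  then have "\<kappa> * w m \<le> 1 * w m" using wpos[of m] kap by (intro mult_right_mono) auto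
  then show "(\<Sum>n=1..m-1. w n * b n m) \<le> w m" using w_frag'[OF \<open>m \<ge> 1\<close>] by linarith
qed

lemma col_sum_extend:
  assumes "j \<ge> 1" "t \<ge> 0" "\<And>n. n \<ge> 1 \<Longrightarrow> 0 \<le> \<theta> n"
  shows "(\<Sum>n=1..N. \<theta> n * col n j t) \<le> (\<Sum>n=1..j. \<theta> n * col n j t)"
proof -
  have "(\<Sum>n=1..N. \<theta> n * col n j t) \<le> (\<Sum>n\<in>{1..N} \<union> {1..j}. \<theta> n * col n j t)"
    using assms col_nonneg by (intro sum_mono2) auto
  also have "\<dots> = (\<Sum>n=1..j. \<theta> n * col n j t)"
    by (rule sum.mono_neutral_right) (use assms col_triangular in auto)
  finally show ?thesis .
qed

section \<open>The smoothing estimate for columns\<close>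

definition dcol :: "nat \<Rightarrow> nat \<Rightarrow> real \<Rightarrow> real" where
  "dcol n j t = (\<Sum>m=1..j. Gm n m * col m j t)"

text \<open>Here \<open>dcol n j t\<close> is the n-th coordinate of G S(t) e_j,
  \<open>dnorm j t\<close> is the w-norm of that vector, and \<open>acol j t\<close> is the w-norm
  of A S(t) e_j.\<close>

definition dnorm :: "nat \<Rightarrow> real \<Rightarrow> real" where
  "dnorm j t = (\<Sum>n=1..j. w n * \<bar>dcol n j t\<bar>)"

definition acol :: "nat \<Rightarrow> real \<Rightarrow> real" where
  "acol j t = (\<Sum>n=1..j. a n * w n * col n j t)"

text \<open>Each column of B has w-norm at most \<kappa> times that of the corresponding column of
  A, so G is dominated by 1 + \<kappa> times A on nonnegative vectors.\<close>

lemma dnorm_le_acol: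
  assumes "j \<ge> 1" "t \<ge> 0"
  shows "dnorm j t \<le> (1 + \<kappa>) * acol j t"
proof -
  have "dnorm j t \<le> (\<Sum>n=1..j. w n * (\<Sum>m=1..j. \<bar>Gm n m\<bar> * col m j t))"
    unfolding dnorm_def dcol_def
  proof (intro sum_mono mult_left_mono)
    fix n assume "n \<in> {1..j}"
    show "\<bar>\<Sum>m=1..j. Gm n m * col m j t\<bar> \<le> (\<Sum>m=1..j. \<bar>Gm n m\<bar> * col m j t)"
      using col_nonneg assms by (intro order.trans[OF sum_abs] sum_mono) (auto simp: abs_mult)
  qed (use wpos in \<open>auto simp: less_imp_le\<close>)
  also have "\<dots> = (\<Sum>m=1..j. (\<Sum>n=1..j. w n * \<bar>Gm n m\<bar>) * col m j t)"
    by (simp add: sum_distrib_left sum_distrib_right mult.assoc) (rule sum.swap)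
  also have "\<dots> \<le> (\<Sum>m=1..j. ((1 + \<kappa>) * (a m * w m)) * col m j t)"
  proof (intro sum_mono mult_right_mono)
    fix m assume m: "m \<in> {1..j}"
    have "(\<Sum>n=1..j. w n * \<bar>Gm n m\<bar>) \<le> (\<Sum>n=1..j. (if n = m then w n * a n else 0) + a m * (w n * b n m))"
    proof (rule sum_mono)
      fix n assume n: "n \<in> {1..j}"
      have "\<bar>Gm n m\<bar> \<le> (if n = m then a n else 0) + a m * b n m"
        using a_nn[of m] b_nn[of n m] b_z[of m m] m n by (auto simp: Gm_def)
      then have "w n * \<bar>Gm n m\<bar> \<le> w n * ((if n = m then a n else 0) + a m * b n m)"
        using wpos[of n] n by (intro mult_left_mono) auto
      then show "w n * \<bar>Gm n m\<bar> \<le> (if n = m then w n * a n else 0) + a m * (w n * b n m)"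
        by (auto simp: algebra_simps split: if_splits)
    qed
    also have "\<dots> = w m * a m + a m * (\<Sum>n=1..j. w n * b n m)"
      using m by (simp add: sum.distrib sum_distrib_left)
    also have "(\<Sum>n=1..j. w n * b n m) = (\<Sum>n=1..m-1. w n * b n m)"
      by (rule sum.mono_neutral_right) (use m b_z in auto)
    also have "w m * a m + a m * (\<Sum>n=1..m-1. w n * b n m) \<le> w m * a m + a m * (\<kappa> * w m)"
      using w_frag'[of m] a_nn[of m] m by (intro add_left_mono mult_left_mono) auto
    finally show "(\<Sum>n=1..j. w n * \<bar>Gm n m\<bar>) \<le> (1 + \<kappa>) * (a m * w m)" by (simp add: algebra_simps)
  qed (use col_nonneg assms in auto)
  finally show ?thesis by (simp add: acol_def sum_distrib_left mult.assoc)
qed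

text \<open>Dissipation: each breakup destroys at least the fraction 1 - \<kappa> of the weight of
  the broken particle.\<close>

lemma weighted_w_deriv_le:
  assumes "j \<ge> 1" "t \<ge> 0"
  shows "(\<Sum>m=1..j. a m * ((\<Sum>n=1..m-1. w n * b n m) - w m) * col m j t) \<le> - (1 - \<kappa>) * acol j t"
proof -
  have "(\<Sum>m=1..j. a m * ((\<Sum>n=1..m-1. w n * b n m) - w m) * col m j t) \<le> (\<Sum>m=1..j. a m * (\<kappa> * w m - w m) * col m j t)"
    using w_frag' a_nn col_nonneg assms by (intro sum_mono mult_right_mono mult_left_mono) auto
  also have "\<dots> = - (1 - \<kappa>) * acol j t"
    unfolding acol_def sum_distrib_left by (rule sum.cong) (auto simp: algebra_simps)
  finally show ?thesis .
qed

text \<open>Converse of \<open>dnorm_le_acol\<close>, valid because the columns are nonnegative: the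
  signed w-sum of G S(t) e_j is at most -(1 - \<kappa>) \<open>acol j t\<close>, and it is never
  below minus the norm.\<close>

lemma acol_le_dnorm:
  assumes "j \<ge> 1" "t \<ge> 0"
  shows "(1 - \<kappa>) * acol j t \<le> dnorm j t"
proof -
  have "- dnorm j t \<le> (\<Sum>n=1..j. w n * dcol n j t)"
    unfolding dnorm_def sum_negf[symmetric]
  proof (rule sum_mono)
    fix n assume "n \<in> {1..j}"
    then have "w n * (- \<bar>dcol n j t\<bar>) \<le> w n * dcol n j t" using wpos[of n] by (intro mult_left_mono) auto
    then show "- (w n * \<bar>dcol n j t\<bar>) \<le> w n * dcol n j t" by simp
  qed
  also have "\<dots> = (\<Sum>m=1..j. (\<Sum>n=1..j. w n * Gm n m) * col m j t)"
    unfolding dcol_def by (simp add: sum_distrib_left sum_distrib_right mult.assoc) (rule sum.swap)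
  also have "\<dots> = (\<Sum>m=1..j. a m * ((\<Sum>n=1..m-1. w n * b n m) - w m) * col m j t)"
    by (rule sum.cong) (use weighted_Gm_column[of _ j w] in auto)
  also have "\<dots> \<le> - (1 - \<kappa>) * acol j t" by (rule weighted_w_deriv_le[OF assms])
  finally show ?thesis by (simp add: algebra_simps)
qed

text \<open>G S(t + r) e_j = S(t) G S(r) e_j. The backward form is taken at time t + r so that the
  semigroup law can split the column, and commutation restores the forward form at time r.\<close>

lemma dcol_semigroup:
  assumes "n \<ge> 1" "j \<ge> 1" "t \<ge> 0" "r \<ge> 0"
  shows "dcol n j (t + r) = (\<Sum>m=1..j. col n m t * dcol m j r)"
proof -
  have "dcol n j (t + r) = (\<Sum>m=1..j. Gm m j * col n m (t + r))"
    using Gm_col_commute[of n j "t + r"] assms by (simp add: dcol_def)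
  also have "\<dots> = (\<Sum>m=1..j. Gm m j * (\<Sum>i=1..j. col n i t * col i m r))"
  proof (rule sum.cong[OF refl])
    fix m assume m: "m \<in> {1..j}"
    have "col n m (t + r) = (\<Sum>i=1..m. col n i t * col i m r)" using col_semigroup assms m by auto
    also have "\<dots> = (\<Sum>i=1..j. col n i t * col i m r)"
      by (rule sum.mono_neutral_left) (use m col_triangular assms in auto)
    finally show "Gm m j * col n m (t + r) = Gm m j * (\<Sum>i=1..j. col n i t * col i m r)" by simp
  qed
  also have "\<dots> = (\<Sum>m=1..j. \<Sum>i=1..j. col n i t * (Gm m j * col i m r))"
    by (simp add: sum_distrib_left mult.left_commute)
  also have "\<dots> = (\<Sum>i=1..j. col n i t * (\<Sum>m=1..j. Gm m j * col i m r))"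
    by (subst sum.swap) (simp add: sum_distrib_left)
  also have "\<dots> = (\<Sum>i=1..j. col n i t * dcol i j r)"
    using Gm_col_commute[of _ j r] assms by (intro sum.cong) (auto simp: dcol_def)
  finally show ?thesis .
qed

text \<open>The derivative of a column is itself transported by the contraction semigroup, so its norm
  cannot grow; together with the integrability of \<open>acol\<close> this yields the smoothing estimate
  without any analyticity.\<close>

lemma dnorm_antimono:
  assumes "j \<ge> 1" "0 \<le> r" "r \<le> t"
  shows "dnorm j t \<le> dnorm j r"
proof -
  define q where "q = t - r"
  have q: "q \<ge> 0" "t = q + r" using assms by (auto simp: q_def)
  have "dnorm j t \<le> (\<Sum>n=1..j. w n * (\<Sum>m=1..j. col n m q * \<bar>dcol m j r\<bar>))"
    unfolding dnorm_def
  proof (intro sum_mono mult_left_mono)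
    fix n assume n: "n \<in> {1..j}"
    have "dcol n j t = (\<Sum>m=1..j. col n m q * dcol m j r)" using dcol_semigroup[of n j q r] q n assms by simp
    then show "\<bar>dcol n j t\<bar> \<le> (\<Sum>m=1..j. col n m q * \<bar>dcol m j r\<bar>)"
      using col_nonneg n q by (auto intro!: order.trans[OF sum_abs] sum_mono simp: abs_mult)
  qed (use wpos in \<open>auto simp: less_imp_le\<close>)
  also have "\<dots> = (\<Sum>m=1..j. (\<Sum>n=1..j. w n * col n m q) * \<bar>dcol m j r\<bar>)"
    by (simp add: sum_distrib_left sum_distrib_right mult.assoc) (rule sum.swap)
  also have "\<dots> \<le> (\<Sum>m=1..j. w m * \<bar>dcol m j r\<bar>)"
  proof (intro sum_mono mult_right_mono)
    fix m assume m: "m \<in> {1..j}"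
    have "(\<Sum>n=1..j. w n * col n m q) \<le> (\<Sum>n=1..m. w n * col n m q)"
      by (rule col_sum_extend) (use m q wpos in \<open>auto simp: less_imp_le\<close>)
    also have "\<dots> \<le> w m" by (rule col_w_le) (use m q in auto)
    finally show "(\<Sum>n=1..j. w n * col n m q) \<le> w m" .
  qed auto
  finally show ?thesis by (simp add: dnorm_def)
qed

text \<open>With t fixed, the function C * W(r) + r * \<open>dnorm j t\<close> is nonincreasing in r
  on [0, t]: C is chosen so that C times the dissipation is at least (1 + \<kappa>)
  \<open>acol j r\<close>, which exceeds \<open>dnorm j r\<close> and hence
  \<open>dnorm j t\<close>. This expresses that t times a nonincreasing function is at most its
  integral, without forming the integral.\<close>

lemma time_dnorm_le:
  assumes "j \<ge> 1" "0 \<le> t" "\<kappa> < 1"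
  shows "t * dnorm j t \<le> (1 + \<kappa>) / (1 - \<kappa>) * w j"
proof -
  define C where "C = (1 + \<kappa>) / (1 - \<kappa>)"
  have C: "C \<ge> 0" "C * (1 - \<kappa>) = 1 + \<kappa>" using assms kap by (auto simp: C_def)
  let ?W = "\<lambda>r. \<Sum>n=1..j. w n * col n j r"
  let ?D = "\<lambda>r. \<Sum>m=1..j. a m * ((\<Sum>n=1..m-1. w n * b n m) - w m) * col m j r"
  have "C * ?W t + t * dnorm j t \<le> C * ?W 0 + 0 * dnorm j t"
  proof (rule right_deriv_nonpos_imp_le[OF assms(2), of "\<lambda>r. C * ?W r + r * dnorm j t" "\<lambda>r. C * ?D r + dnorm j t"])
    show "continuous_on {0..t} (\<lambda>r. C * ?W r + r * dnorm j t)"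
      by (intro continuous_on_add continuous_on_mult continuous_on_const continuous_on_id weighted_col_continuous[OF assms(1)])
    show "((\<lambda>r. C * ?W r + r * dnorm j t) has_real_derivative C * ?D x + dnorm j t) (at_right x)" if "0 \<le> x" "x < t" for x
      using DERIV_cmult[OF weighted_col_right_deriv[OF assms(1) that(1), of w], of C]
      by (intro DERIV_add) (auto intro!: derivative_eq_intros)
    fix x assume x: "0 \<le> x" "x < t"
    have "C * ?D x \<le> C * (- (1 - \<kappa>) * acol j x)"
      by (rule mult_left_mono[OF weighted_w_deriv_le[OF assms(1) x(1)] C(1)])
    also have "\<dots> = - ((C * (1 - \<kappa>)) * acol j x)" by (simp add: algebra_simps)
    also have "\<dots> = - ((1 + \<kappa>) * acol j x)" by (simp only: C(2))
    also have "\<dots> \<le> - dnorm j x" using dnorm_le_acol[OF assms(1) x(1)] by simp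
    also have "\<dots> \<le> - dnorm j t" using dnorm_antimono[OF assms(1) x(1), of t] x by simp
    finally show "C * ?D x + dnorm j t \<le> 0" by simp
  qed
  moreover have "0 \<le> ?W t" using wpos col_nonneg assms by (intro sum_nonneg mult_nonneg_nonneg) (auto simp: less_imp_le)
  ultimately show ?thesis
    using C(1) weighted_col_zero[OF assms(1), of w] mult_nonneg_nonneg[of C "?W t"] by (simp add: C_def)
qed

text \<open>The same quantity is bounded for positive times by w_j / t and uniformly in time by a_j
  w_j. The second bound uses that \<open>dnorm\<close> is largest at time 0; its constant is
  enlarged so that both bounds share one.\<close>

lemma acol_le:
  assumes "j \<ge> 1" "0 \<le> t" "\<kappa> < 1"
  shows "t * acol j t \<le> (1 + \<kappa>) / (1 - \<kappa>)\<^sup>2 * w j"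
    and "acol j t \<le> (1 + \<kappa>) / (1 - \<kappa>)\<^sup>2 * (a j * w j)"
proof -
  have k: "0 < 1 - \<kappa>" using assms by simp
  have "(1 - \<kappa>) * (t * acol j t) \<le> t * dnorm j t"
    using mult_left_mono[OF acol_le_dnorm[OF assms(1,2)] assms(2)] by (simp add: mult.left_commute)
  also have "\<dots> \<le> (1 + \<kappa>) / (1 - \<kappa>) * w j" by (rule time_dnorm_le[OF assms])
  finally have "t * acol j t \<le> (1 + \<kappa>) / (1 - \<kappa>) * w j / (1 - \<kappa>)"
    by (subst pos_le_divide_eq[OF k]) (simp add: mult.commute)
  then show "t * acol j t \<le> (1 + \<kappa>) / (1 - \<kappa>)\<^sup>2 * w j"
    by (simp add: power2_eq_square mult.commute)
  have a0: "acol j 0 = a j * w j" using weighted_col_zero[OF assms(1), of "\<lambda>n. a n * w n"] by (simp add: acol_def)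
  have "(1 - \<kappa>) * acol j t \<le> dnorm j 0"
    using acol_le_dnorm[OF assms(1,2)] dnorm_antimono[OF assms(1) _ assms(2)] by simp
  also have "\<dots> \<le> (1 + \<kappa>) * (a j * w j)" using dnorm_le_acol[OF assms(1), of 0] a0 by simp
  finally have 1: "acol j t \<le> (1 + \<kappa>) / (1 - \<kappa>) * (a j * w j)" using k by (simp add: field_simps)
  have "(1 + \<kappa>) / (1 - \<kappa>) \<le> (1 + \<kappa>) / (1 - \<kappa>)\<^sup>2"
    using k kap by (intro divide_left_mono) (auto simp: power2_eq_square mult_le_cancel_left1)
  then have "(1 + \<kappa>) / (1 - \<kappa>) * (a j * w j) \<le> (1 + \<kappa>) / (1 - \<kappa>)\<^sup>2 * (a j * w j)"
    using a_nn[OF assms(1)] wpos[OF assms(1)] by (intro mult_right_mono) auto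
  with 1 show "acol j t \<le> (1 + \<kappa>) / (1 - \<kappa>)\<^sup>2 * (a j * w j)" by linarith
qed

text \<open>The inequality x^\<alpha> \<le> 1 + x is applied to x = c (1 + a_n). The parameter c
  stays free because two different choices of it are needed.\<close>

lemma wtil_col_interpolation:
  assumes "j \<ge> 1" "0 \<le> t" "0 \<le> \<alpha>" "\<alpha> \<le> 1" "0 < c"
  shows "(\<Sum>n=1..j. wtil \<alpha> a w n * col n j t) \<le> c powr (-\<alpha>) * ((1 + c) * w j + c * acol j t)"
proof -
  have "(\<Sum>n=1..j. wtil \<alpha> a w n * col n j t) \<le> (\<Sum>n=1..j. c powr (-\<alpha>) * ((1 + c + c * a n) * w n) * col n j t)"
  proof (intro sum_mono mult_right_mono)
    fix n assume n: "n \<in> {1..j}"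
    then have an: "0 \<le> a n" using a_nn by simp
    have "(1 + a n) powr \<alpha> = c powr (-\<alpha>) * (c * (1 + a n)) powr \<alpha>"
      using assms(5) an by (simp add: powr_mult powr_minus)
    also have "\<dots> \<le> c powr (-\<alpha>) * (1 + c * (1 + a n))"
      using assms an by (intro mult_left_mono powr_le_one_plus) auto
    finally have "(1 + a n) powr \<alpha> \<le> c powr (-\<alpha>) * (1 + c + c * a n)" by (simp add: algebra_simps)
    then have "(1 + a n) powr \<alpha> * w n \<le> c powr (-\<alpha>) * (1 + c + c * a n) * w n"
      using wpos[of n] n by (intro mult_right_mono) auto
    then show "wtil \<alpha> a w n \<le> c powr (-\<alpha>) * ((1 + c + c * a n) * w n)" by (simp add: wtil_def mult.assoc)
  qed (use col_nonneg assms in auto)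
  also have "\<dots> = c powr (-\<alpha>) * ((1 + c) * (\<Sum>n=1..j. w n * col n j t) + c * acol j t)"
    by (simp add: acol_def sum_distrib_left sum.distrib[symmetric] algebra_simps)
  also have "\<dots> \<le> c powr (-\<alpha>) * ((1 + c) * w j + c * acol j t)"
    using col_w_le[OF assms(1,2)] assms(5) by (intro mult_left_mono add_right_mono) auto
  finally show ?thesis .
qed

text \<open>For \<alpha> = 0 the two weights agree from index 1 on and contractivity suffices.
  Otherwise the two estimates come from the two regimes of \<open>acol_le\<close>, each with its own
  interpolation parameter.\<close>

lemma wtil_col_bounds:
  assumes "\<alpha> = 0 \<or> (\<kappa> < 1 \<and> 0 < \<alpha> \<and> \<alpha> < 1)"
  shows "\<exists>C\<ge>1. (\<forall>j\<ge>1. \<forall>t\<ge>0. (\<Sum>n=1..j. wtil \<alpha> a w n * col n j t) \<le> C * wtil \<alpha> a w j) \<and>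
    (\<forall>j\<ge>1. \<forall>t. 0 < t \<and> t \<le> 1 \<longrightarrow> (\<Sum>n=1..j. wtil \<alpha> a w n * col n j t) \<le> C * t powr (-\<alpha>) * w j)"
  using assms
proof
  assume \<alpha>: "\<alpha> = 0"
  have eq: "wtil \<alpha> a w n = w n" if "n \<ge> 1" for n using a_nn[OF that] \<alpha> by (simp add: wtil_def)
  have "(\<Sum>n=1..j. wtil \<alpha> a w n * col n j t) = (\<Sum>n=1..j. w n * col n j t)" for j t
    by (rule sum.cong) (auto simp: eq)
  then show ?thesis using \<alpha> col_w_le eq by (intro exI[of _ 1]) auto
next
  assume as: "\<kappa> < 1 \<and> 0 < \<alpha> \<and> \<alpha> < 1"
  define C0 where "C0 = (1 + \<kappa>) / (1 - \<kappa>)\<^sup>2"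
  have C0: "C0 \<ge> 0" using kap by (simp add: C0_def)
  have 1: "(\<Sum>n=1..j. wtil \<alpha> a w n * col n j t) \<le> (2 + C0) * wtil \<alpha> a w j" if j: "j \<ge> 1" and t: "t \<ge> 0" for j t
  proof -
    \<comment> \<open>This makes c^(-\<alpha>) equal to (1 + a_j)^\<alpha>, the factor that turns
      w_j into the larger weight, while c a_j \<le> 1 absorbs the a_j in the time-uniform bound for
      \<open>acol\<close>.\<close>
    define c where "c = 1 / (1 + a j)"
    have aj: "a j \<ge> 0" "w j > 0" using a_nn wpos j by auto
    have c: "0 < c" "c \<le> 1" "c * a j \<le> 1" using aj by (auto simp: c_def)
    have "(1 + c) * w j + c * acol j t \<le> 2 * w j + C0 * w j"
    proof -
      have "c * acol j t \<le> c * (C0 * (a j * w j))"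
        using acol_le(2)[OF j t] as c by (intro mult_left_mono) (auto simp: C0_def)
      also have "\<dots> = (c * a j) * (C0 * w j)" by (simp add: algebra_simps)
      also have "\<dots> \<le> 1 * (C0 * w j)" using c C0 aj by (intro mult_right_mono) auto
      finally have "c * acol j t \<le> C0 * w j" by simp
      moreover have "(1 + c) * w j \<le> 2 * w j" using c aj by (intro mult_right_mono) auto
      ultimately show ?thesis by linarith
    qed
    then have "c powr (-\<alpha>) * ((1 + c) * w j + c * acol j t) \<le> c powr (-\<alpha>) * (2 * w j + C0 * w j)"
      by (intro mult_left_mono) auto
    with wtil_col_interpolation[OF j t _ _ c(1), of \<alpha>] as
    have "(\<Sum>n=1..j. wtil \<alpha> a w n * col n j t) \<le> c powr (-\<alpha>) * (2 * w j + C0 * w j)"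
      by (auto elim: order.trans)
    moreover have "c powr (-\<alpha>) = (1 + a j) powr \<alpha>"
      using aj by (simp add: c_def powr_divide powr_minus field_simps)
    ultimately have "(\<Sum>n=1..j. wtil \<alpha> a w n * col n j t) \<le> (1 + a j) powr \<alpha> * (2 * w j + C0 * w j)"
      by simp
    then show ?thesis by (simp add: wtil_def algebra_simps)
  qed
  have 2: "(\<Sum>n=1..j. wtil \<alpha> a w n * col n j t) \<le> (2 + C0) * t powr (-\<alpha>) * w j" if j: "j \<ge> 1" and t: "0 < t" "t \<le> 1" for j t
  proof -
    \<comment> \<open>Here the interpolation parameter is t itself, matched to the bound of order
      1/t; t \<le> 1 keeps 1 + t below 2.\<close>
    have "(1 + t) * w j + t * acol j t \<le> 2 * w j + C0 * w j"
      using acol_le(1)[OF j, of t] t as wpos[OF j] by (intro add_mono mult_right_mono) (auto simp: C0_def)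
    then have "t powr (-\<alpha>) * ((1 + t) * w j + t * acol j t) \<le> t powr (-\<alpha>) * (2 * w j + C0 * w j)"
      by (intro mult_left_mono) auto
    then show ?thesis using wtil_col_interpolation[OF j _ _ _ t(1), of t \<alpha>] as t by (simp add: algebra_simps)
  qed
  show ?thesis using 1 2 C0 by (intro exI[of _ "2 + C0"]) auto
qed

end

section \<open>The semigroup on both weighted spaces\<close>

lemma wnorm_finite_support:
  assumes "f 0 = 0" "\<And>n. n > N \<Longrightarrow> f n = 0"
  shows "wnorm v f = (\<Sum>n=1..N. v n * \<bar>f n\<bar>)"
proof -
  have "wnorm v f = (\<Sum>n\<in>{..N}. v n * \<bar>f n\<bar>)"
    unfolding wnorm_def by (rule suminf_finite) (use assms(2) in \<open>auto simp: not_le\<close>)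
  also have "\<dots> = (\<Sum>n=1..N. v n * \<bar>f n\<bar>)"
    by (rule sum.mono_neutral_right) (use assms(1) in \<open>auto simp: not_le Suc_le_eq\<close>)
  finally show ?thesis .
qed

text \<open>The alternative (CI) or (CII) is condensed into the constant \<open>C1\<close> and the
  two column bounds. The kernel is deliberately left out of the locale, since truncated and
  time-shifted kernels have to be treated by the same lemmas.\<close>

locale coag_frag = frag_columns w S a b \<kappa>
  for w :: "nat \<Rightarrow> real" and S :: "real \<Rightarrow> (nat \<Rightarrow> real) \<Rightarrow> nat \<Rightarrow> real"
    and a :: "nat \<Rightarrow> real" and b :: "nat \<Rightarrow> nat \<Rightarrow> real" and \<kappa> :: real +
  fixes \<alpha> C1 :: real
  assumes alpha: "0 \<le> \<alpha>" "\<alpha> < 1"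
    and w_mono: "\<And>n m. n \<ge> 1 \<Longrightarrow> n \<le> m \<Longrightarrow> w n \<le> w m"
    and w_ge: "\<And>n. n \<ge> 1 \<Longrightarrow> real n \<le> w n"
    and C1: "C1 \<ge> 1"
    and col_wtil_le: "\<And>j t. j \<ge> 1 \<Longrightarrow> t \<ge> 0 \<Longrightarrow> (\<Sum>n=1..j. wtil \<alpha> a w n * col n j t) \<le> C1 * wtil \<alpha> a w j"
    and col_wtil_smooth: "\<And>j t. j \<ge> 1 \<Longrightarrow> 0 < t \<Longrightarrow> t \<le> 1 \<Longrightarrow>
      (\<Sum>n=1..j. wtil \<alpha> a w n * col n j t) \<le> C1 * t powr (-\<alpha>) * w j"
begin

abbreviation wt :: "nat \<Rightarrow> real" where "wt \<equiv> wtil \<alpha> a w"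

lemma wt_ge_w: "n \<ge> 1 \<Longrightarrow> w n \<le> wt n"
  using ge_one_powr_ge_zero[of "1 + a n" \<alpha>] a_nn[of n] alpha wpos[of n] by (simp add: wtil_def)

lemma wt_pos: "n \<ge> 1 \<Longrightarrow> 0 < wt n"
  using wt_ge_w[of n] wpos[of n] by linarith

lemma lsp_wt_w:
  assumes "f \<in> lsp wt" shows "f \<in> lsp w" "wnorm w f \<le> wnorm wt f"
proof -
  have "(\<Sum>n=1..N. w n * \<bar>f n\<bar>) \<le> wnorm wt f" for N
  proof -
    have "(\<Sum>n=1..N. w n * \<bar>f n\<bar>) \<le> (\<Sum>n=1..N. wt n * \<bar>f n\<bar>)"
      using wt_ge_w by (intro sum_mono mult_right_mono) auto
    also have "\<dots> \<le> wnorm wt f" by (rule wnorm_sum_le[OF assms wt_pos]) auto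
    finally show ?thesis .
  qed
  from lsp_boundI[OF lsp_zero[OF assms] wpos this] show "f \<in> lsp w" "wnorm w f \<le> wnorm wt f" by auto
qed

text \<open>The columns determine S(t) on the whole space: truncations of f converge to f, and the
  bounded operator S(t) carries this over.\<close>

lemma S_sums:
  assumes f: "f \<in> lsp w" and t: "t \<ge> 0" and n: "n \<ge> 1"
  shows "(\<lambda>j. col n j t * f j) sums S t f n"
proof -
  obtain M where M: "\<And>f. f \<in> lsp w \<Longrightarrow> wnorm w (S t f) \<le> M * wnorm w f" using S_bounded[OF t] by blast
  have wn: "0 < w n" using wpos n by simp
  have eq: "S t (strunc N f) n = (\<Sum>j<Suc N. col n j t * f j)" for N
  proof -
    have "S t (strunc N f) n = (\<Sum>j=1..N. strunc N f j * col n j t)"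
      by (rule S_finite) (use lsp_zero[OF f] t in \<open>auto simp: strunc_def\<close>)
    also have "\<dots> = (\<Sum>j\<in>{1..N}. col n j t * f j)" by (rule sum.cong) (auto simp: strunc_def)
    also have "\<dots> = (\<Sum>j<Suc N. col n j t * f j)"
      by (rule sum.mono_neutral_left) (use lsp_zero[OF f] in \<open>auto simp: not_le Suc_le_eq\<close>)
    finally show ?thesis .
  qed
  have est: "\<bar>S t (strunc N f) n - S t f n\<bar> \<le> M / w n * wnorm w (\<lambda>n. f n - strunc N f n)" for N
  proof -
    have l: "(\<lambda>n. f n - strunc N f n) \<in> lsp w" by (rule lsp_diff(1)[OF f strunc_lsp[OF f] wpos])
    have "w n * \<bar>S t f n - S t (strunc N f) n\<bar> \<le> wnorm w (S t (\<lambda>n. f n - strunc N f n))"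
      using wnorm_comp_le[OF S_lsp[OF t l] wpos, of n] S_diff[OF t f strunc_lsp[OF f]] by simp
    also have "\<dots> \<le> M * wnorm w (\<lambda>n. f n - strunc N f n)" by (rule M[OF l])
    finally show ?thesis using wn by (simp add: field_simps abs_minus_commute)
  qed
  have "(\<lambda>N. M / w n * wnorm w (\<lambda>n. f n - strunc N f n)) \<longlonglongrightarrow> 0"
    using tendsto_mult_left[OF strunc_tendsto[OF f], of "M / w n"] by simp
  then have "(\<lambda>N. S t (strunc N f) n - S t f n) \<longlonglongrightarrow> 0"
    by (rule Lim_null_comparison[rotated]) (use est in auto)
  then have "(\<lambda>N. \<Sum>j<Suc N. col n j t * f j) \<longlonglongrightarrow> S t f n"
    unfolding eq[symmetric] by (simp add: LIM_zero_iff)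
  then show ?thesis unfolding sums_def by (rule LIMSEQ_imp_Suc)
qed

text \<open>Operators given by a nonnegative matrix are bounded between weighted l1 spaces as soon
  as the weighted column sums are. The finite sum over n is exchanged with the series over j, so
  S(t) f is seen to lie in the target space rather than assumed to.\<close>

lemma S_norm_le_weights:
  assumes f: "f \<in> lsp w" "f \<in> lsp v'" and t: "t \<ge> 0"
    and v: "\<And>n. n \<ge> 1 \<Longrightarrow> 0 < v n" and v': "\<And>n. n \<ge> 1 \<Longrightarrow> 0 < v' n"
    and col: "\<And>j. j \<ge> 1 \<Longrightarrow> (\<Sum>n=1..j. v n * col n j t) \<le> D * v' j"
  shows "S t f \<in> lsp v" "wnorm v (S t f) \<le> D * wnorm v' f"
proof -
  have f0: "f 0 = 0" using lsp_zero[OF f(1)] .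
  have af: "(\<lambda>n. \<bar>f n\<bar>) \<in> lsp w" using f by (simp add: lsp_def)
  have sm: "summable (\<lambda>j. col n j t * \<bar>f j\<bar>)" if "n \<ge> 1" for n
    using S_sums[OF af t that] by (rule sums_summable)
  have bd: "\<bar>S t f n\<bar> \<le> (\<Sum>j. col n j t * \<bar>f j\<bar>)" if n: "n \<ge> 1" for n
  proof -
    have eq: "norm (col n j t * f j) = col n j t * \<bar>f j\<bar>" for j
      using col_nonneg[OF n _ t, of j] f0 by (cases "j = 0") (auto simp: abs_mult)
    have "norm (\<Sum>j. col n j t * f j) \<le> (\<Sum>j. norm (col n j t * f j))"
      by (rule summable_norm) (use sm[OF n] in \<open>simp only: eq\<close>)
    then show ?thesis unfolding eq using S_sums[OF f(1) t n] by (simp add: sums_iff)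
  qed
  have "(\<Sum>n=1..N. v n * \<bar>S t f n\<bar>) \<le> D * wnorm v' f" for N
  proof -
    have "(\<Sum>n=1..N. v n * \<bar>S t f n\<bar>) \<le> (\<Sum>n=1..N. v n * (\<Sum>j. col n j t * \<bar>f j\<bar>))"
      using bd v by (intro sum_mono mult_left_mono) (auto simp: less_imp_le)
    also have "\<dots> = (\<Sum>n=1..N. (\<Sum>j. v n * (col n j t * \<bar>f j\<bar>)))"
      using sm by (intro sum.cong) (auto simp: suminf_mult)
    also have "\<dots> = (\<Sum>j. \<Sum>n=1..N. v n * (col n j t * \<bar>f j\<bar>))"
      using sm by (intro suminf_sum[symmetric]) (auto intro: summable_mult)
    also have "\<dots> \<le> (\<Sum>j. D * (v' j * \<bar>f j\<bar>))"
    proof (rule suminf_le)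
      fix j
      show "(\<Sum>n=1..N. v n * (col n j t * \<bar>f j\<bar>)) \<le> D * (v' j * \<bar>f j\<bar>)"
      proof (cases "j = 0")
        case False
        have "(\<Sum>n=1..N. v n * col n j t) \<le> (\<Sum>n=1..j. v n * col n j t)"
          by (rule col_sum_extend) (use False t v in \<open>auto simp: less_imp_le\<close>)
        also have "\<dots> \<le> D * v' j" using col False by simp
        finally have "(\<Sum>n=1..N. v n * col n j t) * \<bar>f j\<bar> \<le> D * v' j * \<bar>f j\<bar>" by (rule mult_right_mono) simp
        then show ?thesis by (simp add: sum_distrib_right mult.assoc)
      qed (simp add: f0)
      show "summable (\<lambda>j. \<Sum>n=1..N. v n * (col n j t * \<bar>f j\<bar>))"
        using sm by (intro summable_sum summable_mult) auto
      show "summable (\<lambda>j. D * (v' j * \<bar>f j\<bar>))" using f(2) by (intro summable_mult) (simp add: lsp_def)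
    qed
    also have "\<dots> = D * wnorm v' f" unfolding wnorm_def using f(2) by (intro suminf_mult) (simp add: lsp_def)
    finally show ?thesis .
  qed
  from lsp_boundI[OF _ v this] show "S t f \<in> lsp v" "wnorm v (S t f) \<le> D * wnorm v' f"
    using lsp_zero[OF S_lsp[OF t f(1)]] by auto
qed

lemma S_contraction: "f \<in> lsp w \<Longrightarrow> t \<ge> 0 \<Longrightarrow> wnorm w (S t f) \<le> wnorm w f"
  using S_norm_le_weights(2)[of f w t w 1] wpos col_w_le by simp

lemma S_wt:
  assumes "f \<in> lsp wt" "t \<ge> 0"
  shows "S t f \<in> lsp wt" "wnorm wt (S t f) \<le> C1 * wnorm wt f"
  using S_norm_le_weights[OF lsp_wt_w(1)[OF assms(1)] assms(1) assms(2) wt_pos wt_pos col_wtil_le] assms by auto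

lemma S_smooth:
  assumes "f \<in> lsp w" "0 < t" "t \<le> 1"
  shows "S t f \<in> lsp wt" "wnorm wt (S t f) \<le> C1 * t powr (-\<alpha>) * wnorm w f"
  using S_norm_le_weights[OF assms(1) assms(1) _ wt_pos wpos col_wtil_smooth] assms by auto

text \<open>Strong continuity is given only for the weaker weight w. Orbits of truncated vectors
  remain in finitely many coordinates, where continuity of components is enough; density and the
  uniform constant \<open>C1\<close> extend this to all f with three errors of size e/3.\<close>

lemma S_wt_continuous:
  assumes f: "f \<in> lsp wt" and t: "t \<ge> 0"
  shows "((\<lambda>s. wnorm wt (\<lambda>n. S s f n - S t f n)) \<longlongrightarrow> 0) (at t within {0..})"
proof (rule tendstoI)
  fix e :: real assume e: "e > 0"
  have C0: "C1 > 0" using C1 by simp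
  have "\<forall>\<^sub>F N in sequentially. wnorm wt (\<lambda>n. f n - strunc N f n) < e / (3 * C1)"
    using strunc_tendsto[OF f] by (rule order_tendstoD(2)) (use e C0 in auto)
  then obtain N where N: "wnorm wt (\<lambda>n. f n - strunc N f n) < e / (3 * C1)"
    by (auto simp: eventually_sequentially)
  let ?g = "strunc N f"
  have g: "?g \<in> lsp wt" by (rule strunc_lsp[OF f])
  have fg: "(\<lambda>n. f n - ?g n) \<in> lsp wt" by (rule lsp_diff(1)[OF f g wt_pos])
  have near: "wnorm wt (\<lambda>n. S s f n - S s ?g n) < e / 3" if "s \<ge> 0" for s
  proof -
    have "wnorm wt (\<lambda>n. S s f n - S s ?g n) = wnorm wt (S s (\<lambda>n. f n - ?g n))"
      using S_diff[OF that lsp_wt_w(1)[OF f] lsp_wt_w(1)[OF g]] by simp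
    also have "\<dots> \<le> C1 * wnorm wt (\<lambda>n. f n - ?g n)" by (rule S_wt(2)[OF fg that])
    also have "\<dots> < e / 3" using N C0 by (simp add: field_simps)
    finally show ?thesis .
  qed
  have Sg: "S s ?g n = (\<Sum>j=1..N. ?g j * col n j s)" if "s \<ge> 0" for s n
    by (rule S_finite) (use that lsp_zero[OF f] in \<open>auto simp: strunc_def\<close>)
  have Sg0: "S s ?g n = 0" if "s \<ge> 0" "n > N \<or> n = 0" for s n
    using that col_triangular[of n _ s] col_zero_index[of _ s] unfolding Sg[OF that(1)] by (intro sum.neutral) auto
  have mid: "((\<lambda>s. \<Sum>n=1..N. wt n * \<bar>S s ?g n - S t ?g n\<bar>) \<longlongrightarrow> (\<Sum>n=1..N. wt n * \<bar>S t ?g n - S t ?g n\<bar>)) (at t within {0..})"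
    using S_comp_continuous[OF lsp_wt_w(1)[OF g]] t unfolding continuous_on
    by (intro tendsto_intros) auto
  then have "\<forall>\<^sub>F s in at t within {0..}. (\<Sum>n=1..N. wt n * \<bar>S s ?g n - S t ?g n\<bar>) < e / 3"
    by (rule order_tendstoD(2)) (use e in simp)
  moreover have "\<forall>\<^sub>F s in at t within {0..}. s \<ge> 0"
    by (auto simp: eventually_at_filter)
  ultimately show "\<forall>\<^sub>F s in at t within {0..}. dist (wnorm wt (\<lambda>n. S s f n - S t f n)) 0 < e"
  proof eventually_elim
    case (elim s)
    note L = S_wt(1)[OF f elim(2)] S_wt(1)[OF g elim(2)] S_wt(1)[OF f t] S_wt(1)[OF g t]
    have "wnorm wt (\<lambda>n. S s ?g n - S t ?g n) = (\<Sum>n=1..N. wt n * \<bar>S s ?g n - S t ?g n\<bar>)"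
      by (rule wnorm_finite_support) (use Sg0 elim t in auto)
    then have m: "wnorm wt (\<lambda>n. S s ?g n - S t ?g n) < e / 3" using elim by simp
    have "wnorm wt (\<lambda>n. S s f n - S t f n) \<le> wnorm wt (\<lambda>n. S s f n - S s ?g n) + wnorm wt (\<lambda>n. S s ?g n - S t f n)"
      by (rule wnorm_triangle[OF L(1,2,3) wt_pos])
    moreover have "wnorm wt (\<lambda>n. S s ?g n - S t f n) \<le> wnorm wt (\<lambda>n. S s ?g n - S t ?g n) + wnorm wt (\<lambda>n. S t ?g n - S t f n)"
      by (rule wnorm_triangle[OF L(2,4,3) wt_pos])
    ultimately have "wnorm wt (\<lambda>n. S s f n - S t f n) < e"
      using near[OF elim(2)] near[OF t] m by (simp add: wnorm_diff_commute[of wt "S t ?g" "S t f"])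
    then show ?case using wnorm_nonneg[OF lsp_diff(1)[OF L(1,3) wt_pos] wt_pos] by simp
  qed
qed

subsection \<open>The coagulation operator\<close>

text \<open>The coagulation operator as a linear function of the array H of pair interactions, so
  that differences of coagulation terms, in the arguments or in the kernel, have the same
  shape.\<close>

definition gain_loss :: "(nat \<Rightarrow> nat \<Rightarrow> real) \<Rightarrow> nat \<Rightarrow> real" where
  "gain_loss H n = (if n = 0 then 0 else (1/2) * (\<Sum>j=1..n-1. H (n-j) j) - (\<Sum>j. H n j))"

lemma Kop_gain_loss: "Kop k t f = gain_loss (\<lambda>n j. k n j t * f n * f j)"
  by (rule ext) (simp add: Kop_def gain_loss_def)

text \<open>Two product terms are allowed on the right because the difference of two quadratic
  expressions splits into two bilinear ones. The gain is a Cauchy product, with n - j and j adding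
  up to n exactly as the weight w(n) requires; the loss uses w(n) \<le> w(n + j). The factor 3/2 is
  1/2 for the gain plus 1 for the loss.\<close>

lemma gain_loss_bound:
  assumes H0: "\<And>n. H n 0 = 0"
    and bd: "\<And>n j. n \<ge> 1 \<Longrightarrow> j \<ge> 1 \<Longrightarrow> w (n + j) * \<bar>H n j\<bar> \<le> X n * Y j + X' n * Y' j"
    and nn: "\<And>n. 0 \<le> X n" "\<And>n. 0 \<le> Y n" "\<And>n. 0 \<le> X' n" "\<And>n. 0 \<le> Y' n"
    and sm: "summable X" "summable Y" "summable X'" "summable Y'"
  shows "\<And>n. n \<ge> 1 \<Longrightarrow> summable (H n)" "gain_loss H \<in> lsp w"
    "wnorm w (gain_loss H) \<le> 3/2 * (suminf X * suminf Y + suminf X' * suminf Y')"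
proof -
  let ?P = "suminf X * suminf Y + suminf X' * suminf Y'"
  have loss: "w n * \<bar>H n j\<bar> \<le> X n * Y j + X' n * Y' j" if n: "n \<ge> 1" for n j
  proof (cases "j = 0")
    case False
    have "w n * \<bar>H n j\<bar> \<le> w (n + j) * \<bar>H n j\<bar>" using w_mono[OF n, of "n + j"] by (intro mult_right_mono) auto
    also have "\<dots> \<le> X n * Y j + X' n * Y' j" using bd n False by simp
    finally show ?thesis .
  qed (simp add: H0 nn)
  have smY: "summable (\<lambda>j. X n * Y j + X' n * Y' j)" for n
    by (intro summable_add summable_mult sm)
  have swH: "summable (\<lambda>j. w n * \<bar>H n j\<bar>)" if n: "n \<ge> 1" for n
    by (rule summable_comparison_test'[OF smY[of n], of 0])
      (use loss[OF n] wpos[OF n] in \<open>auto simp: abs_mult less_imp_le\<close>)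
  have sabs: "summable (\<lambda>j. \<bar>H n j\<bar>)" if n: "n \<ge> 1" for n
    using summable_mult[OF swH[OF n], of "1 / w n"] wpos[OF n] by simp
  show sH: "\<And>n. n \<ge> 1 \<Longrightarrow> summable (H n)"
    by (rule summable_rabs_cancel[OF sabs])
  have cp: "(\<lambda>n. (\<Sum>i\<le>n. Y i * X (n - i)) + (\<Sum>i\<le>n. Y' i * X' (n - i))) sums ?P"
    using sums_add[OF Cauchy_product_sums[of Y X] Cauchy_product_sums[of Y' X']] sm nn
    by (simp add: mult.commute)
  have "(\<Sum>n=1..N. w n * \<bar>gain_loss H n\<bar>) \<le> 3/2 * ?P" for N
  proof -
    have "w n * \<bar>gain_loss H n\<bar> \<le> 1/2 * ((\<Sum>i\<le>n. Y i * X (n - i)) + (\<Sum>i\<le>n. Y' i * X' (n - i)))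
        + (X n * suminf Y + X' n * suminf Y')" if n: "n \<ge> 1" for n
    proof -
      have g: "w n * \<bar>\<Sum>j=1..n-1. H (n-j) j\<bar> \<le> (\<Sum>i\<le>n. Y i * X (n - i)) + (\<Sum>i\<le>n. Y' i * X' (n - i))"
      proof -
        have "w n * \<bar>\<Sum>j=1..n-1. H (n-j) j\<bar> \<le> (\<Sum>j=1..n-1. w n * \<bar>H (n-j) j\<bar>)"
          unfolding sum_distrib_left[symmetric] using wpos[OF n] by (intro mult_left_mono sum_abs) auto
        also have "\<dots> \<le> (\<Sum>j=1..n-1. X (n-j) * Y j + X' (n-j) * Y' j)"
        proof (rule sum_mono)
          fix j assume j: "j \<in> {1..n-1}"
          then have "n - j \<ge> 1" "j \<ge> 1" "n - j + j = n" by auto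
          then show "w n * \<bar>H (n-j) j\<bar> \<le> X (n-j) * Y j + X' (n-j) * Y' j" using bd[of "n-j" j] by simp
        qed
        also have "\<dots> \<le> (\<Sum>j\<le>n. X (n-j) * Y j + X' (n-j) * Y' j)"
          using nn by (intro sum_mono2) auto
        finally show ?thesis by (simp add: sum.distrib mult.commute)
      qed
      have l: "w n * \<bar>\<Sum>j. H n j\<bar> \<le> X n * suminf Y + X' n * suminf Y'"
      proof -
        have "w n * \<bar>\<Sum>j. H n j\<bar> \<le> w n * (\<Sum>j. \<bar>H n j\<bar>)"
          using summable_rabs[OF sabs[OF n]] wpos[OF n] by (intro mult_left_mono) auto
        also have "\<dots> = (\<Sum>j. w n * \<bar>H n j\<bar>)" by (rule suminf_mult[OF sabs[OF n], symmetric])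
        also have "\<dots> \<le> (\<Sum>j. X n * Y j + X' n * Y' j)" by (rule suminf_le[OF loss[OF n] swH[OF n] smY])
        also have "\<dots> = X n * suminf Y + X' n * suminf Y'"
          using sm by (simp add: suminf_add[symmetric] suminf_mult summable_mult)
        finally show ?thesis .
      qed
      have "\<bar>gain_loss H n\<bar> \<le> 1/2 * \<bar>\<Sum>j=1..n-1. H (n-j) j\<bar> + \<bar>\<Sum>j. H n j\<bar>"
        using n by (auto simp: gain_loss_def abs_mult intro!: order.trans[OF abs_triangle_ineq4])
      then have "w n * \<bar>gain_loss H n\<bar> \<le> w n * (1/2 * \<bar>\<Sum>j=1..n-1. H (n-j) j\<bar> + \<bar>\<Sum>j. H n j\<bar>)"
        using wpos[OF n] by (intro mult_left_mono) auto
      also have "\<dots> = 1/2 * (w n * \<bar>\<Sum>j=1..n-1. H (n-j) j\<bar>) + w n * \<bar>\<Sum>j. H n j\<bar>"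
        by (simp add: algebra_simps)
      also have "\<dots> \<le> 1/2 * ((\<Sum>i\<le>n. Y i * X (n - i)) + (\<Sum>i\<le>n. Y' i * X' (n - i)))
        + (X n * suminf Y + X' n * suminf Y')"
        by (intro add_mono mult_left_mono g l) simp
      finally show ?thesis .
    qed
    then have "(\<Sum>n=1..N. w n * \<bar>gain_loss H n\<bar>) \<le> (\<Sum>n=1..N. 1/2 * ((\<Sum>i\<le>n. Y i * X (n - i)) + (\<Sum>i\<le>n. Y' i * X' (n - i)))
        + (X n * suminf Y + X' n * suminf Y'))"
      by (intro sum_mono) auto
    also have "\<dots> = 1/2 * (\<Sum>n=1..N. (\<Sum>i\<le>n. Y i * X (n - i)) + (\<Sum>i\<le>n. Y' i * X' (n - i)))
        + ((\<Sum>n=1..N. X n) * suminf Y + (\<Sum>n=1..N. X' n) * suminf Y')"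
      unfolding sum.distrib[of "\<lambda>n. 1/2 * _ n"] sum.distrib[of "\<lambda>n. X n * _"] sum_distrib_left sum_distrib_right ..
    also have "\<dots> \<le> 1/2 * ?P + ?P"
    proof (intro add_mono mult_left_mono mult_right_mono)
      show "(\<Sum>n=1..N. (\<Sum>i\<le>n. Y i * X (n - i)) + (\<Sum>i\<le>n. Y' i * X' (n - i))) \<le> ?P"
        unfolding sums_unique[OF cp] using nn
        by (intro sum_le_suminf sums_summable[OF cp]) (auto intro!: add_nonneg_nonneg sum_nonneg)
      show "(\<Sum>n=1..N. X n) \<le> suminf X" "(\<Sum>n=1..N. X' n) \<le> suminf X'"
        using nn sm by (auto intro!: sum_le_suminf)
    qed (use nn sm in \<open>auto intro: suminf_nonneg\<close>)
    also have "1/2 * ?P + ?P = 3/2 * ?P" by (simp add: field_simps)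
    finally show ?thesis .
  qed
  note B = this
  have z: "gain_loss H 0 = 0" by (simp add: gain_loss_def)
  show "gain_loss H \<in> lsp w" by (rule lsp_boundI(1)[where v = w, OF z wpos B])
  show "wnorm w (gain_loss H) \<le> 3/2 * ?P" by (rule lsp_boundI(2)[where v = w, OF z wpos B])
qed

lemma gain_loss_diff:
  assumes "\<And>n. n \<ge> 1 \<Longrightarrow> summable (H n)" "\<And>n. n \<ge> 1 \<Longrightarrow> summable (H' n)"
  shows "gain_loss H n - gain_loss H' n = gain_loss (\<lambda>n j. H n j - H' n j) n"
  using assms[of n] by (simp add: gain_loss_def sum_subtractf suminf_diff[symmetric] algebra_simps)

text \<open>All kernel hypotheses on a compact time interval with one fixed constant. The property
  survives restriction, time shift and truncation with the same \<open>c\<close>, so step lengths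
  need not be adapted.\<close>

definition kernel_ok :: "(nat \<Rightarrow> nat \<Rightarrow> real \<Rightarrow> real) \<Rightarrow> real \<Rightarrow> real \<Rightarrow> bool" where
  "kernel_ok k \<tau> c \<longleftrightarrow> 0 \<le> c \<and>
     (\<forall>n\<ge>1. \<forall>j\<ge>1. (\<forall>t\<in>{0..\<tau>}. 0 \<le> k n j t \<and> k n j t \<le> c * wt n * wt j / w (n + j) \<and> k n j t = k j n t) \<and>
        continuous_on {0..\<tau>} (k n j))"

lemma kernel_okD:
  assumes "kernel_ok k \<tau> c"
  shows "0 \<le> c" and "\<And>n j t. n \<ge> 1 \<Longrightarrow> j \<ge> 1 \<Longrightarrow> t \<in> {0..\<tau>} \<Longrightarrow> 0 \<le> k n j t"
    and "\<And>n j t. n \<ge> 1 \<Longrightarrow> j \<ge> 1 \<Longrightarrow> t \<in> {0..\<tau>} \<Longrightarrow> k n j t \<le> c * wt n * wt j / w (n + j)"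
    and "\<And>n j t. n \<ge> 1 \<Longrightarrow> j \<ge> 1 \<Longrightarrow> t \<in> {0..\<tau>} \<Longrightarrow> k n j t = k j n t"
    and "\<And>n j. n \<ge> 1 \<Longrightarrow> j \<ge> 1 \<Longrightarrow> continuous_on {0..\<tau>} (k n j)"
  using assms unfolding kernel_ok_def by blast+

lemma kernel_weight_le:
  assumes "kernel_ok k \<tau> c" "t \<in> {0..\<tau>}" "n \<ge> 1" "j \<ge> 1"
  shows "w (n + j) * \<bar>k n j t\<bar> \<le> c * wt n * wt j"
proof -
  have "\<bar>k n j t\<bar> \<le> c * wt n * wt j / w (n + j)" using kernel_okD(2,3)[OF assms(1) assms(3,4,2)] by simp
  then show ?thesis using wpos[of "n + j"] assms by (simp add: field_simps)
qed

lemma summable_wt: "f \<in> lsp wt \<Longrightarrow> summable (\<lambda>n. wt n * \<bar>f n\<bar>)"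
  by (simp add: lsp_def)

lemma wt_term_nonneg: "f \<in> lsp wt \<Longrightarrow> 0 \<le> wt n * \<bar>f n\<bar>"
  by (rule lsp_term_nonneg[OF _ wt_pos])

lemma Kop_summable:
  assumes k: "kernel_ok k \<tau> c" "t \<in> {0..\<tau>}" and f: "f \<in> lsp wt" and n: "n \<ge> 1"
  shows "summable (\<lambda>j. k n j t * f n * f j)"
proof (rule gain_loss_bound(1)[where X = "\<lambda>n. c * (wt n * \<bar>f n\<bar>)" and Y = "\<lambda>n. wt n * \<bar>f n\<bar>" and X' = "\<lambda>n. 0" and Y' = "\<lambda>n. 0", OF _ _ _ _ _ _ _ _ _ _ n])
  fix n j :: nat assume nj: "n \<ge> 1" "j \<ge> 1"
  have "w (n + j) * \<bar>k n j t\<bar> * (\<bar>f n\<bar> * \<bar>f j\<bar>) \<le> c * wt n * wt j * (\<bar>f n\<bar> * \<bar>f j\<bar>)"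
    by (rule mult_right_mono[OF kernel_weight_le[OF k nj]]) simp
  then show "w (n + j) * \<bar>k n j t * f n * f j\<bar> \<le> c * (wt n * \<bar>f n\<bar>) * (wt j * \<bar>f j\<bar>) + 0 * 0"
    by (simp add: abs_mult mult_ac)
qed (use k f lsp_zero[OF f] summable_wt[OF f] wt_term_nonneg[OF f] in \<open>auto simp: kernel_ok_def intro: summable_mult\<close>)

text \<open>With h = f - g, the pair term f_n f_j - g_n g_j equals f_n h_j + h_n g_j, which gives
  the two products in \<open>gain_loss_bound\<close>. The kernel bound cancels w(n + j) and leaves
  the larger weight at each index.\<close>

lemma Kop_lipschitz:
  assumes k: "kernel_ok k \<tau> c" "t \<in> {0..\<tau>}" and f: "f \<in> lsp wt" and g: "g \<in> lsp wt"
  shows "(\<lambda>n. Kop k t f n - Kop k t g n) \<in> lsp w"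
    "wnorm w (\<lambda>n. Kop k t f n - Kop k t g n) \<le> 3/2 * c * (wnorm wt f + wnorm wt g) * wnorm wt (\<lambda>n. f n - g n)"
proof -
  let ?H = "\<lambda>n j. k n j t * f n * f j - k n j t * g n * g j"
  let ?h = "\<lambda>n. f n - g n"
  have h: "?h \<in> lsp wt" by (rule lsp_diff(1)[OF f g wt_pos])
  have eq: "(\<lambda>n. Kop k t f n - Kop k t g n) = gain_loss ?H"
    unfolding Kop_gain_loss by (rule ext, rule gain_loss_diff) (use Kop_summable k f g in auto)
  have c: "c \<ge> 0" using k by (simp add: kernel_ok_def)
  have bd: "w (n + j) * \<bar>?H n j\<bar> \<le> c * (wt n * \<bar>f n\<bar>) * (wt j * \<bar>?h j\<bar>) + c * (wt n * \<bar>?h n\<bar>) * (wt j * \<bar>g j\<bar>)"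
    if nj: "n \<ge> 1" "j \<ge> 1" for n j
  proof -
    have "?H n j = k n j t * (f n * ?h j + ?h n * g j)" by (simp add: algebra_simps)
    then have "\<bar>?H n j\<bar> \<le> \<bar>k n j t\<bar> * (\<bar>f n\<bar> * \<bar>?h j\<bar> + \<bar>?h n\<bar> * \<bar>g j\<bar>)"
      using mult_left_mono[OF abs_triangle_ineq[of "f n * ?h j" "?h n * g j"], of "\<bar>k n j t\<bar>"] by (simp add: abs_mult)
    then have "w (n + j) * \<bar>?H n j\<bar> \<le> w (n + j) * (\<bar>k n j t\<bar> * (\<bar>f n\<bar> * \<bar>?h j\<bar> + \<bar>?h n\<bar> * \<bar>g j\<bar>))"
      using wpos[of "n + j"] nj by (intro mult_left_mono) auto
    also have "\<dots> = (w (n + j) * \<bar>k n j t\<bar>) * (\<bar>f n\<bar> * \<bar>?h j\<bar> + \<bar>?h n\<bar> * \<bar>g j\<bar>)" by (simp add: mult.assoc)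
    also have "\<dots> \<le> (c * wt n * wt j) * (\<bar>f n\<bar> * \<bar>?h j\<bar> + \<bar>?h n\<bar> * \<bar>g j\<bar>)"
      by (rule mult_right_mono[OF kernel_weight_le[OF k nj]]) simp
    finally show ?thesis by (simp add: algebra_simps)
  qed
  note B = gain_loss_bound[of ?H "\<lambda>n. c * (wt n * \<bar>f n\<bar>)" "\<lambda>n. wt n * \<bar>?h n\<bar>" "\<lambda>n. c * (wt n * \<bar>?h n\<bar>)" "\<lambda>n. wt n * \<bar>g n\<bar>",
      OF _ bd mult_nonneg_nonneg[OF c wt_term_nonneg[OF f]] wt_term_nonneg[OF h] mult_nonneg_nonneg[OF c wt_term_nonneg[OF h]] wt_term_nonneg[OF g]
       summable_mult[OF summable_wt[OF f]] summable_wt[OF h] summable_mult[OF summable_wt[OF h]] summable_wt[OF g]]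
  have H0: "?H n 0 = 0" for n using lsp_zero[OF f] lsp_zero[OF g] by simp
  show "(\<lambda>n. Kop k t f n - Kop k t g n) \<in> lsp w" unfolding eq by (rule B(2)[OF H0])
  have "wnorm w (gain_loss ?H) \<le> 3/2 * (c * wnorm wt f * wnorm wt ?h + c * wnorm wt ?h * wnorm wt g)"
    using B(3)[OF H0] suminf_mult[OF summable_wt[OF f], of c] suminf_mult[OF summable_wt[OF h], of c]
    by (simp add: wnorm_def)
  then show "wnorm w (\<lambda>n. Kop k t f n - Kop k t g n) \<le> 3/2 * c * (wnorm wt f + wnorm wt g) * wnorm wt ?h"
    unfolding eq by (simp add: algebra_simps)
qed

lemma Kop_lsp:
  assumes k: "kernel_ok k \<tau> c" "t \<in> {0..\<tau>}" and f: "f \<in> lsp wt"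
  shows "Kop k t f \<in> lsp w" "wnorm w (Kop k t f) \<le> 3/2 * c * (wnorm wt f)\<^sup>2"
proof -
  have z: "Kop k t (\<lambda>n. 0) = (\<lambda>n. 0)" by (auto simp: Kop_def)
  show "Kop k t f \<in> lsp w" "wnorm w (Kop k t f) \<le> 3/2 * c * (wnorm wt f)\<^sup>2"
    using Kop_lipschitz[OF k f lsp_zero_fun(1)] by (auto simp: z lsp_zero_fun power2_eq_square mult_ac)
qed

text \<open>Cutting off by n + j rather than by the single indices forbids precisely those mergers
  whose product exceeds N. Sizes above N are then never produced, and the mass lost in a remaining
  merger is also regained.\<close>

definition ktrunc :: "nat \<Rightarrow> (nat \<Rightarrow> nat \<Rightarrow> real \<Rightarrow> real) \<Rightarrow> nat \<Rightarrow> nat \<Rightarrow> real \<Rightarrow> real" where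
  "ktrunc N k n j t = (if n + j \<le> N then k n j t else 0)"

lemma kernel_ok_ktrunc:
  assumes "kernel_ok k \<tau> c" shows "kernel_ok (ktrunc N k) \<tau> c"
  unfolding kernel_ok_def
proof (intro conjI allI impI ballI)
  fix n j :: nat assume nj: "n \<ge> 1" "j \<ge> 1"
  have "0 \<le> c * wt n * wt j / w (n + j)"
    using assms wt_pos[of n] wt_pos[of j] wpos[of "n + j"] nj by (auto simp: kernel_ok_def intro!: divide_nonneg_pos)
  then show "ktrunc N k n j t \<le> c * wt n * wt j / w (n + j)" if "t \<in> {0..\<tau>}" for t
    using kernel_okD(3)[OF assms nj that] by (simp add: ktrunc_def)
  show "continuous_on {0..\<tau>} (ktrunc N k n j)"
    using assms nj by (cases "n + j \<le> N") (auto simp: kernel_ok_def ktrunc_def)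
qed (use assms in \<open>auto simp: kernel_ok_def ktrunc_def add.commute\<close>)

text \<open>If n + j > N, one of the two indices exceeds \<open>N div 2\<close>, so every suppressed
  interaction contains a factor from the tail of f.\<close>

lemma Kop_ktrunc_close:
  assumes k: "kernel_ok k \<tau> c" "t \<in> {0..\<tau>}" and f: "f \<in> lsp wt"
  shows "wnorm w (\<lambda>n. Kop k t f n - Kop (ktrunc N k) t f n) \<le> 3 * c * wnorm wt f * wnorm wt (\<lambda>n. f n - strunc (N div 2) f n)"
proof -
  let ?H = "\<lambda>n j. k n j t * f n * f j - ktrunc N k n j t * f n * f j"
  let ?h = "\<lambda>n. f n - strunc (N div 2) f n"
  have h: "?h \<in> lsp wt" by (rule lsp_diff(1)[OF f strunc_lsp[OF f] wt_pos])
  have eq: "(\<lambda>n. Kop k t f n - Kop (ktrunc N k) t f n) = gain_loss ?H"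
    unfolding Kop_gain_loss by (rule ext, rule gain_loss_diff) (use Kop_summable[OF _ k(2) f] kernel_ok_ktrunc[OF k(1)] k(1) in blast)+
  have c: "c \<ge> 0" using k by (simp add: kernel_ok_def)
  have bd: "w (n + j) * \<bar>?H n j\<bar> \<le> c * (wt n * \<bar>f n\<bar>) * (wt j * \<bar>?h j\<bar>) + c * (wt n * \<bar>?h n\<bar>) * (wt j * \<bar>f j\<bar>)"
    if nj: "n \<ge> 1" "j \<ge> 1" for n j
  proof -
    have "\<bar>?H n j\<bar> \<le> \<bar>k n j t\<bar> * (\<bar>f n\<bar> * \<bar>?h j\<bar> + \<bar>?h n\<bar> * \<bar>f j\<bar>)"
    proof (cases "n + j \<le> N")
      case False
      then have "n > N div 2 \<or> j > N div 2" by linarith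
      then show ?thesis using False by (auto simp: ktrunc_def strunc_def abs_mult mult.assoc intro!: mult_left_mono)
    qed (simp add: ktrunc_def)
    then have "w (n + j) * \<bar>?H n j\<bar> \<le> w (n + j) * (\<bar>k n j t\<bar> * (\<bar>f n\<bar> * \<bar>?h j\<bar> + \<bar>?h n\<bar> * \<bar>f j\<bar>))"
      using wpos[of "n + j"] nj by (intro mult_left_mono) auto
    also have "\<dots> = (w (n + j) * \<bar>k n j t\<bar>) * (\<bar>f n\<bar> * \<bar>?h j\<bar> + \<bar>?h n\<bar> * \<bar>f j\<bar>)" by (simp add: mult.assoc)
    also have "\<dots> \<le> (c * wt n * wt j) * (\<bar>f n\<bar> * \<bar>?h j\<bar> + \<bar>?h n\<bar> * \<bar>f j\<bar>)"
      by (rule mult_right_mono[OF kernel_weight_le[OF k nj]]) simp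
    finally show ?thesis by (simp add: algebra_simps)
  qed
  note B = gain_loss_bound[of ?H "\<lambda>n. c * (wt n * \<bar>f n\<bar>)" "\<lambda>n. wt n * \<bar>?h n\<bar>" "\<lambda>n. c * (wt n * \<bar>?h n\<bar>)" "\<lambda>n. wt n * \<bar>f n\<bar>",
      OF _ bd mult_nonneg_nonneg[OF c wt_term_nonneg[OF f]] wt_term_nonneg[OF h] mult_nonneg_nonneg[OF c wt_term_nonneg[OF h]] wt_term_nonneg[OF f]
       summable_mult[OF summable_wt[OF f]] summable_wt[OF h] summable_mult[OF summable_wt[OF h]] summable_wt[OF f]]
  have H0: "?H n 0 = 0" for n using lsp_zero[OF f] by simp
  have "wnorm w (gain_loss ?H) \<le> 3/2 * (c * wnorm wt f * wnorm wt ?h + c * wnorm wt ?h * wnorm wt f)"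
    using B(3)[OF H0] suminf_mult[OF summable_wt[OF f], of c] suminf_mult[OF summable_wt[OF h], of c]
    by (simp add: wnorm_def)
  then show ?thesis unfolding eq by (simp add: algebra_simps)
qed

lemma Kop_measurable:
  assumes k: "kernel_ok k \<tau> c" and u: "\<And>n. (\<lambda>s. u s n) \<in> borel_measurable (restrict_space borel {0..\<tau>})"
    and u0: "\<And>s. s \<in> {0..\<tau>} \<Longrightarrow> u s 0 = 0"
  shows "(\<lambda>s. Kop k s (u s) n) \<in> borel_measurable (restrict_space borel {0..\<tau>})"
proof (cases "n = 0")
  case False
  have km: "(\<lambda>s. k n j s) \<in> borel_measurable (restrict_space borel {0..\<tau>})" if "n \<ge> 1" "j \<ge> 1" for n j
    by (rule borel_measurable_continuous_on_restrict[OF kernel_okD(5)[OF k that]])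
  have tm: "(\<lambda>s. k n j s * u s n * u s j) \<in> borel_measurable (restrict_space borel {0..\<tau>})" for j
  \<comment> \<open>Kernel entries with index 0 are arbitrary, so measurability at j = 0 comes from
    \<open>u s 0 = 0\<close>.\<close>
  proof (cases "j = 0")
    case True
    have "(\<lambda>s. k n j s * u s n * u s j) \<in> borel_measurable (restrict_space borel {0..\<tau>}) \<longleftrightarrow>
      (\<lambda>s. 0::real) \<in> borel_measurable (restrict_space borel {0..\<tau>})"
      by (rule measurable_cong) (use True u0 in auto)
    then show ?thesis by simp
  next
    case j: False
    have [measurable]: "(\<lambda>s. k n j s) \<in> borel_measurable (restrict_space borel {0..\<tau>})" using km j False by simp
    note u[measurable]
    show ?thesis by measurable
  qed
  have g: "(\<lambda>s. k (n-j) j s * u s (n-j) * u s j) \<in> borel_measurable (restrict_space borel {0..\<tau>})" if "j \<in> {1..n-1}" for j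
  proof -
    have [measurable]: "(\<lambda>s. k (n-j) j s) \<in> borel_measurable (restrict_space borel {0..\<tau>})" using km[of "n - j" j] that False by auto
    note u[measurable]
    show ?thesis by measurable
  qed
  have "(\<lambda>s. (1/2) * (\<Sum>j=1..n-1. k (n-j) j s * u s (n-j) * u s j) - (\<Sum>j. k n j s * u s n * u s j))
      \<in> borel_measurable (restrict_space borel {0..\<tau>})"
    by (intro borel_measurable_diff borel_measurable_times borel_measurable_const borel_measurable_sum g borel_measurable_suminf tm)
  then show ?thesis using False by (simp add: Kop_def)
qed (simp add: Kop_def)

end

subsection \<open>The Duhamel operator\<close>

lemma small_powr:
  assumes "0 < \<beta>" "0 < (e::real)"
  obtains \<eta> where "0 < \<eta>" "\<eta> \<le> 1" "\<eta> powr \<beta> \<le> e"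
proof
  let ?\<eta> = "min 1 (e powr (1 / \<beta>))"
  show "0 < ?\<eta>" "?\<eta> \<le> 1" using assms by auto
  have "?\<eta> powr \<beta> \<le> (e powr (1 / \<beta>)) powr \<beta>"
    using assms by (intro powr_mono2) auto
  also have "\<dots> = e" using assms by (simp add: powr_powr)
  finally show "?\<eta> powr \<beta> \<le> e" .
qed

text \<open>Since 1 - \<alpha> > 0, the antiderivative is continuous up to the singular endpoint,
  and the fundamental theorem requires its derivative only in the open interval.\<close>

lemma has_integral_singular_kernel:
  assumes "0 \<le> \<alpha>" "\<alpha> < 1" "0 \<le> (t::real)"
  shows "((\<lambda>s. (t - s) powr (-\<alpha>)) has_integral (t powr (1 - \<alpha>) / (1 - \<alpha>))) {0..t}"
proof -
  let ?f = "\<lambda>s. - ((t - s) powr (1 - \<alpha>)) / (1 - \<alpha>)"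
  have "((\<lambda>s. (t - s) powr (-\<alpha>)) has_integral (?f t - ?f 0)) {0..t}"
  proof (rule fundamental_theorem_of_calculus_interior[OF assms(3)])
    show "continuous_on {0..t} ?f"
      using assms by (intro continuous_intros continuous_on_powr') auto
    fix s assume s: "s \<in> {0<..<t}"
    have "((\<lambda>s. t - s) has_real_derivative -1) (at s)" by (auto intro!: derivative_eq_intros)
    from DERIV_chain2[OF has_real_derivative_powr[of "t - s" "1 - \<alpha>"] this] s
    have "((\<lambda>s. (t - s) powr (1 - \<alpha>)) has_real_derivative (1 - \<alpha>) * (t - s) powr (-\<alpha>) * -1) (at s)" by simp
    from DERIV_cdivide[OF DERIV_minus[OF this], of "1 - \<alpha>"]
    have "(?f has_real_derivative (t - s) powr (-\<alpha>)) (at s)" using assms by simp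
    then show "(?f has_vector_derivative (t - s) powr (-\<alpha>)) (at s)"
      by (simp add: has_real_derivative_iff_has_vector_derivative)
  qed
  then show ?thesis using assms by simp
qed

lemma borel_restrict_imp_lebesgue_on:
  fixes f :: "real \<Rightarrow> real"
  assumes "f \<in> borel_measurable (restrict_space borel {a..b})"
  shows "f \<in> borel_measurable (lebesgue_on {a..b})"
proof -
  have "(\<lambda>x. if x \<in> {a..b} then f x else 0) \<in> borel_measurable borel"
    using assms by (subst (asm) measurable_restrict_space_iff[where c = 0]) auto
  then have "(\<lambda>x. if x \<in> {a..b} then f x else 0) \<in> borel_measurable lebesgue"
    by (intro measurable_completion) simp
  then show ?thesis by (subst measurable_restrict_space_iff[where c = 0]) auto
qed

lemma integrable_bounded_Icc:
  fixes f :: "real \<Rightarrow> real"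
  assumes "f \<in> borel_measurable (restrict_space borel {a..b})" "\<And>x. x \<in> {a..b} \<Longrightarrow> \<bar>f x\<bar> \<le> B"
  shows "f integrable_on {a..b}"
  by (rule measurable_bounded_by_integrable_imp_integrable_real[OF borel_restrict_imp_lebesgue_on[OF assms(1)], of "\<lambda>_. B"])
    (use assms(2) in \<open>auto simp: integrable_const_ivl\<close>)

context coag_frag
begin

text \<open>The class of right-hand sides for the Duhamel integral. Measurable components are
  demanded instead of continuity because the limit of the Picard iterates is at first known only as
  a pointwise limit.\<close>

definition adm :: "real \<Rightarrow> real \<Rightarrow> (real \<Rightarrow> nat \<Rightarrow> real) \<Rightarrow> bool" where
  "adm \<tau> \<Phi> F \<longleftrightarrow> (\<forall>s\<in>{0..\<tau>}. F s \<in> lsp w \<and> wnorm w (F s) \<le> \<Phi>) \<and>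
     (\<forall>n. (\<lambda>s. F s n) \<in> borel_measurable (restrict_space borel {0..\<tau>}))"

definition duh :: "(real \<Rightarrow> nat \<Rightarrow> real) \<Rightarrow> real \<Rightarrow> nat \<Rightarrow> real" where
  "duh F t n = integral {0..t} (\<lambda>s. S (t - s) (F s) n)"

lemma admD:
  assumes "adm \<tau> \<Phi> F" "s \<in> {0..\<tau>}" shows "F s \<in> lsp w" "wnorm w (F s) \<le> \<Phi>"
  using assms by (auto simp: adm_def)

lemma adm_nonneg: "adm \<tau> \<Phi> F \<Longrightarrow> 0 \<le> \<tau> \<Longrightarrow> 0 \<le> \<Phi>"
  using admD[of \<tau> \<Phi> F 0] wnorm_nonneg[of "F 0" w, OF _ wpos] by (auto elim: order.trans[rotated])

lemma adm_shift:
  assumes F: "adm \<tau> \<Phi> F" and q: "0 \<le> q" "q \<le> \<tau>"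
  shows "adm (\<tau> - q) \<Phi> (\<lambda>s. F (q + s))"
  unfolding adm_def
proof (intro conjI ballI allI)
  fix n
  have "(\<lambda>s. q + s) \<in> restrict_space borel {0..\<tau> - q} \<rightarrow>\<^sub>M restrict_space borel {0..\<tau>}"
    by (rule measurable_restrict_space3) (use q in auto)
  moreover have "(\<lambda>s. F s n) \<in> borel_measurable (restrict_space borel {0..\<tau>})"
    using F by (simp add: adm_def)
  ultimately show "(\<lambda>s. F (q + s) n) \<in> borel_measurable (restrict_space borel {0..\<tau> - q})"
    by (rule measurable_compose)
qed (use F q in \<open>auto simp: adm_def\<close>)

lemma duh_integrand_bound:
  assumes F: "adm \<tau> \<Phi> F" and t: "t \<le> \<tau>" and s: "s \<in> {0..t}"
  shows "S (t - s) (F s) \<in> lsp w" "wnorm w (S (t - s) (F s)) \<le> \<Phi>" "n \<ge> 1 \<Longrightarrow> \<bar>S (t - s) (F s) n\<bar> \<le> \<Phi> / w n"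
proof -
  have Fs: "F s \<in> lsp w" "wnorm w (F s) \<le> \<Phi>" using admD[OF F] s t by auto
  show L: "S (t - s) (F s) \<in> lsp w" by (rule S_lsp) (use s Fs in auto)
  show N: "wnorm w (S (t - s) (F s)) \<le> \<Phi>" using S_contraction[OF Fs(1), of "t - s"] s Fs(2) by simp
  show "\<bar>S (t - s) (F s) n\<bar> \<le> \<Phi> / w n" if "n \<ge> 1"
    using wnorm_comp_le[OF L wpos, of n] N wpos[OF that] by (simp add: field_simps)
qed

text \<open>Operator and argument both vary with s. The column series writes each coordinate as a
  countable sum of products of a continuous function and a measurable one.\<close>

lemma duh_integrand_measurable:
  assumes F: "adm \<tau> \<Phi> F" and t: "0 \<le> t" "t \<le> \<tau>"
  shows "(\<lambda>s. S (t - s) (F s) n) \<in> borel_measurable (restrict_space borel {0..t})"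
proof (cases "n = 0")
  case True
  have "(\<lambda>s. S (t - s) (F s) n) \<in> borel_measurable (restrict_space borel {0..t}) \<longleftrightarrow>
      (\<lambda>s. 0::real) \<in> borel_measurable (restrict_space borel {0..t})"
    by (rule measurable_cong) (use True lsp_zero[OF duh_integrand_bound(1)[OF F t(2)]] in auto)
  then show ?thesis by simp
next
  case False
  then have n: "n \<ge> 1" by simp
  have tm: "(\<lambda>s. col n j (t - s) * F s j) \<in> borel_measurable (restrict_space borel {0..t})" for j
  proof (cases "j = 0")
    case True
    have "(\<lambda>s. col n j (t - s) * F s j) \<in> borel_measurable (restrict_space borel {0..t}) \<longleftrightarrow>
      (\<lambda>s. 0::real) \<in> borel_measurable (restrict_space borel {0..t})"
    proof (rule measurable_cong)
      fix s assume "s \<in> space (restrict_space borel {0..t})"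
      then have "F s \<in> lsp w" using admD(1)[OF F] t by auto
      then show "col n j (t - s) * F s j = 0" using True lsp_zero by auto
    qed
    then show ?thesis by simp
  next
    case j: False
    have "continuous_on {0..t} (\<lambda>s. col n j (t - s))"
      by (rule continuous_on_compose2[OF col_continuous]) (use j in \<open>auto intro!: continuous_intros\<close>)
    moreover have "(\<lambda>s. F s j) \<in> borel_measurable (restrict_space borel {0..t})"
      by (rule measurable_restrict_mono[of _ _ "{0..\<tau>}"]) (use F t in \<open>auto simp: adm_def\<close>)
    ultimately show ?thesis using borel_measurable_continuous_on_restrict by (intro borel_measurable_times) auto
  qed
  have "(\<lambda>s. S (t - s) (F s) n) \<in> borel_measurable (restrict_space borel {0..t}) \<longleftrightarrow>
      (\<lambda>s. \<Sum>j. col n j (t - s) * F s j) \<in> borel_measurable (restrict_space borel {0..t})"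
  proof (rule measurable_cong)
    fix s assume "s \<in> space (restrict_space borel {0..t})"
    then have "F s \<in> lsp w" "t - s \<ge> 0" using admD(1)[OF F] t by auto
    then show "S (t - s) (F s) n = (\<Sum>j. col n j (t - s) * F s j)"
      using S_sums[OF _ _ n] by (auto simp: sums_iff)
  qed
  then show ?thesis using borel_measurable_suminf[OF tm] by simp
qed

lemma duh_integrable:
  assumes F: "adm \<tau> \<Phi> F" and t: "0 \<le> t" "t \<le> \<tau>"
  shows "(\<lambda>s. S (t - s) (F s) n) integrable_on {0..t}" "(\<lambda>s. \<bar>S (t - s) (F s) n\<bar>) integrable_on {0..t}"
proof -
  have m: "(\<lambda>s. S (t - s) (F s) n) \<in> borel_measurable (restrict_space borel {0..t})"
    by (rule duh_integrand_measurable[OF assms])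
  have b: "\<bar>S (t - s) (F s) n\<bar> \<le> (if n = 0 then 0 else \<Phi> / w n)" if "s \<in> {0..t}" for s
    using duh_integrand_bound[OF F t(2) that] lsp_zero by (cases "n = 0") auto
  show "(\<lambda>s. S (t - s) (F s) n) integrable_on {0..t}"
    by (rule integrable_bounded_Icc[OF m b])
  show "(\<lambda>s. \<bar>S (t - s) (F s) n\<bar>) integrable_on {0..t}"
    by (rule integrable_bounded_Icc[OF borel_measurable_abs[OF m], of "if n = 0 then 0 else \<Phi> / w n"]) (use b in auto)
qed

lemma duh_0: "adm \<tau> \<Phi> F \<Longrightarrow> 0 \<le> t \<Longrightarrow> t \<le> \<tau> \<Longrightarrow> duh F t 0 = 0"
  unfolding duh_def using lsp_zero[OF duh_integrand_bound(1)] by (intro integral_unique has_integral_is_0) auto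

text \<open>A Minkowski inequality for the componentwise integral, proved on finite partial sums so
  that it also places the integral in a space with a larger weight than w. The majorant g may be
  singular at s = t.\<close>

lemma duh_weighted_sum_le:
  assumes F: "adm \<tau> \<Phi> F" and t: "0 \<le> t" "t \<le> \<tau>" and v: "\<And>n. n \<ge> 1 \<Longrightarrow> 0 < v n"
    and g: "(g has_integral G) {0..t}"
    and bd: "\<And>s. s \<in> {0..<t} \<Longrightarrow> S (t - s) (F s) \<in> lsp v \<and> wnorm v (S (t - s) (F s)) \<le> g s"
  shows "duh F t \<in> lsp v" "wnorm v (duh F t) \<le> G"
proof -
  have "(\<Sum>n=1..N. v n * \<bar>duh F t n\<bar>) \<le> G" for N
  proof -
    let ?z = "\<lambda>s. \<Sum>n=1..N. v n * \<bar>S (t - s) (F s) n\<bar>"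
    have zi: "?z integrable_on {0..t}"
      by (intro integrable_sum integrable_on_mult_right duh_integrable[OF F t]) auto
    have "(\<Sum>n=1..N. v n * \<bar>duh F t n\<bar>) \<le> (\<Sum>n=1..N. v n * integral {0..t} (\<lambda>s. \<bar>S (t - s) (F s) n\<bar>))"
    proof (intro sum_mono mult_left_mono)
      fix n
      show "\<bar>duh F t n\<bar> \<le> integral {0..t} (\<lambda>s. \<bar>S (t - s) (F s) n\<bar>)"
        unfolding duh_def using duh_integrable[OF F t, of n]
        using integral_norm_bound_integral[of "\<lambda>s. S (t - s) (F s) n" "{0..t}" "\<lambda>s. \<bar>S (t - s) (F s) n\<bar>"] by simp
    qed (use v in \<open>auto simp: less_imp_le\<close>)
    also have "\<dots> = integral {0..t} ?z"
      using duh_integrable(2)[OF F t] by (simp add: integral_sum integrable_on_mult_right)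
    also have "\<dots> \<le> G"
    proof (rule has_integral_le[OF integrable_integral[OF zi]])
      \<comment> \<open>The bound is available only for s < t. At the single point t the majorant is
        replaced by the integrand, which does not change its integral.\<close>
      show "((\<lambda>s. if s = t then ?z s else g s) has_integral G) {0..t}"
        by (rule has_integral_spike_finite[OF _ _ g, of "{t}"]) auto
      fix s assume "s \<in> {0..t}"
      then show "?z s \<le> (if s = t then ?z s else g s)"
        using bd[of s] wnorm_sum_le[where v = v and f = "S (t - s) (F s)" and I = "{1..N}", OF _ v]
        by (auto elim: order.trans)
    qed
    finally show ?thesis .
  qed
  from lsp_boundI[OF duh_0[OF F t] v this] show "duh F t \<in> lsp v" "wnorm v (duh F t) \<le> G" by auto
qed

lemma duh_w:
  assumes F: "adm \<tau> \<Phi> F" and t: "0 \<le> t" "t \<le> \<tau>"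
  shows "duh F t \<in> lsp w"
  by (rule duh_weighted_sum_le(1)[OF F t wpos has_integral_const_real[of \<Phi> 0 t]])
    (use duh_integrand_bound[OF F t(2)] in auto)

text \<open>The constant \<open>C1\<close> times the integral of (t - s)^(-\<alpha>) over [0, t]: a
  bound for the Duhamel operator from bounded functions with values in weight w to the larger
  weight.\<close>

definition dfac :: "real \<Rightarrow> real" where
  "dfac t = C1 * t powr (1 - \<alpha>) / (1 - \<alpha>)"

lemma dfac_mono: "0 \<le> s \<Longrightarrow> s \<le> t \<Longrightarrow> dfac s \<le> dfac t"
  unfolding dfac_def using C1 alpha by (intro divide_right_mono mult_left_mono powr_mono2) auto

lemma dfac_nonneg: "0 \<le> dfac t"
  unfolding dfac_def using C1 alpha by auto

lemma dfac_small:
  assumes "0 < e" obtains \<eta> where "0 < \<eta>" "\<eta> \<le> 1" "dfac \<eta> \<le> e"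
proof -
  have "0 < e * (1 - \<alpha>) / C1" using assms C1 alpha by simp
  then obtain \<eta> where "0 < \<eta>" "\<eta> \<le> 1" "\<eta> powr (1 - \<alpha>) \<le> e * (1 - \<alpha>) / C1"
    using small_powr[of "1 - \<alpha>" "e * (1 - \<alpha>) / C1"] alpha by auto
  then show thesis using that[of \<eta>] C1 alpha by (simp add: dfac_def field_simps)
qed

lemma duh_wt:
  assumes F: "adm \<tau> \<Phi> F" and t: "0 \<le> t" "t \<le> \<tau>" "t \<le> 1"
  shows "duh F t \<in> lsp wt" "wnorm wt (duh F t) \<le> dfac t * \<Phi>"
proof -
  have \<Phi>: "0 \<le> \<Phi>" using adm_nonneg[OF F] t by simp
  have hi: "((\<lambda>s. C1 * \<Phi> * (t - s) powr (-\<alpha>)) has_integral (C1 * \<Phi> * (t powr (1 - \<alpha>) / (1 - \<alpha>)))) {0..t}"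
    by (rule has_integral_mult_right[OF has_integral_singular_kernel[OF alpha t(1)]])
  have bd: "S (t - s) (F s) \<in> lsp wt \<and> wnorm wt (S (t - s) (F s)) \<le> C1 * \<Phi> * (t - s) powr (-\<alpha>)" if s: "s \<in> {0..<t}" for s
  proof -
    have Fs: "F s \<in> lsp w" "wnorm w (F s) \<le> \<Phi>" using admD[OF F] s t by auto
    have "wnorm wt (S (t - s) (F s)) \<le> C1 * (t - s) powr (-\<alpha>) * wnorm w (F s)"
      by (rule S_smooth(2)[OF Fs(1)]) (use s t in auto)
    also have "\<dots> \<le> C1 * (t - s) powr (-\<alpha>) * \<Phi>" using Fs(2) C1 by (intro mult_left_mono) auto
    finally show ?thesis using S_smooth(1)[OF Fs(1), of "t - s"] s t by (simp add: mult_ac)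
  qed
  from duh_weighted_sum_le[OF F t(1,2) wt_pos hi bd]
  show "duh F t \<in> lsp wt" "wnorm wt (duh F t) \<le> dfac t * \<Phi>" by (auto simp: dfac_def mult_ac)
qed

lemma duh_diff:
  assumes F: "adm \<tau> \<Phi> F" and G: "adm \<tau> \<Phi>' G" and t: "0 \<le> t" "t \<le> \<tau>"
  shows "duh F t n - duh G t n = duh (\<lambda>s n. F s n - G s n) t n"
proof -
  have "duh F t n - duh G t n = integral {0..t} (\<lambda>s. S (t - s) (F s) n - S (t - s) (G s) n)"
    unfolding duh_def by (rule integral_diff[OF duh_integrable(1)[OF F t] duh_integrable(1)[OF G t], symmetric])
  also have "\<dots> = duh (\<lambda>s n. F s n - G s n) t n"
    unfolding duh_def
  proof (rule integral_cong)
    fix s assume s: "s \<in> {0..t}"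
    then have "F s \<in> lsp w" "G s \<in> lsp w" "0 \<le> t - s" using admD(1)[OF F] admD(1)[OF G] t by auto
    then show "S (t - s) (F s) n - S (t - s) (G s) n = S (t - s) (\<lambda>n. F s n - G s n) n"
      by (simp add: S_diff)
  qed
  finally show ?thesis .
qed

text \<open>The integral is split at q, and S(r) has to be pulled out of the first part. As
  integration is componentwise, S(r) is expanded in its columns and the series is exchanged with the
  integral by dominated convergence; \<open>w n * col n m r \<le> w m\<close> supplies the constant
  majorant \<Phi> / w n.\<close>

lemma duh_restart:
  assumes F: "adm \<tau> \<Phi> F" and q: "0 \<le> q" "0 \<le> r" "q + r \<le> \<tau>"
  shows "duh F (q + r) n = S r (duh F q) n + duh (\<lambda>s. F (q + s)) r n"
proof (cases "n = 0")
  case True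
  have "duh (\<lambda>s. F (q + s)) r 0 = 0" by (rule duh_0[OF adm_shift[OF F]]) (use q in auto)
  moreover have "S r (duh F q) 0 = 0" by (rule lsp_zero[of _ w], intro S_lsp duh_w[OF F]) (use q in auto)
  ultimately show ?thesis using True duh_0[OF F, of "q + r"] q by simp
next
  case False
  then have n: "n \<ge> 1" and wn: "0 < w n" using wpos by auto
  have qt: "q \<le> \<tau>" using q by simp
  let ?f = "\<lambda>s. S (q + r - s) (F s) n"
  let ?p = "\<lambda>M s. \<Sum>m<M. col n m r * S (q - s) (F s) m"
  have col_le: "w n * col n m r \<le> w m" if "m \<ge> 1" for m
  proof (cases "n \<le> m")
    case True
    have "w n * col n m r \<le> (\<Sum>i=1..m. w i * col i m r)"
      by (rule member_le_sum) (use True n q that wpos col_nonneg in \<open>auto simp: less_imp_le\<close>)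
    also have "\<dots> \<le> w m" by (rule col_w_le) (use that q in auto)
    finally show ?thesis .
  next
    case False
    then show ?thesis using col_triangular[OF n that q(2)] wpos[OF that] by simp
  qed
  have lim: "(\<lambda>M. integral {0..q} (?p M)) \<longlonglongrightarrow> integral {0..q} ?f"
  proof (rule dominated_convergence(2)[where h = "\<lambda>_. \<Phi> / w n"])
    show "?p M integrable_on {0..q}" for M
      by (intro integrable_sum integrable_on_mult_right duh_integrable[OF F q(1) qt]) auto
    show "(\<lambda>_. \<Phi> / w n) integrable_on {0..q}" by (rule integrable_const_ivl)
    fix s assume s: "s \<in> {0..q}"
    note z = duh_integrand_bound[OF F qt s]
    show "norm (?p M s) \<le> \<Phi> / w n" for M
    proof -
      have "w n * norm (?p M s) \<le> (\<Sum>m<M. w n * \<bar>col n m r * S (q - s) (F s) m\<bar>)"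
        unfolding sum_distrib_left[symmetric] using wn by (intro mult_left_mono) (auto intro: sum_abs)
      also have "\<dots> \<le> (\<Sum>m<M. w m * \<bar>S (q - s) (F s) m\<bar>)"
      proof (rule sum_mono)
        fix m
        show "w n * \<bar>col n m r * S (q - s) (F s) m\<bar> \<le> w m * \<bar>S (q - s) (F s) m\<bar>"
        proof (cases "m = 0")
          case False
          then have m: "m \<ge> 1" by simp
          have "w n * \<bar>col n m r * S (q - s) (F s) m\<bar> = (w n * col n m r) * \<bar>S (q - s) (F s) m\<bar>"
            using col_nonneg[OF n m q(2)] by (simp add: abs_mult)
          also have "\<dots> \<le> w m * \<bar>S (q - s) (F s) m\<bar>" by (rule mult_right_mono[OF col_le[OF m]]) simp
          finally show ?thesis .
        qed (simp add: lsp_zero[OF z(1)])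
      qed
      also have "\<dots> \<le> \<Phi>" using wnorm_sum_le[OF z(1) wpos, of "{..<M}"] z(2) by simp
      finally show ?thesis using wn by (simp add: field_simps)
    qed
    have "(\<lambda>m. col n m r * S (q - s) (F s) m) sums S r (S (q - s) (F s)) n"
      by (rule S_sums[OF z(1) q(2) n])
    moreover have "S r (S (q - s) (F s)) = S (q + r - s) (F s)"
      using S_semigroup[of r "q - s" "F s"] q s qt admD(1)[OF F, of s] by (simp add: algebra_simps)
    ultimately show "(\<lambda>M. ?p M s) \<longlonglongrightarrow> ?f s" by (simp add: sums_def)
  qed
  have "integral {0..q} (?p M) = (\<Sum>m<M. col n m r * duh F q m)" for M
    unfolding duh_def using duh_integrable(1)[OF F q(1) qt]
    by (simp add: integral_sum integrable_on_mult_right)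
  moreover have "(\<lambda>m. col n m r * duh F q m) sums S r (duh F q) n"
    by (rule S_sums[OF duh_w[OF F q(1) qt] q(2) n])
  ultimately have 1: "integral {0..q} ?f = S r (duh F q) n"
    using lim by (auto simp: sums_def intro: LIMSEQ_unique)
  have "integral {q..q+r} ?f = integral {0..r} (\<lambda>s. ?f (s + q))"
    using integral_shift_cbox[of q q "q + r" ?f] by simp
  also have "\<dots> = duh (\<lambda>s. F (q + s)) r n" unfolding duh_def by (simp add: algebra_simps)
  finally have 2: "integral {q..q+r} ?f = duh (\<lambda>s. F (q + s)) r n" .
  have "integral {0..q} ?f + integral {q..q+r} ?f = integral {0..q+r} ?f"
    by (rule Henstock_Kurzweil_Integration.integral_combine) (use q duh_integrable(1)[OF F, of "q + r"] in auto)
  then show ?thesis using 1 2 by (simp add: duh_def)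
qed

text \<open>Restarting at a time q shortly before t writes the integral at s as S(s - q) y plus an
  integral over a short interval. The first part is continuous because y already lies in the space
  with the larger weight, and each short integral is at most e/4. For t > 0, times slightly to the
  left of t still lie beyond q.\<close>

lemma duh_wt_continuous:
  assumes F: "adm \<tau> \<Phi> F" and \<tau>: "\<tau> \<le> 1" and t: "t \<in> {0..\<tau>}"
  shows "((\<lambda>s. wnorm wt (\<lambda>n. duh F s n - duh F t n)) \<longlongrightarrow> 0) (at t within {0..\<tau>})"
proof (rule tendstoI)
  fix e :: real assume e: "e > 0"
  have \<Phi>: "0 \<le> \<Phi>" using adm_nonneg[OF F] t by simp
  obtain \<eta>2 where \<eta>2: "0 < \<eta>2" "dfac \<eta>2 \<le> e / (4 * (\<Phi> + 1))"
    using dfac_small[of "e / (4 * (\<Phi> + 1))"] e \<Phi> by auto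
  \<comment> \<open>Half of \<open>\<eta>2\<close>, since for s within \<eta> of t the distance s -
    q can reach 2 \<eta>.\<close>
  define \<eta> where "\<eta> = \<eta>2 / 2"
  define q where "q = max 0 (t - \<eta>)"
  have q: "0 \<le> q" "q \<le> t" "q \<le> \<tau>" using t \<eta>2 by (auto simp: q_def \<eta>_def)
  let ?y = "duh F q"
  have y: "?y \<in> lsp wt" using duh_wt(1)[OF F q(1,3)] q t \<tau> by simp
  have "\<forall>\<^sub>F x in at (t - q) within {0..}. dist (wnorm wt (\<lambda>n. S x ?y n - S (t - q) ?y n)) 0 < e / 4"
    using S_wt_continuous[OF y, of "t - q"] q e by (intro tendstoD) auto
  then obtain d where d: "d > 0" "\<And>x. 0 \<le> x \<Longrightarrow> x \<noteq> t - q \<Longrightarrow> dist x (t - q) < d \<Longrightarrow>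
      \<bar>wnorm wt (\<lambda>n. S x ?y n - S (t - q) ?y n)\<bar> < e / 4"
    unfolding eventually_at by auto
  have small: "wnorm wt (duh (\<lambda>s. F (q + s)) r) \<le> e / 4 \<and> duh (\<lambda>s. F (q + s)) r \<in> lsp wt"
    if r: "0 \<le> r" "r \<le> \<eta>2" "q + r \<le> \<tau>" for r
  proof -
    have A: "adm (\<tau> - q) \<Phi> (\<lambda>s. F (q + s))" by (rule adm_shift[OF F q(1,3)])
    have "wnorm wt (duh (\<lambda>s. F (q + s)) r) \<le> dfac r * \<Phi>"
      by (rule duh_wt(2)[OF A]) (use r q \<tau> in auto)
    also have "\<dots> \<le> dfac \<eta>2 * \<Phi>" using dfac_mono[OF r(1,2)] \<Phi> by (rule mult_right_mono)
    also have "\<dots> \<le> e / (4 * (\<Phi> + 1)) * \<Phi>" using \<eta>2(2) \<Phi> by (rule mult_right_mono)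
    also have "\<dots> \<le> e / 4" using \<Phi> e by (simp add: field_simps)
    finally show ?thesis using duh_wt(1)[OF A, of r] r q \<tau> by simp
  qed
  show "\<forall>\<^sub>F s in at t within {0..\<tau>}. dist (wnorm wt (\<lambda>n. duh F s n - duh F t n)) 0 < e"
    unfolding eventually_at
  proof (intro exI[of _ "min d \<eta>"] conjI ballI impI)
    show "0 < min d \<eta>" using d \<eta>2 by (simp add: \<eta>_def)
    fix s assume s: "s \<in> {0..\<tau>}" "s \<noteq> t \<and> dist s t < min d \<eta>"
    have sq: "q \<le> s" "s - q \<le> \<eta>2" "t - q \<le> \<eta>2"
      using s t by (auto simp: q_def \<eta>_def dist_real_def abs_if max_def split: if_splits)
    let ?a = "S (s - q) ?y" and ?b = "S (t - q) ?y"
    let ?c = "duh (\<lambda>s. F (q + s)) (s - q)" and ?d = "duh (\<lambda>s. F (q + s)) (t - q)"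
    have es: "duh F s n = ?a n + ?c n" for n using duh_restart[OF F q(1), of "s - q" n] sq s by simp
    have et: "duh F t n = ?b n + ?d n" for n using duh_restart[OF F q(1), of "t - q" n] q t by simp
    have L: "?a \<in> lsp wt" "?b \<in> lsp wt" using S_wt(1)[OF y] sq q by auto
    have M: "wnorm wt ?c \<le> e / 4" "?c \<in> lsp wt" "wnorm wt ?d \<le> e / 4" "?d \<in> lsp wt"
      using small[of "s - q"] small[of "t - q"] sq q s t by auto
    have "\<bar>wnorm wt (\<lambda>n. ?a n - ?b n)\<bar> < e / 4"
      using d(2)[of "s - q"] sq s by (auto simp: dist_real_def)
    moreover have "(\<lambda>n. duh F s n - duh F t n) = (\<lambda>n. (?a n - ?b n) + (?c n - ?d n))"
      by (auto simp: es et)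
    then have "wnorm wt (\<lambda>n. duh F s n - duh F t n) \<le> wnorm wt (\<lambda>n. ?a n - ?b n) + wnorm wt (\<lambda>n. ?c n - ?d n)"
      using lsp_add(2)[OF lsp_diff(1)[OF L wt_pos] lsp_diff(1)[OF M(2,4) wt_pos] wt_pos] by simp
    moreover have "wnorm wt (\<lambda>n. ?c n - ?d n) \<le> e / 4 + e / 4"
      using lsp_diff(2)[OF M(2,4) wt_pos] M by simp
    ultimately have "wnorm wt (\<lambda>n. duh F s n - duh F t n) < e" using e by linarith
    moreover have "(\<lambda>n. duh F s n - duh F t n) \<in> lsp wt"
      by (rule lsp_diff(1)[OF duh_wt(1)[OF F] duh_wt(1)[OF F] wt_pos]) (use s t \<tau> in auto)
    then have "0 \<le> wnorm wt (\<lambda>n. duh F s n - duh F t n)" by (rule wnorm_nonneg[OF _ wt_pos])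
    ultimately show "dist (wnorm wt (\<lambda>n. duh F s n - duh F t n)) 0 < e" by simp
  qed
qed

end

subsection \<open>Mild solutions on compact intervals\<close>

text \<open>The rough bound \<open>B0\<close> makes the supremum B finite, so B \<le> A + B/2 can be
  solved for B. On short intervals this takes the place of a Gronwall inequality with singular
  kernel.\<close>

lemma half_absorb:
  fixes d :: "'a \<Rightarrow> real"
  assumes ne: "I \<noteq> {}" and B0: "\<And>t. t \<in> I \<Longrightarrow> d t \<le> B0"
    and st: "\<And>B. (\<And>t. t \<in> I \<Longrightarrow> d t \<le> B) \<Longrightarrow> (\<And>t. t \<in> I \<Longrightarrow> d t \<le> A + B / 2)"
    and t: "t \<in> I"
  shows "d t \<le> 2 * A"
proof -
  define B where "B = Sup (d ` I)"
  have bdd: "bdd_above (d ` I)" using B0 by (auto intro: bdd_aboveI[of _ B0])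
  have le: "d s \<le> B" if "s \<in> I" for s unfolding B_def using that bdd by (intro cSup_upper) auto
  have "B \<le> A + B / 2" unfolding B_def
    using ne st[OF le] by (intro cSup_least) (auto simp: B_def)
  then show ?thesis using le[OF t] by linarith
qed

lemma step_induct:
  fixes \<delta> \<tau> :: real
  assumes \<delta>: "0 < \<delta>" and \<tau>: "0 \<le> \<tau>" and P0: "P 0"
    and step: "\<And>q. 0 \<le> q \<Longrightarrow> q < \<tau> \<Longrightarrow> P q \<Longrightarrow> P (min (q + \<delta>) \<tau>)"
  shows "P \<tau>"
proof -
  have it: "P (min (real i * \<delta>) \<tau>)" for i
  proof (induction i)
    case 0
    then show ?case using P0 \<tau> by (simp add: min_def)
  next
    case (Suc i)
    show ?case
    proof (cases "real i * \<delta> < \<tau>")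
      case True
      then have "P (real i * \<delta>)" using Suc by (simp add: min_def)
      then show ?thesis using step[of "real i * \<delta>"] True \<delta> by (simp add: algebra_simps)
    next
      case False
      then have "min (real (Suc i) * \<delta>) \<tau> = min (real i * \<delta>) \<tau>" using \<delta> by (simp add: algebra_simps)
      then show ?thesis using Suc by simp
    qed
  qed
  obtain i :: nat where "\<tau> / \<delta> < real i" using reals_Archimedean2 by blast
  then have "min (real i * \<delta>) \<tau> = \<tau>" using \<delta> by (simp add: field_simps min_def)
  then show ?thesis using it[of i] by simp
qed

definition kshift :: "real \<Rightarrow> (nat \<Rightarrow> nat \<Rightarrow> real \<Rightarrow> real) \<Rightarrow> nat \<Rightarrow> nat \<Rightarrow> real \<Rightarrow> real" where
  "kshift q k n j t = k n j (q + t)"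

lemma Kop_kshift: "Kop (kshift q k) t f = Kop k (q + t) f"
  by (rule ext) (simp add: Kop_def kshift_def)

context coag_frag
begin

text \<open>Continuity into the larger-weight space, in epsilon-delta form: this form is transported
  directly through restriction, time shift and gluing.\<close>

definition cont_wt :: "real \<Rightarrow> (real \<Rightarrow> nat \<Rightarrow> real) \<Rightarrow> bool" where
  "cont_wt \<tau> u \<longleftrightarrow> (\<forall>t\<in>{0..\<tau>}. u t \<in> lsp wt) \<and>
     (\<forall>t\<in>{0..\<tau>}. \<forall>e>0. \<exists>d>0. \<forall>s\<in>{0..\<tau>}. \<bar>s - t\<bar> < d \<longrightarrow> wnorm wt (\<lambda>n. u s n - u t n) < e)"

text \<open>Mild solutions on a closed interval. The integrability that \<open>mild_sol\<close>
  demands explicitly is here a consequence of \<open>cont_wt\<close> and \<open>kernel_ok\<close>,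
  via \<open>msol_adm\<close> and \<open>duh_integrable\<close>.\<close>

definition msol :: "(nat \<Rightarrow> nat \<Rightarrow> real \<Rightarrow> real) \<Rightarrow> (nat \<Rightarrow> real) \<Rightarrow> real \<Rightarrow> (real \<Rightarrow> nat \<Rightarrow> real) \<Rightarrow> bool" where
  "msol k u0 \<tau> u \<longleftrightarrow> cont_wt \<tau> u \<and>
     (\<forall>t\<in>{0..\<tau>}. \<forall>n. u t n = S t u0 n + duh (\<lambda>s. Kop k s (u s)) t n)"

lemma cont_wtD:
  assumes "cont_wt \<tau> u" "t \<in> {0..\<tau>}" "0 < e"
  obtains d where "d > 0" "\<And>s. s \<in> {0..\<tau>} \<Longrightarrow> \<bar>s - t\<bar> < d \<Longrightarrow> wnorm wt (\<lambda>n. u s n - u t n) < e"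
  using assms unfolding cont_wt_def by blast

lemma msol_lsp: "msol k u0 \<tau> u \<Longrightarrow> t \<in> {0..\<tau>} \<Longrightarrow> u t \<in> lsp wt"
  by (simp add: msol_def cont_wt_def)

lemma msol_eq: "msol k u0 \<tau> u \<Longrightarrow> t \<in> {0..\<tau>} \<Longrightarrow> u t n = S t u0 n + duh (\<lambda>s. Kop k s (u s)) t n"
  by (simp add: msol_def)

lemma msol_cont: "msol k u0 \<tau> u \<Longrightarrow> cont_wt \<tau> u"
  by (simp add: msol_def)

lemma cont_wtI_tendsto:
  assumes "\<And>t. t \<in> {0..\<tau>} \<Longrightarrow> u t \<in> lsp wt"
    and "\<And>t. t \<in> {0..\<tau>} \<Longrightarrow> ((\<lambda>s. wnorm wt (\<lambda>n. u s n - u t n)) \<longlongrightarrow> 0) (at t within {0..\<tau>})"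
  shows "cont_wt \<tau> u"
  unfolding cont_wt_def
proof (intro conjI ballI allI impI)
  fix t e :: real assume t: "t \<in> {0..\<tau>}" and e: "e > 0"
  from assms(2)[OF t, unfolded tendsto_iff eventually_at, rule_format, OF e]
  obtain d where d: "d > 0" "\<And>s. s \<in> {0..\<tau>} \<Longrightarrow> s \<noteq> t \<Longrightarrow> dist s t < d \<Longrightarrow> \<bar>wnorm wt (\<lambda>n. u s n - u t n)\<bar> < e"
    by auto
  have "wnorm wt (\<lambda>n. u s n - u t n) < e" if "s \<in> {0..\<tau>}" "\<bar>s - t\<bar> < d" for s
  proof (cases "s = t")
    case False
    have "\<bar>wnorm wt (\<lambda>n. u s n - u t n)\<bar> < e" by (rule d(2)) (use that False in \<open>auto simp: dist_real_def\<close>)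
    then show ?thesis by simp
  qed (simp add: lsp_zero_fun e)
  then show "\<exists>d>0. \<forall>s\<in>{0..\<tau>}. \<bar>s - t\<bar> < d \<longrightarrow> wnorm wt (\<lambda>n. u s n - u t n) < e" using d(1) by blast
qed (use assms(1) in auto)

lemma cont_wt_imp_tendsto:
  assumes "cont_wt \<tau> u" "t \<in> {0..\<tau>}"
  shows "((\<lambda>s. wnorm wt (\<lambda>n. u s n - u t n)) \<longlongrightarrow> 0) (at t within {0..\<tau>})"
  unfolding tendsto_iff eventually_at
proof (intro allI impI)
  fix e :: real assume "e > 0"
  then obtain d where d: "d > 0" "\<And>s. s \<in> {0..\<tau>} \<Longrightarrow> \<bar>s - t\<bar> < d \<Longrightarrow> wnorm wt (\<lambda>n. u s n - u t n) < e"
    using assms unfolding cont_wt_def by blast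
  have "dist (wnorm wt (\<lambda>n. u s n - u t n)) 0 < e" if "s \<in> {0..\<tau>}" "\<bar>s - t\<bar> < d" for s
    using d(2)[OF that] wnorm_nonneg[OF lsp_diff(1)[of "u s" wt "u t", OF _ _ wt_pos] wt_pos] assms that
    by (auto simp: cont_wt_def)
  then show "\<exists>d>0. \<forall>x\<in>{0..\<tau>}. x \<noteq> t \<and> dist x t < d \<longrightarrow> dist (wnorm wt (\<lambda>n. u x n - u t n)) 0 < e"
    using d(1) by (intro exI[of _ d]) (auto simp: dist_real_def)
qed

lemma cont_wt_comp_continuous:
  assumes u: "cont_wt \<tau> u"
  shows "continuous_on {0..\<tau>} (\<lambda>t. u t n)"
proof (cases "n = 0")
  case True
  have "continuous_on {0..\<tau>} (\<lambda>t. u t 0)"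
    by (rule continuous_on_eq[OF continuous_on_const[of "{0..\<tau>}" 0]]) (use u in \<open>auto simp: cont_wt_def lsp_def\<close>)
  then show ?thesis using True by simp
next
  case False
  then have wn: "0 < wt n" using wt_pos by simp
  show ?thesis unfolding continuous_on_iff
  proof (intro ballI allI impI)
    fix t e :: real assume t: "t \<in> {0..\<tau>}" and e: "e > 0"
    obtain d where d: "d > 0" "\<And>s. s \<in> {0..\<tau>} \<Longrightarrow> \<bar>s - t\<bar> < d \<Longrightarrow> wnorm wt (\<lambda>n. u s n - u t n) < e * wt n"
      using cont_wtD[OF u t, of "e * wt n"] wn e by auto
    have "dist (u s n) (u t n) < e" if s: "s \<in> {0..\<tau>}" "dist s t < d" for s
    proof -
      have "(\<lambda>n. u s n - u t n) \<in> lsp wt" by (rule lsp_diff(1)[OF _ _ wt_pos]) (use u s t in \<open>auto simp: cont_wt_def\<close>)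
      then have "wt n * \<bar>u s n - u t n\<bar> < e * wt n"
        using wnorm_comp_le[where v = wt and f = "\<lambda>n. u s n - u t n" and n = n, OF _ wt_pos] d(2)[of s] s by (auto simp: dist_real_def)
      then show ?thesis using wn by (simp add: dist_real_def mult.commute)
    qed
    then show "\<exists>d>0. \<forall>s\<in>{0..\<tau>}. dist s t < d \<longrightarrow> dist (u s n) (u t n) < e" using d(1) by blast
  qed
qed

lemma cont_wt_norm_continuous:
  assumes u: "cont_wt \<tau> u"
  shows "continuous_on {0..\<tau>} (\<lambda>t. wnorm wt (u t))"
  unfolding continuous_on_iff
proof (intro ballI allI impI)
  fix t e :: real assume t: "t \<in> {0..\<tau>}" and e: "e > 0"
  then obtain d where d: "d > 0" "\<And>s. s \<in> {0..\<tau>} \<Longrightarrow> \<bar>s - t\<bar> < d \<Longrightarrow> wnorm wt (\<lambda>n. u s n - u t n) < e"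
    using u unfolding cont_wt_def by blast
  have "dist (wnorm wt (u s)) (wnorm wt (u t)) < e" if s: "s \<in> {0..\<tau>}" "dist s t < d" for s
  proof -
    have L: "u s \<in> lsp wt" "u t \<in> lsp wt" using u s t by (auto simp: cont_wt_def)
    show ?thesis
      using wnorm_triangle_sub[OF L wt_pos] wnorm_triangle_sub[OF L(2,1) wt_pos] d(2)[of s] s
      by (auto simp: dist_real_def wnorm_diff_commute[of wt "u t" "u s"])
  qed
  then show "\<exists>d>0. \<forall>s\<in>{0..\<tau>}. dist s t < d \<longrightarrow> dist (wnorm wt (u s)) (wnorm wt (u t)) < e" using d(1) by blast
qed

lemma cont_wt_bounded:
  assumes u: "cont_wt \<tau> u"
  obtains R where "0 \<le> R" "\<And>t. t \<in> {0..\<tau>} \<Longrightarrow> wnorm wt (u t) \<le> R"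
proof -
  have "bounded ((\<lambda>t. wnorm wt (u t)) ` {0..\<tau>})"
    by (intro compact_imp_bounded compact_continuous_image cont_wt_norm_continuous[OF u]) auto
  then obtain R where "\<forall>x\<in>(\<lambda>t. wnorm wt (u t)) ` {0..\<tau>}. norm x \<le> R"
    unfolding bounded_iff by blast
  then have R: "\<And>t. t \<in> {0..\<tau>} \<Longrightarrow> \<bar>wnorm wt (u t)\<bar> \<le> R" by auto
  show thesis by (rule that[of "max R 0"]) (use R in \<open>force simp: le_max_iff_disj\<close>)+
qed

lemma cont_wt_restrict: "cont_wt \<tau> u \<Longrightarrow> r \<le> \<tau> \<Longrightarrow> cont_wt r u"
  unfolding cont_wt_def
proof (elim conjE, intro conjI ballI allI impI)
  fix t e :: real
  assume r: "r \<le> \<tau>" and A: "\<forall>t\<in>{0..\<tau>}. \<forall>e>0. \<exists>d>0. \<forall>s\<in>{0..\<tau>}. \<bar>s - t\<bar> < d \<longrightarrow> wnorm wt (\<lambda>n. u s n - u t n) < e"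
    and t: "t \<in> {0..r}" and e: "0 < e"
  obtain d where "d > 0" "\<forall>s\<in>{0..\<tau>}. \<bar>s - t\<bar> < d \<longrightarrow> wnorm wt (\<lambda>n. u s n - u t n) < e"
    using A[rule_format, of t e] t r e by auto
  then show "\<exists>d>0. \<forall>s\<in>{0..r}. \<bar>s - t\<bar> < d \<longrightarrow> wnorm wt (\<lambda>n. u s n - u t n) < e"
    using r by (intro exI[of _ d]) auto
qed auto

lemma msol_restrict: "msol k u0 \<tau> u \<Longrightarrow> r \<le> \<tau> \<Longrightarrow> msol k u0 r u"
  unfolding msol_def using cont_wt_restrict by auto

lemma kernel_ok_restrict: "kernel_ok k \<tau> c \<Longrightarrow> r \<le> \<tau> \<Longrightarrow> kernel_ok k r c"
  unfolding kernel_ok_def by (auto intro: continuous_on_subset[of "{0..\<tau>}"])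

lemma kernel_ok_shift:
  assumes "kernel_ok k \<tau> c" "0 \<le> q"
  shows "kernel_ok (kshift q k) (\<tau> - q) c"
  unfolding kernel_ok_def
proof (intro conjI allI impI ballI)
  fix n j :: nat assume nj: "n \<ge> 1" "j \<ge> 1"
  show "continuous_on {0..\<tau> - q} (kshift q k n j)"
    unfolding kshift_def
    by (rule continuous_on_compose2[OF kernel_okD(5)[OF assms(1) nj]]) (use assms(2) in \<open>auto intro!: continuous_intros\<close>)
  fix t assume "t \<in> {0..\<tau> - q}"
  then have t: "q + t \<in> {0..\<tau>}" using assms(2) by auto
  show "0 \<le> kshift q k n j t" "kshift q k n j t \<le> c * wt n * wt j / w (n + j)" "kshift q k n j t = kshift q k j n t"
    unfolding kshift_def using kernel_okD(2,3,4)[OF assms(1) nj t] by auto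
qed (use kernel_okD(1)[OF assms(1)] in simp)

section \<open>Comparison estimates and local existence\<close>

definition bmeas :: "real \<Rightarrow> real \<Rightarrow> (real \<Rightarrow> nat \<Rightarrow> real) \<Rightarrow> bool" where
  "bmeas \<tau> R v \<longleftrightarrow> (\<forall>t\<in>{0..\<tau>}. v t \<in> lsp wt \<and> wnorm wt (v t) \<le> R) \<and>
     (\<forall>n. (\<lambda>s. v s n) \<in> borel_measurable (restrict_space borel {0..\<tau>}))"

lemma cont_wt_bmeas:
  assumes "cont_wt \<tau> u" "\<And>t. t \<in> {0..\<tau>} \<Longrightarrow> wnorm wt (u t) \<le> R"
  shows "bmeas \<tau> R u"
  unfolding bmeas_def using assms borel_measurable_continuous_on_restrict[OF cont_wt_comp_continuous[OF assms(1)]]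
  by (auto simp: cont_wt_def)

lemma bmeas_adm:
  assumes v: "bmeas \<tau> R v" and k: "kernel_ok k \<tau> c"
  shows "adm \<tau> (3/2 * c * R\<^sup>2) (\<lambda>s. Kop k s (v s))"
  unfolding adm_def
proof (intro conjI ballI allI)
  fix s assume s: "s \<in> {0..\<tau>}"
  have vs: "v s \<in> lsp wt" "wnorm wt (v s) \<le> R" using v s by (auto simp: bmeas_def)
  show "Kop k s (v s) \<in> lsp w" by (rule Kop_lsp(1)[OF k s vs(1)])
  have "(wnorm wt (v s))\<^sup>2 \<le> R\<^sup>2" using vs wnorm_nonneg[OF vs(1) wt_pos] by (intro power_mono) auto
  then have "3/2 * c * (wnorm wt (v s))\<^sup>2 \<le> 3/2 * c * R\<^sup>2" using kernel_okD(1)[OF k] by (intro mult_left_mono) auto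
  then show "wnorm w (Kop k s (v s)) \<le> 3/2 * c * R\<^sup>2" using Kop_lsp(2)[OF k s vs(1)] by linarith
next
  fix n
  show "(\<lambda>s. Kop k s (v s) n) \<in> borel_measurable (restrict_space borel {0..\<tau>})"
    by (rule Kop_measurable[OF k]) (use v in \<open>auto simp: bmeas_def lsp_def\<close>)
qed

lemma msol_adm:
  assumes "msol k u0 \<tau> u" "kernel_ok k \<tau> c"
  obtains \<Phi> where "adm \<tau> \<Phi> (\<lambda>s. Kop k s (u s))"
proof -
  obtain R where "0 \<le> R" "\<And>t. t \<in> {0..\<tau>} \<Longrightarrow> wnorm wt (u t) \<le> R"
    using cont_wt_bounded[OF msol_cont[OF assms(1)]] by blast
  then show thesis using that bmeas_adm[OF cont_wt_bmeas[OF msol_cont[OF assms(1)]] assms(2)] by blast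
qed

lemma msol_init: "msol k u0 \<tau> u \<Longrightarrow> 0 \<le> \<tau> \<Longrightarrow> u0 \<in> lsp wt \<Longrightarrow> u 0 = u0"
  using msol_eq[of k u0 \<tau> u 0] by (auto simp: duh_def S_zero_time[OF lsp_wt_w(1)])

text \<open>The Lipschitz constant of the coagulation operator on the ball of radius R is 3 c R. The
  condition makes the Duhamel map a contraction with factor 1/2 there, and \<delta> \<le> 1 is the
  range of the smoothing estimate. Only R and c restrict the step length.\<close>

definition good_step :: "real \<Rightarrow> real \<Rightarrow> real \<Rightarrow> bool" where
  "good_step \<delta> R c \<longleftrightarrow> 0 \<le> \<delta> \<and> \<delta> \<le> 1 \<and> dfac \<delta> * (3 * c * R) \<le> 1/2"

lemma good_step_mono: "good_step \<delta> R c \<Longrightarrow> 0 \<le> \<delta>' \<Longrightarrow> \<delta>' \<le> \<delta> \<Longrightarrow> 0 \<le> R \<Longrightarrow> 0 \<le> c \<Longrightarrow> good_step \<delta>' R c"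
  unfolding good_step_def using mult_right_mono[OF dfac_mono[of \<delta>' \<delta>], of "3 * c * R"] by auto

lemma good_step_exists:
  assumes "0 \<le> R" "0 \<le> c" obtains \<delta> where "0 < \<delta>" "good_step \<delta> R c"
proof -
  have p: "0 \<le> 3 * c * R" using assms by simp
  obtain \<delta> where d: "0 < \<delta>" "\<delta> \<le> 1" "dfac \<delta> \<le> 1 / (2 * (3 * c * R + 1))"
    using dfac_small[of "1 / (2 * (3 * c * R + 1))"] p by auto
  have "dfac \<delta> * (3 * c * R) \<le> 1 / (2 * (3 * c * R + 1)) * (3 * c * R)" by (rule mult_right_mono[OF d(3) p])
  also have "\<dots> \<le> 1/2" using p by (simp add: field_simps)
  finally show thesis using that d by (auto simp: good_step_def)
qed

text \<open>One estimate with two kernels and two initial values. Equal kernels and data give the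
  contraction property, equal kernels alone give stability and uniqueness, and different kernels
  give the truncation error. The functions need not solve anything, so it also applies to
  iterates.\<close>

lemma Duhamel_difference:
  assumes k: "kernel_ok k \<tau> c" and k': "kernel_ok k' \<tau> c"
    and u: "bmeas \<tau> R u" and v: "bmeas \<tau> R v" and g: "good_step \<tau> R c" and R: "0 \<le> R"
    and u0: "u0 \<in> lsp wt" and v0: "v0 \<in> lsp wt"
    and eps: "\<And>s. s \<in> {0..\<tau>} \<Longrightarrow> wnorm w (\<lambda>n. Kop k s (u s) n - Kop k' s (u s) n) \<le> \<epsilon>"
    and B: "\<And>s. s \<in> {0..\<tau>} \<Longrightarrow> wnorm wt (\<lambda>n. u s n - v s n) \<le> B"
    and t: "t \<in> {0..\<tau>}"
  shows "wnorm wt (\<lambda>n. (S t u0 n + duh (\<lambda>s. Kop k s (u s)) t n) - (S t v0 n + duh (\<lambda>s. Kop k' s (v s)) t n))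
     \<le> C1 * wnorm wt (\<lambda>n. u0 n - v0 n) + dfac \<tau> * \<epsilon> + B / 2"
proof -
  have c: "0 \<le> c" by (rule kernel_okD(1)[OF k])
  have t1: "0 \<le> t" "t \<le> \<tau>" "t \<le> 1" using t g by (auto simp: good_step_def)
  let ?F = "\<lambda>s. Kop k s (u s)" and ?G = "\<lambda>s. Kop k' s (v s)"
  note A = bmeas_adm[OF u k] and A' = bmeas_adm[OF v k']
  have L: "u s \<in> lsp wt" "v s \<in> lsp wt" "wnorm wt (u s) \<le> R" "wnorm wt (v s) \<le> R" if "s \<in> {0..\<tau>}" for s
    using u v that by (auto simp: bmeas_def)
  have B0: "0 \<le> B" using B[OF t] wnorm_nonneg[OF lsp_diff(1)[OF L(1,2)[OF t] wt_pos] wt_pos] by linarith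
  \<comment> \<open>The kernel is exchanged first while the argument u is kept, at cost \<epsilon>;
    then the argument is changed using the Lipschitz bound for the second kernel.\<close>
  have AD: "adm \<tau> (\<epsilon> + 3 * c * R * B) (\<lambda>s n. ?F s n - ?G s n)"
    unfolding adm_def
  proof (intro conjI ballI allI)
    fix s assume s: "s \<in> {0..\<tau>}"
    have FG: "?F s \<in> lsp w" "?G s \<in> lsp w" "Kop k' s (u s) \<in> lsp w"
      using Kop_lsp(1)[OF k s] Kop_lsp(1)[OF k' s] L[OF s] by auto
    show "(\<lambda>n. ?F s n - ?G s n) \<in> lsp w" by (rule lsp_diff(1)[OF FG(1,2) wpos])
    have "wnorm w (\<lambda>n. Kop k' s (u s) n - ?G s n) \<le> 3/2 * c * (wnorm wt (u s) + wnorm wt (v s)) * wnorm wt (\<lambda>n. u s n - v s n)"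
      by (rule Kop_lipschitz(2)[OF k' s L(1,2)[OF s]])
    also have "\<dots> \<le> 3/2 * c * (R + R) * B"
      using L[OF s] B[OF s] c R wnorm_nonneg[OF lsp_diff(1)[OF L(1,2)[OF s] wt_pos] wt_pos]
      by (intro mult_mono mult_left_mono add_mono) auto
    finally have "wnorm w (\<lambda>n. Kop k' s (u s) n - ?G s n) \<le> 3 * c * R * B" by (simp add: mult_ac)
    then show "wnorm w (\<lambda>n. ?F s n - ?G s n) \<le> \<epsilon> + 3 * c * R * B"
      using wnorm_triangle[OF FG(1,3,2) wpos] eps[OF s] by linarith
  next
    fix n
    show "(\<lambda>s. ?F s n - ?G s n) \<in> borel_measurable (restrict_space borel {0..\<tau>})"
      using A A' by (intro borel_measurable_diff) (auto simp: adm_def)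
  qed
  have Lw: "u0 \<in> lsp w" "v0 \<in> lsp w" using lsp_wt_w u0 v0 by auto
  have d0: "(\<lambda>n. u0 n - v0 n) \<in> lsp wt" by (rule lsp_diff(1)[OF u0 v0 wt_pos])
  have "(\<lambda>n. (S t u0 n + duh ?F t n) - (S t v0 n + duh ?G t n)) = (\<lambda>n. S t (\<lambda>n. u0 n - v0 n) n + duh (\<lambda>s n. ?F s n - ?G s n) t n)"
    using S_diff[OF t1(1) Lw] duh_diff[OF A A' t1(1,2)] by (auto simp: algebra_simps)
  then have "wnorm wt (\<lambda>n. (S t u0 n + duh ?F t n) - (S t v0 n + duh ?G t n))
      \<le> wnorm wt (S t (\<lambda>n. u0 n - v0 n)) + wnorm wt (duh (\<lambda>s n. ?F s n - ?G s n) t)"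
    using lsp_add(2)[OF S_wt(1)[OF d0 t1(1)] duh_wt(1)[OF AD t1] wt_pos] by simp
  also have "\<dots> \<le> C1 * wnorm wt (\<lambda>n. u0 n - v0 n) + dfac t * (\<epsilon> + 3 * c * R * B)"
    by (rule add_mono[OF S_wt(2)[OF d0 t1(1)] duh_wt(2)[OF AD t1]])
  also have "dfac t * (\<epsilon> + 3 * c * R * B) \<le> dfac \<tau> * (\<epsilon> + 3 * c * R * B)"
    using dfac_mono[OF t1(1,2)] adm_nonneg[OF AD] t by (intro mult_right_mono) auto
  also have "\<dots> = dfac \<tau> * \<epsilon> + dfac \<tau> * (3 * c * R) * B" by (simp add: algebra_simps)
  also have "dfac \<tau> * (3 * c * R) * B \<le> 1/2 * B" using g B0 by (intro mult_right_mono) (auto simp: good_step_def)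
  finally show ?thesis by (simp add: add_ac)
qed

text \<open>Both functions are fixed points of their Duhamel maps, so the previous estimate bounds
  their distance by data error plus half of the distance itself. The bound 2R from the ball makes
  the absorption legitimate.\<close>

lemma msol_compare:
  assumes k: "kernel_ok k \<tau> c" and k': "kernel_ok k' \<tau> c"
    and u: "msol k u0 \<tau> u" and v: "msol k' v0 \<tau> v" and g: "good_step \<tau> R c" and R: "0 \<le> R"
    and u0: "u0 \<in> lsp wt" and v0: "v0 \<in> lsp wt"
    and uR: "\<And>s. s \<in> {0..\<tau>} \<Longrightarrow> wnorm wt (u s) \<le> R" and vR: "\<And>s. s \<in> {0..\<tau>} \<Longrightarrow> wnorm wt (v s) \<le> R"
    and eps: "\<And>s. s \<in> {0..\<tau>} \<Longrightarrow> wnorm w (\<lambda>n. Kop k s (u s) n - Kop k' s (u s) n) \<le> \<epsilon>"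
    and t: "t \<in> {0..\<tau>}"
  shows "wnorm wt (\<lambda>n. u t n - v t n) \<le> 2 * (C1 * wnorm wt (\<lambda>n. u0 n - v0 n) + dfac \<tau> * \<epsilon>)"
proof (rule half_absorb[of "{0..\<tau>}" "\<lambda>t. wnorm wt (\<lambda>n. u t n - v t n)" "2 * R"])
  show "{0..\<tau>} \<noteq> {}" using t by auto
  show "wnorm wt (\<lambda>n. u t n - v t n) \<le> 2 * R" if "t \<in> {0..\<tau>}" for t
    using lsp_diff(2)[OF msol_lsp[OF u that] msol_lsp[OF v that] wt_pos] uR[OF that] vR[OF that] by linarith
  fix B t assume B: "\<And>t. t \<in> {0..\<tau>} \<Longrightarrow> wnorm wt (\<lambda>n. u t n - v t n) \<le> B" and t: "t \<in> {0..\<tau>}"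
  show "wnorm wt (\<lambda>n. u t n - v t n) \<le> C1 * wnorm wt (\<lambda>n. u0 n - v0 n) + dfac \<tau> * \<epsilon> + B / 2"
    using Duhamel_difference[OF k k' cont_wt_bmeas[OF msol_cont[OF u] uR] cont_wt_bmeas[OF msol_cont[OF v] vR] g R u0 v0 eps B t]
    unfolding msol_eq[OF u t, symmetric] msol_eq[OF v t, symmetric] by simp
qed (rule t)

lemma msol_compare_same:
  assumes k: "kernel_ok k \<tau> c"
    and u: "msol k u0 \<tau> u" and v: "msol k v0 \<tau> v" and g: "good_step \<tau> R c" and R: "0 \<le> R"
    and u0: "u0 \<in> lsp wt" and v0: "v0 \<in> lsp wt"
    and uR: "\<And>s. s \<in> {0..\<tau>} \<Longrightarrow> wnorm wt (u s) \<le> R" and vR: "\<And>s. s \<in> {0..\<tau>} \<Longrightarrow> wnorm wt (v s) \<le> R"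
    and t: "t \<in> {0..\<tau>}"
  shows "wnorm wt (\<lambda>n. u t n - v t n) \<le> 2 * C1 * wnorm wt (\<lambda>n. u0 n - v0 n)"
  using msol_compare[OF k k u v g R u0 v0 uR vR _ t, of 0] by (simp add: lsp_zero_fun)

lemma Duhamel_cont_wt:
  assumes F: "adm \<tau> \<Phi> F" and u0: "u0 \<in> lsp wt" and \<tau>: "\<tau> \<le> 1"
  shows "cont_wt \<tau> (\<lambda>t n. S t u0 n + duh F t n)"
proof (rule cont_wtI_tendsto)
  have L: "S t u0 \<in> lsp wt" "duh F t \<in> lsp wt" if "t \<in> {0..\<tau>}" for t
    using S_wt(1)[OF u0, of t] duh_wt(1)[OF F, of t] that \<tau> by auto
  show "(\<lambda>n. S t u0 n + duh F t n) \<in> lsp wt" if "t \<in> {0..\<tau>}" for t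
    by (rule lsp_add(1)[OF L[OF that] wt_pos])
  fix t assume t: "t \<in> {0..\<tau>}"
  have "((\<lambda>s. wnorm wt (\<lambda>n. S s u0 n - S t u0 n) + wnorm wt (\<lambda>n. duh F s n - duh F t n)) \<longlongrightarrow> 0 + 0) (at t within {0..\<tau>})"
    by (intro tendsto_add duh_wt_continuous[OF F \<tau> t] tendsto_within_subset[OF S_wt_continuous[OF u0]]) (use t in auto)
  then have lim: "((\<lambda>s. wnorm wt (\<lambda>n. S s u0 n - S t u0 n) + wnorm wt (\<lambda>n. duh F s n - duh F t n)) \<longlongrightarrow> 0) (at t within {0..\<tau>})"
    by simp
  show "((\<lambda>s. wnorm wt (\<lambda>n. (S s u0 n + duh F s n) - (S t u0 n + duh F t n))) \<longlongrightarrow> 0) (at t within {0..\<tau>})"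
  proof (rule Lim_null_comparison[OF _ lim], unfold eventually_at_filter, rule always_eventually, intro allI impI)
    fix s assume s: "s \<in> {0..\<tau>}"
    have D: "(\<lambda>n. S s u0 n - S t u0 n) \<in> lsp wt" "(\<lambda>n. duh F s n - duh F t n) \<in> lsp wt"
      by (rule lsp_diff(1)[OF _ _ wt_pos]; use L s t in blast)+
    have eq: "(\<lambda>n. (S s u0 n + duh F s n) - (S t u0 n + duh F t n)) = (\<lambda>n. (S s u0 n - S t u0 n) + (duh F s n - duh F t n))"
      by auto
    show "norm (wnorm wt (\<lambda>n. (S s u0 n + duh F s n) - (S t u0 n + duh F t n)))
      \<le> wnorm wt (\<lambda>n. S s u0 n - S t u0 n) + wnorm wt (\<lambda>n. duh F s n - duh F t n)"
      unfolding eq using lsp_add[OF D wt_pos] wnorm_nonneg[OF lsp_add(1)[OF D wt_pos] wt_pos] by simp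
  qed
qed

text \<open>The linear part fills at most half of the ball, since R \<ge> 2 C1 times the norm of the
  data, and the Duhamel part at most a quarter, by the step condition. Picard iteration runs among
  bounded measurable functions and converges geometrically with ratio 1/2.\<close>

lemma msol_local_exists:
  assumes k: "kernel_ok k \<tau> c" and g: "good_step \<tau> R c" and u0: "u0 \<in> lsp wt" and R: "2 * C1 * wnorm wt u0 \<le> R"
  obtains u where "msol k u0 \<tau> u" "\<And>t. t \<in> {0..\<tau>} \<Longrightarrow> wnorm wt (u t) \<le> R"
proof -
  have c: "0 \<le> c" by (rule kernel_okD(1)[OF k])
  have \<tau>: "0 \<le> \<tau>" "\<tau> \<le> 1" using g by (auto simp: good_step_def)
  have n0: "0 \<le> wnorm wt u0" by (rule wnorm_nonneg[OF u0 wt_pos])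
  have R0: "0 \<le> R" using R n0 C1 mult_nonneg_nonneg[of C1 "wnorm wt u0"] by linarith
  define \<Psi> where "\<Psi> v t n = S t u0 n + duh (\<lambda>s. Kop k s (v s)) t n" for v t n
  have \<Psi>c: "cont_wt \<tau> (\<Psi> v)" if "bmeas \<tau> R v" for v
    unfolding \<Psi>_def by (rule Duhamel_cont_wt[OF bmeas_adm[OF that k] u0 \<tau>(2)])
  have Sn: "wnorm wt (S t u0) \<le> R / 2" if "t \<in> {0..\<tau>}" for t
    using S_wt(2)[OF u0, of t] that R by simp
  have \<Psi>b: "bmeas \<tau> R (\<Psi> v)" if v: "bmeas \<tau> R v" for v
  proof (rule cont_wt_bmeas[OF \<Psi>c[OF v]])
    fix t assume t: "t \<in> {0..\<tau>}"
    note A = bmeas_adm[OF v k]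
    have D: "duh (\<lambda>s. Kop k s (v s)) t \<in> lsp wt" "wnorm wt (duh (\<lambda>s. Kop k s (v s)) t) \<le> dfac t * (3/2 * c * R\<^sup>2)"
      using duh_wt[OF A, of t] t \<tau> by auto
    have "dfac t * (3/2 * c * R\<^sup>2) \<le> dfac \<tau> * (3/2 * c * R\<^sup>2)"
      using dfac_mono[of t \<tau>] t c by (intro mult_right_mono) auto
    also have "\<dots> = (dfac \<tau> * (3 * c * R)) * (R / 2)" by (simp add: power2_eq_square)
    also have "\<dots> \<le> 1/2 * (R / 2)" using g R0 by (intro mult_right_mono) (auto simp: good_step_def)
    finally have "wnorm wt (duh (\<lambda>s. Kop k s (v s)) t) \<le> R / 4" using D(2) by linarith
    moreover have "wnorm wt (\<Psi> v t) \<le> wnorm wt (S t u0) + wnorm wt (duh (\<lambda>s. Kop k s (v s)) t)"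
      using lsp_add(2)[OF S_wt(1)[OF u0, of t] D(1) wt_pos] t unfolding \<Psi>_def by simp
    ultimately show "wnorm wt (\<Psi> v t) \<le> R" using Sn[OF t] R0 by linarith
  qed
  have \<Psi>l: "wnorm wt (\<lambda>n. \<Psi> v t n - \<Psi> v' t n) \<le> B / 2"
    if v: "bmeas \<tau> R v" "bmeas \<tau> R v'" and B: "\<And>s. s \<in> {0..\<tau>} \<Longrightarrow> wnorm wt (\<lambda>n. v s n - v' s n) \<le> B" and t: "t \<in> {0..\<tau>}"
    for v v' B t
    using Duhamel_difference[OF k k v g R0 u0 u0 _ B t, of 0] unfolding \<Psi>_def by (simp add: lsp_zero_fun)
  define U where "U i = (\<Psi> ^^ i) (\<lambda>t. S t u0)" for i
  have U0: "U 0 = (\<lambda>t. S t u0)" and US: "U (Suc i) = \<Psi> (U i)" for i by (simp_all add: U_def)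
  have Ub: "bmeas \<tau> R (U i)" for i
  proof (induction i)
    case 0
    have z: "adm \<tau> 0 (\<lambda>s n. 0)" by (simp add: adm_def lsp_zero_fun)
    have zd: "duh (\<lambda>s n. 0) t n = 0" if "t \<in> {0..\<tau>}" for t n
      using duh_diff[OF z z, of t n] that by simp
    have "cont_wt \<tau> (\<lambda>t n. S t u0 n + duh (\<lambda>s n. 0) t n)" by (rule Duhamel_cont_wt[OF z u0 \<tau>(2)])
    then have "cont_wt \<tau> (\<lambda>t. S t u0)" unfolding cont_wt_def using zd by simp
    then show ?case unfolding U0
      by (rule cont_wt_bmeas) (use Sn R0 in force)
  qed (simp add: US \<Psi>b)
  have UL: "U i t \<in> lsp wt" "wnorm wt (U i t) \<le> R" if "t \<in> {0..\<tau>}" for i t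
    using Ub[of i] that by (auto simp: bmeas_def)
  have d1: "wnorm wt (\<lambda>n. U (Suc i) t n - U i t n) \<le> 2 * R / 2 ^ i" if "t \<in> {0..\<tau>}" for i t
    using that
  proof (induction i arbitrary: t)
    case 0
    then show ?case using lsp_diff(2)[OF UL(1) UL(1) wt_pos, of t t 1 0] UL(2)[of t 1] UL(2)[of t 0] by simp
  next
    case (Suc i)
    have "wnorm wt (\<lambda>n. \<Psi> (U (Suc i)) t n - \<Psi> (U i) t n) \<le> (2 * R / 2 ^ i) / 2"
      by (rule \<Psi>l[OF Ub Ub Suc.IH Suc.prems])
    then show ?case by (simp add: US)
  qed
  \<comment> \<open>The subtracted term 4R / 2^m makes the geometric sum telescope in an induction
    on m.\<close>
  have cau: "wnorm wt (\<lambda>n. U m t n - U i t n) \<le> 4 * R / 2 ^ i - 4 * R / 2 ^ m" if t: "t \<in> {0..\<tau>}" and im: "i \<le> m" for t i m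
    using im
  proof (induction m rule: dec_induct)
    case base
    then show ?case by (simp add: lsp_zero_fun)
  next
    case (step m)
    have "wnorm wt (\<lambda>n. U (Suc m) t n - U i t n) \<le> wnorm wt (\<lambda>n. U (Suc m) t n - U m t n) + wnorm wt (\<lambda>n. U m t n - U i t n)"
      by (rule wnorm_triangle[OF UL(1) UL(1) UL(1) wt_pos]) (use t in auto)
    then show ?case using step.IH d1[OF t, of m] by simp
  qed
  have r0: "(\<lambda>i. 4 * R / 2 ^ i) \<longlonglongrightarrow> 0"
    using tendsto_mult_left[OF LIMSEQ_inverse_realpow_zero[of 2], of "4 * R"] by (simp add: divide_inverse power_inverse)
  have "\<exists>l. l \<in> lsp wt \<and> (\<forall>i. wnorm wt (\<lambda>n. l n - U i t n) \<le> 4 * R / 2 ^ i) \<and> (\<forall>n. (\<lambda>i. U i t n) \<longlonglongrightarrow> l n)"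
    if t: "t \<in> {0..\<tau>}" for t
  proof (rule lsp_Cauchy_limit[of "\<lambda>i. U i t" wt "\<lambda>i. 4 * R / 2 ^ i"])
    show "wnorm wt (\<lambda>n. U m t n - U i t n) \<le> 4 * R / 2 ^ i" if "i \<le> m" for i m
    proof -
      have "0 \<le> 4 * R / 2 ^ m" using R0 by simp
      then show ?thesis using cau[OF t that] by linarith
    qed
  qed (use UL t wt_pos r0 in auto)
  then have "\<forall>t\<in>{0..\<tau>}. \<exists>l. l \<in> lsp wt \<and> (\<forall>i. wnorm wt (\<lambda>n. l n - U i t n) \<le> 4 * R / 2 ^ i) \<and> (\<forall>n. (\<lambda>i. U i t n) \<longlonglongrightarrow> l n)"
    by blast
  from bchoice[OF this] obtain u where
    "\<forall>t\<in>{0..\<tau>}. u t \<in> lsp wt \<and> (\<forall>i. wnorm wt (\<lambda>n. u t n - U i t n) \<le> 4 * R / 2 ^ i) \<and> (\<forall>n. (\<lambda>i. U i t n) \<longlonglongrightarrow> u t n)"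
    by blast
  then have u: "\<And>t. t \<in> {0..\<tau>} \<Longrightarrow> u t \<in> lsp wt"
      "\<And>t i. t \<in> {0..\<tau>} \<Longrightarrow> wnorm wt (\<lambda>n. u t n - U i t n) \<le> 4 * R / 2 ^ i"
      "\<And>t n. t \<in> {0..\<tau>} \<Longrightarrow> (\<lambda>i. U i t n) \<longlonglongrightarrow> u t n"
    by blast+
  have uR: "wnorm wt (u t) \<le> R" if t: "t \<in> {0..\<tau>}" for t
  proof (rule LIMSEQ_le_const)
    show "(\<lambda>i. R + 4 * R / 2 ^ i) \<longlonglongrightarrow> R" using tendsto_add[OF tendsto_const r0, of R] by simp
    show "\<exists>N. \<forall>i\<ge>N. wnorm wt (u t) \<le> R + 4 * R / 2 ^ i"
    proof (intro exI allI impI)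
      fix i
      show "wnorm wt (u t) \<le> R + 4 * R / 2 ^ i"
        using wnorm_triangle_sub[OF u(1)[OF t] UL(1)[OF t, of i] wt_pos] u(2)[OF t, of i] UL(2)[OF t, of i] by linarith
    qed
  qed
  have ub: "bmeas \<tau> R u" unfolding bmeas_def
  proof (intro conjI ballI allI)
    fix n
    show "(\<lambda>s. u s n) \<in> borel_measurable (restrict_space borel {0..\<tau>})"
      by (rule borel_measurable_LIMSEQ_real[of _ "\<lambda>i s. U i s n"])
        (use u(3) Ub in \<open>auto simp: bmeas_def\<close>)
  qed (use u(1) uR in auto)
  have fixp: "\<Psi> u t = u t" if t: "t \<in> {0..\<tau>}" for t
  proof -
    have \<Psi>L: "\<Psi> u t \<in> lsp wt" using \<Psi>b[OF ub] t by (auto simp: bmeas_def)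
    have "wnorm wt (\<lambda>n. \<Psi> u t n - u t n) \<le> 4 * R / 2 ^ i" for i
    proof -
      have "wnorm wt (\<lambda>n. \<Psi> u t n - U (Suc i) t n) \<le> (4 * R / 2 ^ i) / 2"
        unfolding US by (rule \<Psi>l[OF ub Ub u(2) t])
      moreover have "wnorm wt (\<lambda>n. U (Suc i) t n - u t n) \<le> 4 * R / 2 ^ Suc i"
        using u(2)[OF t, of "Suc i"] by (simp add: wnorm_diff_commute[of wt "U (Suc i) t" "u t"])
      ultimately show ?thesis using wnorm_triangle[OF \<Psi>L UL(1)[OF t, of "Suc i"] u(1)[OF t] wt_pos] by simp
    qed
    then have "wnorm wt (\<lambda>n. \<Psi> u t n - u t n) \<le> 0"
      by (intro LIMSEQ_le_const[OF r0]) auto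
    then have "(\<lambda>n. \<Psi> u t n - u t n) = (\<lambda>n. 0)"
      by (intro wnorm_zero_imp[OF lsp_diff(1)[OF \<Psi>L u(1)[OF t] wt_pos] wt_pos])
    then show ?thesis by (auto simp: fun_eq_iff)
  qed
  \<comment> \<open>The limit was known only to be bounded and measurable. Continuity follows from
    the fixed-point equation, since the Duhamel map sends bounded measurable functions to continuous
    ones.\<close>
  have "cont_wt \<tau> u" using \<Psi>c[OF ub] fixp unfolding cont_wt_def by simp
  moreover have "u t n = S t u0 n + duh (\<lambda>s. Kop k s (u s)) t n" if "t \<in> {0..\<tau>}" for t n
    using fun_cong[OF fixp[OF that], of n] unfolding \<Psi>_def by simp
  ultimately have "msol k u0 \<tau> u" by (simp add: msol_def)
  then show thesis using that uR by blast
qed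

section \<open>Restarting, gluing, uniqueness and continuous dependence\<close>

lemma msol_restart:
  assumes k: "kernel_ok k \<tau> c" and u: "msol k u0 \<tau> u" and u0: "u0 \<in> lsp wt" and q: "0 \<le> q" "q \<le> \<tau>"
  shows "msol (kshift q k) (u q) (\<tau> - q) (\<lambda>t. u (q + t))"
  unfolding msol_def
proof (intro conjI ballI allI)
  show "cont_wt (\<tau> - q) (\<lambda>t. u (q + t))"
    unfolding cont_wt_def
  proof (intro conjI ballI allI impI)
    fix t e :: real assume t: "t \<in> {0..\<tau> - q}" and e: "0 < e"
    then have "q + t \<in> {0..\<tau>}" using q by auto
    then obtain d where "d > 0" "\<And>s. s \<in> {0..\<tau>} \<Longrightarrow> \<bar>s - (q + t)\<bar> < d \<Longrightarrow> wnorm wt (\<lambda>n. u s n - u (q + t) n) < e"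
      using msol_cont[OF u] e unfolding cont_wt_def by blast
    then show "\<exists>d>0. \<forall>s\<in>{0..\<tau> - q}. \<bar>s - t\<bar> < d \<longrightarrow> wnorm wt (\<lambda>n. u (q + s) n - u (q + t) n) < e"
      using q by (intro exI[of _ d]) auto
  qed (use msol_lsp[OF u] q in auto)
  fix t n assume t: "t \<in> {0..\<tau> - q}"
  let ?F = "\<lambda>s. Kop k s (u s)"
  obtain \<Phi> where A: "adm \<tau> \<Phi> ?F" using msol_adm[OF u k] .
  have Dq: "duh ?F q \<in> lsp w" by (rule duh_w[OF A q])
  have Sq: "S q u0 \<in> lsp w" by (rule S_lsp[OF q(1) lsp_wt_w(1)[OF u0]])
  have uq: "u q = (\<lambda>n. S q u0 n + duh ?F q n)" using msol_eq[OF u, of q] q by auto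
  have "u (q + t) n = S (q + t) u0 n + duh ?F (q + t) n" using msol_eq[OF u, of "q + t"] q t by simp
  also have "S (q + t) u0 n = S t (S q u0) n"
    using S_semigroup[of t q u0] t q lsp_wt_w(1)[OF u0] by (simp add: add.commute)
  also have "duh ?F (q + t) n = S t (duh ?F q) n + duh (\<lambda>s. ?F (q + s)) t n"
    using duh_restart[OF A q(1), of t n] t by simp
  also have "S t (S q u0) n + (S t (duh ?F q) n + duh (\<lambda>s. ?F (q + s)) t n) = S t (u q) n + duh (\<lambda>s. ?F (q + s)) t n"
    unfolding uq using S_add[OF _ Sq Dq, of t] t by simp
  finally show "u (q + t) n = S t (u q) n + duh (\<lambda>s. Kop (kshift q k) s (u (q + s))) t n"
    by (simp add: Kop_kshift)
qed

lemma msol_concat: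
  assumes k: "kernel_ok k (q + r) c" and u: "msol k u0 q u" and u0: "u0 \<in> lsp wt" and q: "0 \<le> q" "0 \<le> r"
    and v: "msol (kshift q k) (u q) r v"
  shows "msol k u0 (q + r) (\<lambda>t. if t \<le> q then u t else v (t - q))"
proof -
  let ?x = "\<lambda>t. if t \<le> q then u t else v (t - q)"
  have uq: "u q \<in> lsp wt" using msol_lsp[OF u] q by simp
  have v0: "v 0 = u q" by (rule msol_init[OF v q(2) uq])
  have xv: "?x (q + t) = v t" if "0 \<le> t" for t using v0 that by auto
  have xv': "?x t = v (t - q)" if "q \<le> t" for t using v0 that by auto
  have cx: "cont_wt (q + r) ?x"
    unfolding cont_wt_def
  proof (intro conjI ballI allI impI)
    fix t assume "t \<in> {0..q + r}"
    then show "?x t \<in> lsp wt" using msol_lsp[OF u, of t] msol_lsp[OF v, of "t - q"] by auto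
  next
    fix t e :: real assume t: "t \<in> {0..q + r}" and e: "0 < e"
    \<comment> \<open>Continuity is checked separately for s on each side of q. If t lies strictly
      beyond q, a radius of t - q excludes all s on the near side and the statement is
      vacuous.\<close>
    have 1: "\<exists>d>0. \<forall>s\<in>{0..q + r}. s \<le> q \<longrightarrow> \<bar>s - t\<bar> < d \<longrightarrow> wnorm wt (\<lambda>n. ?x s n - ?x t n) < e"
    proof (cases "t \<le> q")
      case True
      then obtain d where "d > 0" "\<And>s. s \<in> {0..q} \<Longrightarrow> \<bar>s - t\<bar> < d \<Longrightarrow> wnorm wt (\<lambda>n. u s n - u t n) < e"
        using cont_wtD[OF msol_cont[OF u], of t e] t e by auto
      then show ?thesis using True by (intro exI[of _ d]) auto
    next
      case False
      then show ?thesis by (intro exI[of _ "t - q"]) auto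
    qed
    have 2: "\<exists>d>0. \<forall>s\<in>{0..q + r}. q \<le> s \<longrightarrow> \<bar>s - t\<bar> < d \<longrightarrow> wnorm wt (\<lambda>n. ?x s n - ?x t n) < e"
    proof (cases "q \<le> t")
      case True
      then have "t - q \<in> {0..r}" using t by auto
      then obtain d where d: "d > 0" "\<And>s. s \<in> {0..r} \<Longrightarrow> \<bar>s - (t - q)\<bar> < d \<Longrightarrow> wnorm wt (\<lambda>n. v s n - v (t - q) n) < e"
        using msol_cont[OF v] e unfolding cont_wt_def by blast
      have "wnorm wt (\<lambda>n. ?x s n - ?x t n) < e" if "s \<in> {0..q + r}" "q \<le> s" "\<bar>s - t\<bar> < d" for s
        using d(2)[of "s - q"] that by (simp only: xv'[OF True] xv'[OF that(2)]) auto
      then show ?thesis using d(1) by blast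
    next
      case False
      then show ?thesis by (intro exI[of _ "q - t"]) auto
    qed
    from 1 2 obtain d1 d2 where "d1 > 0" "d2 > 0"
      "\<And>s. s \<in> {0..q + r} \<Longrightarrow> s \<le> q \<Longrightarrow> \<bar>s - t\<bar> < d1 \<Longrightarrow> wnorm wt (\<lambda>n. ?x s n - ?x t n) < e"
      "\<And>s. s \<in> {0..q + r} \<Longrightarrow> q \<le> s \<Longrightarrow> \<bar>s - t\<bar> < d2 \<Longrightarrow> wnorm wt (\<lambda>n. ?x s n - ?x t n) < e"
      by blast
    note d = this
    have "wnorm wt (\<lambda>n. ?x s n - ?x t n) < e" if "s \<in> {0..q + r}" "\<bar>s - t\<bar> < min d1 d2" for s
      using d(3)[OF that(1)] d(4)[OF that(1)] that(2) linear[of s q] by fastforce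
    moreover have "0 < min d1 d2" using d by simp
    ultimately show "\<exists>d>0. \<forall>s\<in>{0..q + r}. \<bar>s - t\<bar> < d \<longrightarrow> wnorm wt (\<lambda>n. ?x s n - ?x t n) < e" by blast
  qed
  let ?F = "\<lambda>s. Kop k s (?x s)"
  obtain R where R: "\<And>t. t \<in> {0..q + r} \<Longrightarrow> wnorm wt (?x t) \<le> R" using cont_wt_bounded[OF cx] by blast
  have A: "adm (q + r) (3/2 * c * R\<^sup>2) ?F" by (rule bmeas_adm[OF cont_wt_bmeas[OF cx R] k])
  have dq: "duh ?F t n = duh (\<lambda>s. Kop k s (u s)) t n" if "t \<le> q" for t n
    unfolding duh_def by (rule integral_cong) (use that in auto)
  have e1: "?x t n = S t u0 n + duh ?F t n" if "0 \<le> t" "t \<le> q" for t n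
    using msol_eq[OF u, of t n] that dq by simp
  have e2: "?x (q + t) n = S (q + t) u0 n + duh ?F (q + t) n" if t: "0 \<le> t" "t \<le> r" for t n
  proof -
    have Dq: "duh ?F q \<in> lsp w" by (rule duh_w[OF A]) (use q in auto)
    have Sq: "S q u0 \<in> lsp w" by (rule S_lsp[OF q(1) lsp_wt_w(1)[OF u0]])
    have uq: "u q = (\<lambda>n. S q u0 n + duh ?F q n)" using e1[of q] q by auto
    have "?x (q + t) n = S t (u q) n + duh (\<lambda>s. Kop (kshift q k) s (v s)) t n"
      using msol_eq[OF v, of t n] t xv[OF t(1)] by simp
    also have "duh (\<lambda>s. Kop (kshift q k) s (v s)) t n = duh (\<lambda>s. ?F (q + s)) t n"
      unfolding duh_def
    proof (rule integral_cong)
      fix s assume "s \<in> {0..t}"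
      then show "S (t - s) (Kop (kshift q k) s (v s)) n = S (t - s) (?F (q + s)) n"
        using xv[of s] by (simp add: Kop_kshift)
    qed
    also have "S t (u q) n = S (q + t) u0 n + S t (duh ?F q) n"
      unfolding uq using S_add[OF t(1) Sq Dq] S_semigroup[of t q u0] t q lsp_wt_w(1)[OF u0] by (simp add: add.commute)
    also have "S (q + t) u0 n + S t (duh ?F q) n + duh (\<lambda>s. ?F (q + s)) t n = S (q + t) u0 n + duh ?F (q + t) n"
      using duh_restart[OF A q(1) t(1), of n] t by simp
    finally show ?thesis .
  qed
  have "?x t n = S t u0 n + duh ?F t n" if "t \<in> {0..q + r}" for t n
    using e1[of t n] e2[of "t - q" n] that by (cases "t \<le> q") auto
  then show ?thesis using cx unfolding msol_def by blast
qed

text \<open>One radius R bounds both solutions on the whole interval, so one step length serves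
  everywhere; on each step the comparison with equal data gives distance 0.\<close>

lemma msol_unique:
  assumes k: "kernel_ok k \<tau> c" and u: "msol k u0 \<tau> u" and v: "msol k u0 \<tau> v" and u0: "u0 \<in> lsp wt"
    and t: "t \<in> {0..\<tau>}"
  shows "u t = v t"
proof -
  obtain R1 where R1: "0 \<le> R1" "\<And>t. t \<in> {0..\<tau>} \<Longrightarrow> wnorm wt (u t) \<le> R1" using cont_wt_bounded[OF msol_cont[OF u]] by blast
  obtain R2 where R2: "0 \<le> R2" "\<And>t. t \<in> {0..\<tau>} \<Longrightarrow> wnorm wt (v t) \<le> R2" using cont_wt_bounded[OF msol_cont[OF v]] by blast
  define R where "R = max R1 R2"
  have R: "0 \<le> R" "\<And>t. t \<in> {0..\<tau>} \<Longrightarrow> wnorm wt (u t) \<le> R" "\<And>t. t \<in> {0..\<tau>} \<Longrightarrow> wnorm wt (v t) \<le> R"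
    using R1 R2 by (auto simp: R_def le_max_iff_disj)
  have c: "0 \<le> c" by (rule kernel_okD(1)[OF k])
  obtain \<delta> where \<delta>: "0 < \<delta>" "good_step \<delta> R c" using good_step_exists[OF R(1) c] .
  have \<tau>: "0 \<le> \<tau>" using t by auto
  have "\<forall>t\<in>{0..\<tau>}. u t = v t"
  proof (rule step_induct[OF \<delta>(1) \<tau>, of "\<lambda>q. \<forall>t\<in>{0..q}. u t = v t"])
    show "\<forall>t\<in>{0..0}. u t = v t" using msol_init[OF u \<tau> u0] msol_init[OF v \<tau> u0] by simp
  next
    fix q assume q: "0 \<le> q" "q < \<tau>" "\<forall>t\<in>{0..q}. u t = v t"
    define r where "r = min (q + \<delta>) \<tau> - q"
    have r: "0 \<le> r" "r \<le> \<delta>" "r \<le> \<tau> - q" "min (q + \<delta>) \<tau> = q + r" using q \<delta> by (auto simp: r_def)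
    have uq: "u q = v q" "u q \<in> lsp wt" using q(1-2) bspec[OF q(3), of q] msol_lsp[OF u, of q] by auto
    have U: "msol (kshift q k) (u q) r (\<lambda>t. u (q + t))"
      by (rule msol_restrict[OF msol_restart[OF k u u0] r(3)]) (use q in auto)
    have V: "msol (kshift q k) (u q) r (\<lambda>t. v (q + t))"
      unfolding uq(1) by (rule msol_restrict[OF msol_restart[OF k v u0] r(3)]) (use q in auto)
    have seg: "u (q + s) = v (q + s)" if s: "s \<in> {0..r}" for s
    proof -
      have "wnorm wt (\<lambda>n. u (q + s) n - v (q + s) n) \<le> 2 * C1 * wnorm wt (\<lambda>n. u q n - u q n)"
        by (rule msol_compare_same[OF kernel_ok_restrict[OF kernel_ok_shift[OF k q(1)] r(3)] U V good_step_mono[OF \<delta>(2) r(1,2) R(1) c] R(1) uq(2) uq(2) _ _ s])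
          (use R(2,3) q r in auto)
      then have le: "wnorm wt (\<lambda>n. u (q + s) n - v (q + s) n) \<le> 0" by (simp add: lsp_zero_fun)
      have "(\<lambda>n. u (q + s) n - v (q + s) n) \<in> lsp wt"
        by (rule lsp_diff(1)[OF msol_lsp[OF u] msol_lsp[OF v] wt_pos]) (use s r q in auto)
      from wnorm_zero_imp[OF this wt_pos le] show ?thesis by (auto simp: fun_eq_iff)
    qed
    have "u t = v t" if "t \<in> {q..q + r}" for t
      using that seg[of "t - q"] by simp
    then show "\<forall>t\<in>{0..min (q + \<delta>) \<tau>}. u t = v t" using q(3) unfolding r(4) by force
  qed
  then show ?thesis using t by blast
qed

lemma msol_trivial: "u0 \<in> lsp wt \<Longrightarrow> msol k u0 0 (\<lambda>t. u0)"
  by (auto simp: msol_def cont_wt_def duh_def S_zero_time[OF lsp_wt_w(1)] lsp_zero_fun intro: exI[of _ 1])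

text \<open>Each step multiplies the distance to u by at most D = 2 \<open>C1\<close>, so m steps
  give M = D^m. With r = 1/M the perturbed solution stays within distance 1 of u, its norm is at
  most R0 + 1 at each restart, and R = 2 C1 (R0 + 1) is just what local existence needs for the next
  step.\<close>

lemma msol_stable:
  assumes k: "kernel_ok k \<tau> c" and u: "msol k u0 \<tau> u" and u0: "u0 \<in> lsp wt" and \<tau>: "0 \<le> \<tau>"
  obtains r M where "r > 0" "M > 0"
    "\<And>v0. v0 \<in> lsp wt \<Longrightarrow> wnorm wt (\<lambda>n. v0 n - u0 n) \<le> r \<Longrightarrow>
       \<exists>v. msol k v0 \<tau> v \<and> (\<forall>t\<in>{0..\<tau>}. wnorm wt (\<lambda>n. v t n - u t n) \<le> M * wnorm wt (\<lambda>n. v0 n - u0 n))"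
proof -
  obtain R0 where R0: "0 \<le> R0" "\<And>t. t \<in> {0..\<tau>} \<Longrightarrow> wnorm wt (u t) \<le> R0" using cont_wt_bounded[OF msol_cont[OF u]] by blast
  define R where "R = 2 * C1 * (R0 + 1)"
  have R: "0 \<le> R" "R0 \<le> R" "R0 + 1 \<le> R"
  proof -
    have "1 * (R0 + 1) \<le> (2 * C1) * (R0 + 1)" using C1 R0 by (intro mult_right_mono) auto
    then show "R0 + 1 \<le> R" by (simp only: R_def mult_1)
    then show "0 \<le> R" "R0 \<le> R" using R0(1) by linarith+
  qed
  have c: "0 \<le> c" by (rule kernel_okD(1)[OF k])
  obtain \<delta> where \<delta>: "0 < \<delta>" "good_step \<delta> R c" using good_step_exists[OF R(1) c] .
  obtain m :: nat where m: "\<tau> / \<delta> < real m" using reals_Archimedean2 by blast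
  define D where "D = 2 * C1"
  have D: "D \<ge> 1" using C1 by (simp add: D_def)
  define M where "M = D ^ m"
  have M: "M \<ge> 1" using D by (simp add: M_def)
  have main: "\<exists>v. msol k v0 \<tau> v \<and> (\<forall>t\<in>{0..\<tau>}. wnorm wt (\<lambda>n. v t n - u t n) \<le> M * wnorm wt (\<lambda>n. v0 n - u0 n))"
    if v0: "v0 \<in> lsp wt" and d: "wnorm wt (\<lambda>n. v0 n - u0 n) \<le> 1 / M" for v0
  proof -
    define d where "d = wnorm wt (\<lambda>n. v0 n - u0 n)"
    have d0: "0 \<le> d" unfolding d_def by (rule wnorm_nonneg[OF lsp_diff(1)[OF v0 u0 wt_pos] wt_pos])
    have Md: "D ^ i * d \<le> 1" if "i \<le> m" for i
    proof -
      have "D ^ i * d \<le> M * d" unfolding M_def using D d0 that by (intro mult_right_mono power_increasing) auto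
      also have "\<dots> \<le> 1" using d M by (simp add: d_def field_simps)
      finally show ?thesis .
    qed
    have "\<exists>v. msol k v0 (min (real i * \<delta>) \<tau>) v \<and> (\<forall>t\<in>{0..min (real i * \<delta>) \<tau>}. wnorm wt (\<lambda>n. v t n - u t n) \<le> D ^ i * d)"
      if "i \<le> m" for i
      using that
    proof (induction i)
      case 0
      have "min 0 \<tau> = 0" using \<tau> by simp
      then show ?case using msol_trivial[OF v0, of k] msol_init[OF u \<tau> u0]
        by (intro exI[of _ "\<lambda>t. v0"]) (auto simp: d_def)
    next
      case (Suc i)
      define q where "q = min (real i * \<delta>) \<tau>"
      define r where "r = min (real (Suc i) * \<delta>) \<tau> - q"
      have q: "0 \<le> q" "q \<le> \<tau>" using \<delta> \<tau> by (auto simp: q_def)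
      have r: "0 \<le> r" "r \<le> \<delta>" "r \<le> \<tau> - q" "min (real (Suc i) * \<delta>) \<tau> = q + r" "q + r \<le> \<tau>"
        using \<delta> \<tau> by (auto simp: r_def q_def min_def algebra_simps)
      obtain v where v: "msol k v0 q v" "\<And>t. t \<in> {0..q} \<Longrightarrow> wnorm wt (\<lambda>n. v t n - u t n) \<le> D ^ i * d"
        using Suc unfolding q_def by auto
      have L: "v q \<in> lsp wt" "u q \<in> lsp wt" using msol_lsp[OF v(1), of q] msol_lsp[OF u, of q] q by auto
      have dq: "wnorm wt (\<lambda>n. v q n - u q n) \<le> D ^ i * d" using v(2)[of q] q by simp
      have "wnorm wt (v q) \<le> R0 + 1"
        using wnorm_triangle_sub[OF L wt_pos] R0(2)[of q] q dq Md[of i] Suc.prems by simp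
      then have vq: "2 * C1 * wnorm wt (v q) \<le> R" unfolding R_def using C1 by (intro mult_left_mono) auto
      have kr: "kernel_ok (kshift q k) r c" by (rule kernel_ok_restrict[OF kernel_ok_shift[OF k q(1)] r(3)])
      have gr: "good_step r R c" by (rule good_step_mono[OF \<delta>(2) r(1,2) R(1) c])
      obtain z where z: "msol (kshift q k) (v q) r z" "\<And>t. t \<in> {0..r} \<Longrightarrow> wnorm wt (z t) \<le> R"
        using msol_local_exists[OF kr gr L(1) vq] by blast
      have U: "msol (kshift q k) (u q) r (\<lambda>t. u (q + t))"
        by (rule msol_restrict[OF msol_restart[OF k u u0 q] r(3)])
      have zu: "wnorm wt (\<lambda>n. z t n - u (q + t) n) \<le> D ^ Suc i * d" if t: "t \<in> {0..r}" for t
      proof -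
        have "wnorm wt (\<lambda>n. z t n - u (q + t) n) \<le> 2 * C1 * wnorm wt (\<lambda>n. v q n - u q n)"
        proof (rule msol_compare_same[OF kr z(1) U gr R(1) L z(2) _ t])
          fix s assume "s \<in> {0..r}"
          then show "wnorm wt (u (q + s)) \<le> R" using R0(2)[of "q + s"] R(2) r q by auto
        qed auto
        also have "\<dots> \<le> D * (D ^ i * d)" unfolding D_def[symmetric] using dq D by (intro mult_left_mono) auto
        finally show ?thesis by (simp add: mult.assoc)
      qed
      let ?x = "\<lambda>t. if t \<le> q then v t else z (t - q)"
      have x: "msol k v0 (q + r) ?x"
        by (rule msol_concat[OF kernel_ok_restrict[OF k r(5)] v(1) v0 q(1) r(1) z(1)])
      have "wnorm wt (\<lambda>n. ?x t n - u t n) \<le> D ^ Suc i * d" if t: "t \<in> {0..q + r}" for t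
      proof (cases "t \<le> q")
        case True
        have "D ^ i * d \<le> D ^ Suc i * d" using D d0 by (intro mult_right_mono power_increasing) auto
        then show ?thesis using v(2)[of t] True t by simp
      next
        case False
        then show ?thesis using zu[of "t - q"] t by simp
      qed
      then show ?case using x unfolding r(4) by blast
    qed
    from this[of m] show ?thesis
      using m \<delta> by (simp add: min_def field_simps M_def d_def mult.commute split: if_splits)
  qed
  show thesis by (rule that[of "1 / M" M]) (use M main in auto)
qed

end

subsection \<open>Positivity and mass\<close>

text \<open>The negative part has a corner at 0, its square does not; this makes it suitable for a
  differential inequality.\<close>

lemma DERIV_min_zero_square: "((\<lambda>x. (min x 0)\<^sup>2) has_real_derivative 2 * min x 0) (at (x::real))"
proof -
  consider "x < 0" | "x > 0" | "x = 0" by linarith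
  then show ?thesis
  proof cases
    case 1
    have "((\<lambda>x. x\<^sup>2) has_real_derivative 2 * x) (at x)" by (auto intro!: derivative_eq_intros)
    then have "((\<lambda>x. (min x 0)\<^sup>2) has_real_derivative 2 * x) (at x)"
      by (rule has_field_derivative_transform_within_open[of _ _ _ "{..<0}"]) (use 1 in \<open>auto simp: min_def\<close>)
    then show ?thesis using 1 by (simp add: min_def)
  next
    case 2
    have "((\<lambda>x. 0) has_real_derivative 0) (at x)" by simp
    then have "((\<lambda>x. (min x 0)\<^sup>2) has_real_derivative 0) (at x)"
      by (rule has_field_derivative_transform_within_open[of _ _ _ "{0<..}"]) (use 2 in \<open>auto simp: min_def\<close>)
    then show ?thesis using 2 by (simp add: min_def)
  next
    case 3
    have "((\<lambda>h. (min h 0)\<^sup>2 / h) \<longlongrightarrow> 0) (at (0::real))"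
    proof (rule Lim_null_comparison)
      show "\<forall>\<^sub>F h in at (0::real). norm ((min h 0)\<^sup>2 / h) \<le> \<bar>h\<bar>"
        by (rule always_eventually) (auto simp: min_def power2_eq_square)
      show "((\<lambda>h. \<bar>h\<bar>) \<longlongrightarrow> 0) (at (0::real))" by (rule tendsto_rabs_zero) (rule tendsto_ident_at)
    qed
    then show ?thesis using 3 by (simp add: has_field_derivative_iff)
  qed
qed

text \<open>A product is negative only if exactly one factor is, and then its size is at most \<rho>
  times the negative part of that factor.\<close>

lemma neg_prod_le:
  fixes x y :: real
  assumes "\<bar>x\<bar> \<le> \<rho>" "\<bar>y\<bar> \<le> \<rho>"
  shows "- (x * y) \<le> \<rho> * (- min x 0 + - min y 0)"
proof -
  have \<rho>: "0 \<le> \<rho>" using assms by linarith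
  consider "x \<le> 0" "y \<le> 0" | "x \<ge> 0" "y \<ge> 0" | "x \<le> 0" "y \<ge> 0" | "x \<ge> 0" "y \<le> 0" by linarith
  then show ?thesis
  proof cases
    case 1
    then have "0 \<le> x * y" by (simp add: mult_nonpos_nonpos)
    moreover have "0 \<le> \<rho> * (- min x 0 + - min y 0)" using \<rho> by (intro mult_nonneg_nonneg) auto
    ultimately show ?thesis by linarith
  next
    case 2
    then show ?thesis using \<rho> by simp
  next
    case 3
    have "y * (- x) \<le> \<rho> * (- x)" using 3 assms by (intro mult_right_mono) auto
    moreover have "min x 0 = x" "min y 0 = 0" using 3 by auto
    ultimately show ?thesis by (simp add: mult.commute)
  next
    case 4
    have "x * (- y) \<le> \<rho> * (- y)" using 4 assms by (intro mult_right_mono) auto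
    moreover have "min x 0 = 0" "min y 0 = y" using 4 by auto
    ultimately show ?thesis by simp
  qed
qed

text \<open>A merger of sizes i and j produces mass i + j and removes i and j. Summing over ordered
  pairs with n = i + j, symmetry turns the weight i + j into twice the weight i, which the factor
  1/2 of the gain compensates.\<close>

lemma coagulation_mass_zero:
  fixes A :: "nat \<Rightarrow> nat \<Rightarrow> real"
  assumes z: "\<And>i j. i + j > N \<Longrightarrow> A i j = 0" "\<And>i. A i 0 = 0" "\<And>j. A 0 j = 0" and sym: "\<And>i j. A i j = A j i"
  shows "(\<Sum>n=1..N. real n * ((1/2) * (\<Sum>j=1..n-1. A (n-j) j) - (\<Sum>j=1..N. A n j))) = 0"
proof -
  have "(\<Sum>n=1..N. real n * (\<Sum>j=1..n-1. A (n-j) j)) = (\<Sum>n\<le>N. \<Sum>i\<le>n. real (i + (n - i)) * A (n - i) i)"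
  proof -
    have "(\<Sum>i\<le>n. real (i + (n - i)) * A (n - i) i) = real n * (\<Sum>j=1..n-1. A (n-j) j)" for n
    proof -
      have "(\<Sum>j=1..n-1. A (n-j) j) = (\<Sum>j\<le>n. A (n-j) j)"
      proof (rule sum.mono_neutral_left)
        show "\<forall>i\<in>{..n} - {1..n - 1}. A (n - i) i = 0"
        proof
          fix i assume "i \<in> {..n} - {1..n - 1}"
          then have "i = 0 \<or> i = n" by auto
          then show "A (n - i) i = 0" using z by auto
        qed
      qed auto
      then show ?thesis by (simp add: sum_distrib_left)
    qed
    moreover have "(\<Sum>n=1..N. real n * (\<Sum>j=1..n-1. A (n-j) j)) = (\<Sum>n\<le>N. real n * (\<Sum>j=1..n-1. A (n-j) j))"
      by (rule sum.mono_neutral_left) (auto simp: not_le)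
    ultimately show ?thesis by simp
  qed
  also have "\<dots> = (\<Sum>(i,j)\<in>{(i,j). i + j \<le> N}. real (i + j) * A j i)"
    by (rule sum.triangle_reindex_eq[symmetric])
  \<comment> \<open>The triangle is replaced by a square: pairs beyond the diagonal vanish by the
    truncation hypothesis, pairs with a zero index by the other two.\<close>
  also have "\<dots> = (\<Sum>(i,j)\<in>{1..N} \<times> {1..N}. real (i + j) * A j i)"
  proof (rule sum.mono_neutral_cong)
    show "finite {(i, j). i + j \<le> N}" by (rule finite_subset[of _ "{..N} \<times> {..N}"]) auto
    fix p assume "p \<in> {1..N} \<times> {1..N} - {(i, j). i + j \<le> N}"
    then show "(case p of (i, j) \<Rightarrow> real (i + j) * A j i) = 0" using z(1) by (auto simp: not_le add.commute)
  next
    fix p assume p: "p \<in> {(i, j). i + j \<le> N} - {1..N} \<times> {1..N}"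
    obtain i j where ij: "p = (i, j)" by (cases p)
    have "i = 0 \<or> j = 0" using p unfolding ij by auto
    then show "(case p of (i, j) \<Rightarrow> real (i + j) * A j i) = 0" using z(2,3) by (auto simp: ij)
  qed auto
  also have "\<dots> = (\<Sum>i=1..N. \<Sum>j=1..N. real (i + j) * A j i)" by (rule sum.cartesian_product[symmetric])
  also have "\<dots> = (\<Sum>i=1..N. \<Sum>j=1..N. real i * A i j) + (\<Sum>i=1..N. \<Sum>j=1..N. real j * A j i)"
    using sym by (simp add: sum.distrib[symmetric] algebra_simps)
  also have "(\<Sum>i=1..N. \<Sum>j=1..N. real j * A j i) = (\<Sum>i=1..N. \<Sum>j=1..N. real i * A i j)"
    by (rule sum.swap)
  finally have "(\<Sum>n=1..N. real n * (\<Sum>j=1..n-1. A (n-j) j)) = 2 * (\<Sum>i=1..N. real i * (\<Sum>j=1..N. A i j))"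
    by (simp add: sum_distrib_left)
  moreover have "(\<Sum>n=1..N. real n * ((1/2) * (\<Sum>j=1..n-1. A (n-j) j) - (\<Sum>j=1..N. A n j)))
     = 1/2 * (\<Sum>n=1..N. real n * (\<Sum>j=1..n-1. A (n-j) j)) - (\<Sum>n=1..N. real n * (\<Sum>j=1..N. A n j))"
  proof -
    define P Q where "P n = (\<Sum>j=1..n-1. A (n-j) j)" and "Q n = (\<Sum>j=1..N. A n j)" for n
    have "(\<Sum>n=1..N. real n * ((1/2) * P n - Q n)) = (\<Sum>n=1..N. 1/2 * (real n * P n) - real n * Q n)"
      by (rule sum.cong) (auto simp: algebra_simps)
    then show ?thesis unfolding P_def[symmetric] Q_def[symmetric] by (simp add: sum_subtractf sum_divide_distrib)
  qed
  ultimately show ?thesis by simp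
qed

text \<open>The weight dominates n, so the first moment is Lipschitz for the norm and passes to
  limits.\<close>

lemma phi1_diff_le:
  assumes v: "\<And>n. n \<ge> 1 \<Longrightarrow> real n \<le> v n" and f: "f \<in> lsp v" and g: "g \<in> lsp v"
  shows "\<bar>phi1 f - phi1 g\<bar> \<le> wnorm v (\<lambda>n. f n - g n)"
proof -
  have vp: "0 < v n" if "n \<ge> 1" for n using v[OF that] that by linarith
  have le: "\<bar>real n * h n\<bar> \<le> v n * \<bar>h n\<bar>" if "h \<in> lsp v" for h n
    using v[of n] lsp_zero[OF that] by (cases "n = 0") (auto simp: abs_mult intro!: mult_right_mono)
  have s: "summable (\<lambda>n. real n * h n)" "summable (\<lambda>n. \<bar>real n * h n\<bar>)" if h: "h \<in> lsp v" for h
  proof -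
    show "summable (\<lambda>n. \<bar>real n * h n\<bar>)"
      by (rule summable_comparison_test'[of "\<lambda>n. v n * \<bar>h n\<bar>" 0]) (use h le[OF h] in \<open>auto simp: lsp_def\<close>)
    then show "summable (\<lambda>n. real n * h n)" by (rule summable_rabs_cancel)
  qed
  have d: "(\<lambda>n. f n - g n) \<in> lsp v" by (rule lsp_diff(1)[OF f g vp])
  have "phi1 f - phi1 g = (\<Sum>n. real n * (f n - g n))"
    unfolding phi1_def by (subst suminf_diff[OF s(1)[OF f] s(1)[OF g]]) (simp add: right_diff_distrib)
  also have "\<bar>\<dots>\<bar> \<le> (\<Sum>n. \<bar>real n * (f n - g n)\<bar>)" by (rule summable_rabs[OF s(2)[OF d]])
  also have "\<dots> \<le> wnorm v (\<lambda>n. f n - g n)"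
    unfolding wnorm_def by (rule suminf_le[OF le[OF d] s(2)[OF d]]) (use d in \<open>simp add: lsp_def\<close>)
  finally show ?thesis .
qed

context coag_frag
begin

text \<open>The values of u form a compact set, so their tails are uniformly small. Otherwise bad
  times accumulate at some l; the tail norm is 1-Lipschitz in the sequence and decreases with the
  cutoff, so smallness of the tail at l contradicts this.\<close>

lemma cont_wt_uniform_tail:
  assumes u: "cont_wt \<tau> u" and e: "0 < e"
  obtains M where "\<And>t. t \<in> {0..\<tau>} \<Longrightarrow> wnorm wt (\<lambda>n. u t n - strunc M (u t) n) \<le> e"
proof -
  let ?T = "\<lambda>M f. wnorm wt (\<lambda>n. f n - strunc M f n)"
  have L: "u t \<in> lsp wt" if "t \<in> {0..\<tau>}" for t using u that by (simp add: cont_wt_def)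
  have tl: "(\<lambda>n. f n - strunc M f n) \<in> lsp wt" if "f \<in> lsp wt" for f M
    by (rule lsp_diff(1)[OF that strunc_lsp[OF that] wt_pos])
  have mono: "?T M' f \<le> ?T M f" if "f \<in> lsp wt" "M \<le> M'" for f M M'
    by (rule lsp_le(2)[OF tl[OF that(1)] wt_pos]) (use that lsp_zero[OF that(1)] in \<open>auto simp: strunc_def\<close>)
  have lip: "?T M f \<le> wnorm wt (\<lambda>n. f n - g n) + ?T M g" if "f \<in> lsp wt" "g \<in> lsp wt" for f g M
  proof -
    have fg: "(\<lambda>n. f n - g n) \<in> lsp wt" by (rule lsp_diff(1)[OF that wt_pos])
    have "?T M f \<le> ?T M g + wnorm wt (\<lambda>n. (f n - strunc M f n) - (g n - strunc M g n))"
      by (rule wnorm_triangle_sub[OF tl[OF that(1)] tl[OF that(2)] wt_pos])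
    also have "wnorm wt (\<lambda>n. (f n - strunc M f n) - (g n - strunc M g n)) \<le> wnorm wt (\<lambda>n. f n - g n)"
      by (rule lsp_le(2)[OF fg wt_pos]) (use lsp_zero[OF that(1)] lsp_zero[OF that(2)] in \<open>auto simp: strunc_def\<close>)
    finally show ?thesis by simp
  qed
  have "\<exists>M. \<forall>t\<in>{0..\<tau>}. ?T M (u t) \<le> e"
  proof (rule ccontr)
    assume "\<not> ?thesis"
    then have "\<forall>M. \<exists>t. t \<in> {0..\<tau>} \<and> e < ?T M (u t)" by (meson not_le)
    from choice[OF this] obtain x where x: "\<And>M. x M \<in> {0..\<tau>}" "\<And>M. e < ?T M (u (x M))" by blast
    have "compact {0..\<tau>}" by simp
    then obtain l r where lr: "l \<in> {0..\<tau>}" "strict_mono r" "(x \<circ> r) \<longlonglongrightarrow> l"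
      using x(1) unfolding compact_def by blast
    obtain d where d: "d > 0" "\<And>s. s \<in> {0..\<tau>} \<Longrightarrow> \<bar>s - l\<bar> < d \<Longrightarrow> wnorm wt (\<lambda>n. u s n - u l n) < e / 2"
      using cont_wtD[OF u lr(1), of "e / 2"] e by auto
    have "\<forall>\<^sub>F M in sequentially. ?T M (u l) < e / 2"
      using strunc_tendsto[OF L[OF lr(1)]] by (rule order_tendstoD(2)) (use e in simp)
    then obtain M1 where M1: "?T M1 (u l) < e / 2" by (auto simp: eventually_sequentially)
    have "\<forall>\<^sub>F i in sequentially. dist ((x \<circ> r) i) l < d" using lr(3) d(1) by (rule tendstoD)
    then obtain i0 where i0: "\<And>i. i \<ge> i0 \<Longrightarrow> dist ((x \<circ> r) i) l < d" by (auto simp: eventually_sequentially)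
    define i where "i = max i0 M1"
    have ri: "M1 \<le> r i" using seq_suble[OF lr(2), of i] by (simp add: i_def)
    let ?s = "x (r i)"
    have "?T (r i) (u ?s) \<le> ?T M1 (u ?s)" by (rule mono[OF L[OF x(1)] ri])
    also have "\<dots> \<le> wnorm wt (\<lambda>n. u ?s n - u l n) + ?T M1 (u l)" by (rule lip[OF L[OF x(1)] L[OF lr(1)]])
    also have "\<dots> < e" using d(2)[OF x(1), of "r i"] i0[of i] M1 by (simp add: dist_real_def i_def)
    finally show False using x(2)[of "r i"] by simp
  qed
  then show thesis using that by blast
qed

text \<open>A truncated problem with finitely supported data lives in the span of the first \<open>N\<close> unit
  vectors and is an ordinary differential equation there.\<close>

context
  fixes N :: nat and k :: "nat \<Rightarrow> nat \<Rightarrow> real \<Rightarrow> real" and \<tau> c :: real and u0 :: "nat \<Rightarrow> real"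
    and u :: "real \<Rightarrow> nat \<Rightarrow> real"
  assumes k: "kernel_ok k \<tau> c" and u: "msol (ktrunc N k) u0 \<tau> u"
    and u0: "u0 0 = 0" "\<And>n. n > N \<Longrightarrow> u0 n = 0"
begin

lemma trunc_kernel: "kernel_ok (ktrunc N k) \<tau> c"
  by (rule kernel_ok_ktrunc[OF k])

lemma trunc_u0: "u0 \<in> lsp wt"
  using u0 by (rule lsp_finite_support)

lemma trunc_zero: "t \<in> {0..\<tau>} \<Longrightarrow> u t 0 = 0"
  using lsp_zero[OF msol_lsp[OF u]] .

lemma trunc_Kop_support: "n > N \<or> n = 0 \<Longrightarrow> Kop (ktrunc N k) t f n = 0"
  by (auto simp: Kop_def ktrunc_def intro!: sum.neutral)

lemma trunc_Kop:
  assumes "t \<in> {0..\<tau>}" "n \<ge> 1"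
  shows "Kop (ktrunc N k) t (u t) n = (1/2) * (\<Sum>j=1..n-1. ktrunc N k (n-j) j t * u t (n-j) * u t j)
     - (\<Sum>j=1..N. ktrunc N k n j t * u t n * u t j)"
proof -
  have "(\<Sum>j. ktrunc N k n j t * u t n * u t j) = (\<Sum>j\<in>{1..N}. ktrunc N k n j t * u t n * u t j)"
  proof (rule suminf_finite)
    fix j assume "j \<notin> {1..N}"
    then have "j = 0 \<or> j > N" by auto
    then show "ktrunc N k n j t * u t n * u t j = 0" using trunc_zero[OF assms(1)] by (auto simp: ktrunc_def)
  qed simp
  then show ?thesis using assms by (simp add: Kop_def)
qed

lemma trunc_comp_continuous: "continuous_on {0..\<tau>} (\<lambda>t. u t n)"
  by (rule cont_wt_comp_continuous[OF msol_cont[OF u]])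

lemma trunc_Kop_continuous: "continuous_on {0..\<tau>} (\<lambda>t. Kop (ktrunc N k) t (u t) n)"
proof (cases "n = 0")
  case False
  have "continuous_on {0..\<tau>} (\<lambda>t. (1/2) * (\<Sum>j=1..n-1. ktrunc N k (n-j) j t * u t (n-j) * u t j)
     - (\<Sum>j=1..N. ktrunc N k n j t * u t n * u t j))"
  proof (intro continuous_intros trunc_comp_continuous)
    fix j assume "j \<in> {1..n-1}"
    then have "n - j \<ge> 1" "j \<ge> 1" using False by auto
    then show "continuous_on {0..\<tau>} (ktrunc N k (n-j) j)" by (rule kernel_okD(5)[OF trunc_kernel])
  next
    fix j assume "j \<in> {1..N}"
    then have "n \<ge> 1" "j \<ge> 1" using False by auto
    then show "continuous_on {0..\<tau>} (ktrunc N k n j)" by (rule kernel_okD(5)[OF trunc_kernel])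
  qed
  then show ?thesis by (rule continuous_on_eq) (use trunc_Kop False in auto)
qed (simp add: Kop_def)

text \<open>The semigroup is triangular and the truncated coagulation term vanishes above N, so
  neither part of the mild formula leaves the first N coordinates.\<close>

lemma trunc_support:
  assumes t: "t \<in> {0..\<tau>}" and n: "n > N"
  shows "u t n = 0"
proof -
  have S0: "S x f n = 0" if "f 0 = 0" "\<And>n. n > N \<Longrightarrow> f n = 0" "x \<ge> 0" for f x
  proof -
    have "S x f n = (\<Sum>j=1..N. f j * col n j x)" by (rule S_finite) (use that in auto)
    also have "\<dots> = 0" by (intro sum.neutral ballI) (use n col_triangular[of n] that(3) in auto)
    finally show ?thesis .
  qed
  have "duh (\<lambda>s. Kop (ktrunc N k) s (u s)) t n = integral {0..t} (\<lambda>s. 0)"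
    unfolding duh_def by (intro integral_cong S0) (use trunc_Kop_support in auto)
  moreover have "S t u0 n = 0" by (rule S0) (use u0 t in auto)
  ultimately show ?thesis using msol_eq[OF u t, of n] by simp
qed

text \<open>The mild formula is restarted at t and divided by the elapsed time h. The homogeneous
  part contributes the matrix \<open>Gm\<close> through the column derivatives at 0; the Duhamel
  part is an average whose integrand tends to the coagulation term at t.\<close>

lemma trunc_right_deriv:
  assumes t: "0 \<le> t" "t < \<tau>" and n: "1 \<le> n" "n \<le> N"
  shows "((\<lambda>t. u t n) has_real_derivative (\<Sum>j=1..N. Gm n j * u t j) + Kop (ktrunc N k) t (u t) n) (at_right t)"
proof (rule has_right_derivI)
  let ?F = "\<lambda>s. Kop (ktrunc N k) s (u s)"
  let ?G = "\<lambda>s. Kop (kshift t (ktrunc N k)) s (u (t + s))"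
  have tI: "t \<in> {0..\<tau>}" using t by simp
  have G: "?G s = ?F (t + s)" for s by (simp add: Kop_kshift)
  have R: "msol (kshift t (ktrunc N k)) (u t) (\<tau> - t) (\<lambda>s. u (t + s))"
    by (rule msol_restart[OF trunc_kernel u trunc_u0]) (use t in auto)
  have fin: "S x f m = (\<Sum>j=1..N. f j * col m j x)" if "f 0 = 0" "\<And>n. n > N \<Longrightarrow> f n = 0" "x \<ge> 0" for x f m
    by (rule S_finite[where f = f and N = N, OF that])
  obtain \<Phi> where A: "adm (\<tau> - t) \<Phi> ?G"
    using msol_adm[OF R kernel_ok_shift[OF trunc_kernel t(1)]] by blast
  have ut: "u t n = (\<Sum>j=1..N. u t j * col n j 0)"
    using fin[of "u t" 0 n] trunc_zero[OF tI] trunc_support[OF tI] S_zero_time[OF lsp_wt_w(1)[OF msol_lsp[OF u tI]]] by simp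
  have quot: "(u (h + t) n - u t n) / h = (\<Sum>j=1..N. u t j * ((col n j h - col n j 0) / h)) + duh ?G h n / h"
    if h: "0 < h" "h < \<tau> - t" for h
  proof -
    have "u (h + t) n = S h (u t) n + duh ?G h n"
      using msol_eq[OF R, of h n] h by (simp add: add.commute)
    also have "S h (u t) n = (\<Sum>j=1..N. u t j * col n j h)"
      by (rule fin) (use trunc_zero[OF tI] trunc_support[OF tI] h in auto)
    finally have "u (h + t) n - u t n = (\<Sum>j=1..N. u t j * (col n j h - col n j 0)) + duh ?G h n"
      unfolding ut by (simp add: right_diff_distrib sum_subtractf)
    then show ?thesis by (simp add: add_divide_distrib sum_divide_distrib)
  qed
  have lim1: "((\<lambda>h. \<Sum>j=1..N. u t j * ((col n j h - col n j 0) / h)) \<longlongrightarrow> (\<Sum>j=1..N. u t j * Gm n j)) (at_right 0)"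
    using col_right_deriv_zero[OF n(1)] by (intro tendsto_intros) (auto simp: has_field_derivative_iff)
  have lim2: "((\<lambda>h. duh ?G h n / h) \<longlongrightarrow> ?F t n) (at_right 0)"
  proof (rule tendstoI)
    fix e :: real assume e: "e > 0"
    \<comment> \<open>The n-th coordinate of S(x) applied to the coagulation term at time t + s, for
      the pair p = (x, s). Finite support makes it a finite sum, hence jointly continuous, and the
      integrand is its value at (h - s, s).\<close>
    let ?\<theta> = "\<lambda>p. \<Sum>j=1..N. ?F (t + snd p) j * col n j (fst p)"
    have "continuous_on ({0..} \<times> {0..\<tau> - t}) ?\<theta>"
    proof (intro continuous_on_sum continuous_on_mult)
      fix j assume j: "j \<in> {1..N}"
      show "continuous_on ({0..} \<times> {0..\<tau> - t}) (\<lambda>p. ?F (t + snd p) j)"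
        by (rule continuous_on_compose2[OF trunc_Kop_continuous]) (use t in \<open>auto intro!: continuous_intros\<close>)
      show "continuous_on ({0..} \<times> {0..\<tau> - t}) (\<lambda>p. col n j (fst p))"
        by (rule continuous_on_compose2[OF col_continuous]) (use j in \<open>auto intro!: continuous_intros\<close>)
    qed
    from this[unfolded continuous_on_iff, rule_format, of "(0,0)" "e/2"] t e
    obtain d where d: "d > 0" "\<And>x s. 0 \<le> x \<Longrightarrow> 0 \<le> s \<Longrightarrow> s \<le> \<tau> - t \<Longrightarrow> dist (x, s) (0, 0) < d \<Longrightarrow> dist (?\<theta> (x, s)) (?\<theta> (0, 0)) < e / 2"
      by auto
    have th0: "?\<theta> (0, 0) = ?F t n"
    proof -
      have "?\<theta> (0, 0) = (\<Sum>j=1..N. if j = n then ?F t j else 0)"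
        by (rule sum.cong) (auto simp: col_0 basis_seq_def)
      then show ?thesis using n by simp
    qed
    have "dist (duh ?G h n / h) (?F t n) < e" if h: "0 < h" "h < min (d / 2) (\<tau> - t)" for h
    proof -
      have pt: "\<bar>S (h - s) (?G s) n - ?F t n\<bar> \<le> e / 2" if s: "s \<in> {0..h}" for s
      proof -
        have "S (h - s) (?G s) n = ?\<theta> (h - s, s)"
          unfolding G fst_conv snd_conv by (rule fin) (use s trunc_Kop_support in auto)
        moreover have "dist (h - s, s) (0, 0) < d"
          using sqrt_sum_squares_le_sum_abs[of "h - s" s] s h by (simp add: dist_Pair_Pair dist_real_def)
        then have "dist (?\<theta> (h - s, s)) (?\<theta> (0, 0)) < e / 2" using s h by (intro d(2)) auto
        ultimately show ?thesis using th0 by (simp only: dist_real_def)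
      qed
      have HI: "((\<lambda>s. S (h - s) (?G s) n - ?F t n) has_integral (duh ?G h n - h * ?F t n)) {0..h}"
        using has_integral_diff[OF integrable_integral[OF duh_integrable(1)[OF A, of h n]] has_integral_const_real[of "?F t n" 0 h]] h
        by (simp add: duh_def)
      have "norm (duh ?G h n - h * ?F t n) \<le> e / 2 * measure lborel (cbox 0 h)"
        by (rule has_integral_bound[of _ "\<lambda>s. S (h - s) (?G s) n - ?F t n"]) (use HI e pt in auto)
      then have "\<bar>duh ?G h n - h * ?F t n\<bar> \<le> e / 2 * h" using h by simp
      moreover have "duh ?G h n / h - ?F t n = (duh ?G h n - h * ?F t n) / h" using h by (simp add: field_simps)
      ultimately have "\<bar>duh ?G h n / h - ?F t n\<bar> \<le> e / 2" using h by (simp add: field_simps)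
      then show ?thesis using e by (simp add: dist_real_def)
    qed
    then show "\<forall>\<^sub>F h in at_right 0. dist (duh ?G h n / h) (?F t n) < e"
      unfolding eventually_at_right_field using d(1) t by (intro exI[of _ "min (d / 2) (\<tau> - t)"]) auto
  qed
  have "((\<lambda>h. (\<Sum>j=1..N. u t j * ((col n j h - col n j 0) / h)) + duh ?G h n / h) \<longlongrightarrow> (\<Sum>j=1..N. u t j * Gm n j) + ?F t n) (at_right 0)"
    by (rule tendsto_add[OF lim1 lim2])
  then have "((\<lambda>h. (u (h + t) n - u t n) / h) \<longlongrightarrow> (\<Sum>j=1..N. u t j * Gm n j) + ?F t n) (at_right 0)"
    by (rule Lim_transform_eventually)
      (use quot t in \<open>auto simp: eventually_at_right_field intro!: exI[of _ "\<tau> - t"]\<close>)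
  then show "((\<lambda>h. (u (h + t) n - u t n) / h) \<longlongrightarrow> (\<Sum>j=1..N. Gm n j * u t j) + ?F t n) (at_right 0)"
    by (simp add: mult.commute)
qed

text \<open>Quasi-positivity of the finite system, in terms of the negative parts. Off-diagonal
  fragmentation entries are nonnegative, so only negative u_j can push u_n down; the loss term
  contains u_n itself; a gain product is harmful only through a negative factor. Every harmful
  contribution thus carries a negative part besides that of u_n.\<close>

lemma trunc_negative_part_rate:
  obtains L where "0 \<le> L" "\<And>t n. t \<in> {0..\<tau>} \<Longrightarrow> n \<in> {1..N} \<Longrightarrow>
    min (u t n) 0 * ((\<Sum>j=1..N. Gm n j * u t j) + Kop (ktrunc N k) t (u t) n) \<le> L * (- min (u t n) 0) * (\<Sum>j=1..N. - min (u t j) 0)"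
proof -
  obtain R where R: "0 \<le> R" "\<And>t. t \<in> {0..\<tau>} \<Longrightarrow> wnorm wt (u t) \<le> R" using cont_wt_bounded[OF msol_cont[OF u]] by blast
  have bd: "\<bar>u t n\<bar> \<le> R" if t: "t \<in> {0..\<tau>}" and n: "n \<ge> 1" for t n
  proof -
    have "1 * \<bar>u t n\<bar> \<le> wt n * \<bar>u t n\<bar>" using wt_ge_w[OF n] w_ge[OF n] n by (intro mult_right_mono) auto
    then show ?thesis using wnorm_comp_le[OF msol_lsp[OF u t] wt_pos, of n] R(2)[OF t] by simp
  qed
  \<comment> \<open>A crude common bound for the finitely many kernel entries, uniform in
    time.\<close>
  define K where "K = (\<Sum>i=1..N. \<Sum>j=1..N. c * wt i * wt j / w (i + j))"
  have c: "0 \<le> c" by (rule kernel_okD(1)[OF k])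
  have tn: "0 \<le> c * wt i * wt j / w (i + j)" if "i \<ge> 1" "j \<ge> 1" for i j
    using c wt_pos[OF that(1)] wt_pos[OF that(2)] wpos[of "i + j"] that by (auto intro!: divide_nonneg_pos)
  have K: "0 \<le> K" unfolding K_def by (intro sum_nonneg tn) auto
  have kK: "0 \<le> ktrunc N k i j t" "ktrunc N k i j t \<le> K" if "i \<ge> 1" "j \<ge> 1" and t: "t \<in> {0..\<tau>}" for i j t
  proof -
    show "0 \<le> ktrunc N k i j t" by (rule kernel_okD(2)[OF trunc_kernel that])
    show "ktrunc N k i j t \<le> K"
    proof (cases "i \<le> N \<and> j \<le> N")
      case True
      have "ktrunc N k i j t \<le> c * wt i * wt j / w (i + j)" by (rule kernel_okD(3)[OF trunc_kernel that])
      also have "\<dots> \<le> (\<Sum>j=1..N. c * wt i * wt j / w (i + j))"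
        by (rule member_le_sum) (use True that tn in auto)
      also have "\<dots> \<le> K" unfolding K_def
        by (rule member_le_sum[of i _ "\<lambda>i. \<Sum>j=1..N. c * wt i * wt j / w (i + j)"]) (use True that in \<open>auto intro!: sum_nonneg tn\<close>)
      finally show ?thesis .
    next
      case False
      then show ?thesis using K by (auto simp: ktrunc_def)
    qed
  qed
  define L1 where "L1 = (\<Sum>n=1..N. \<Sum>j=1..N. \<bar>Gm n j\<bar>)"
  have GL: "\<bar>Gm n j\<bar> \<le> L1" if "n \<in> {1..N}" "j \<in> {1..N}" for n j
  proof -
    have "\<bar>Gm n j\<bar> \<le> (\<Sum>j=1..N. \<bar>Gm n j\<bar>)" by (rule member_le_sum) (use that in auto)
    also have "\<dots> \<le> L1" unfolding L1_def
      by (rule member_le_sum[of n _ "\<lambda>n. \<Sum>j=1..N. \<bar>Gm n j\<bar>"]) (use that in \<open>auto intro!: sum_nonneg\<close>)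
    finally show ?thesis .
  qed
  have L1: "0 \<le> L1" unfolding L1_def by (intro sum_nonneg) auto
  define L where "L = L1 + 2 * N * K * R"
  have main: "min (u t n) 0 * ((\<Sum>j=1..N. Gm n j * u t j) + Kop (ktrunc N k) t (u t) n) \<le> L * (- min (u t n) 0) * (\<Sum>j=1..N. - min (u t j) 0)"
    if t: "t \<in> {0..\<tau>}" and n: "n \<in> {1..N}" for t n
  proof -
    define m where "m j = - min (u t j) 0" for j
    define Q where "Q = (\<Sum>j=1..N. m j)"
    have m0: "0 \<le> m j" and um: "- u t j \<le> m j" for j by (auto simp: m_def)
    have mQ: "m j \<le> Q" if "j \<in> {1..N}" for j unfolding Q_def by (rule member_le_sum) (use that m0 in auto)
    have Q0: "0 \<le> Q" unfolding Q_def by (intro sum_nonneg) (auto simp: m0)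
    have n1: "n \<ge> 1" "n \<le> N" using n by auto
    have 1: "- m n * (\<Sum>j=1..N. Gm n j * u t j) \<le> L1 * m n * Q"
    proof -
      have "- m n * (\<Sum>j=1..N. Gm n j * u t j) = (\<Sum>j=1..N. - m n * (Gm n j * u t j))" by (simp add: sum_distrib_left)
      also have "\<dots> \<le> (\<Sum>j=1..N. L1 * m n * m j)"
      proof (rule sum_mono)
        fix j assume j: "j \<in> {1..N}"
        show "- m n * (Gm n j * u t j) \<le> L1 * m n * m j"
        proof (cases "j = n")
          case True
          have "m n * u t n = - (m n * m n)" by (auto simp: m_def min_def)
          moreover have "- m n * (Gm n n * u t n) = - (Gm n n * (m n * u t n))" by simp
          ultimately have "- m n * (Gm n n * u t n) = Gm n n * (m n * m n)" by simp
          also have "\<dots> \<le> L1 * (m n * m n)" using GL[OF n n] m0 by (intro mult_right_mono) auto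
          finally show ?thesis using True by (simp add: mult.assoc)
        next
          case False
          have g: "0 \<le> Gm n j" using False a_nn[of j] b_nn[of n j] j n by (auto simp: Gm_def)
          have "Gm n j * (- u t j) \<le> L1 * m j" using GL[OF n j] g um[of j] m0[of j] L1
            by (intro order.trans[OF mult_left_mono[OF um g] mult_right_mono]) auto
          from mult_left_mono[OF this m0[of n]] show ?thesis by (simp add: algebra_simps)
        qed
      qed
      also have "\<dots> = L1 * m n * Q" by (simp add: Q_def sum_distrib_left)
      finally show ?thesis .
    qed
    have 2: "- (\<Sum>j=1..n-1. ktrunc N k (n-j) j t * u t (n-j) * u t j) \<le> 2 * N * K * R * Q"
    proof -
      have "- (\<Sum>j=1..n-1. ktrunc N k (n-j) j t * u t (n-j) * u t j) \<le> (\<Sum>j=1..n-1. 2 * K * R * Q)"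
        unfolding sum_negf[symmetric]
      proof (rule sum_mono)
        fix j assume j: "j \<in> {1..n-1}"
        then have j1: "n - j \<ge> 1" "j \<ge> 1" "n - j \<in> {1..N}" "j \<in> {1..N}" using n by auto
        have "- (u t (n-j) * u t j) \<le> R * (m (n-j) + m j)"
          unfolding m_def by (rule neg_prod_le[OF bd[OF t j1(1)] bd[OF t j1(2)]])
        also have "\<dots> \<le> R * (Q + Q)" using mQ[OF j1(3)] mQ[OF j1(4)] R by (intro mult_left_mono) auto
        finally have "ktrunc N k (n-j) j t * (- (u t (n-j) * u t j)) \<le> ktrunc N k (n-j) j t * (R * (Q + Q))"
          using kK(1)[OF j1(1,2) t] by (intro mult_left_mono)
        also have "\<dots> \<le> K * (R * (Q + Q))" using kK(2)[OF j1(1,2) t] R Q0 by (intro mult_right_mono) auto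
        finally show "- (ktrunc N k (n-j) j t * u t (n-j) * u t j) \<le> 2 * K * R * Q" by (simp add: algebra_simps)
      qed
      also have "\<dots> = real (n - 1) * (2 * K * R * Q)" by simp
      also have "\<dots> \<le> real N * (2 * K * R * Q)" using n R K Q0 by (intro mult_right_mono) auto
      finally show ?thesis by (simp add: algebra_simps)
    qed
    have 3: "m n * (\<Sum>j=1..N. ktrunc N k n j t * u t n * u t j) \<le> m n * (N * K * R * Q)"
    proof -
      have "m n * (\<Sum>j=1..N. ktrunc N k n j t * u t n * u t j) = (\<Sum>j=1..N. m n * m n * (ktrunc N k n j t * (- u t j)))"
      proof -
        have "m n * u t n = - (m n * m n)" by (auto simp: m_def min_def)
        then have "m n * (ktrunc N k n j t * u t n * u t j) = m n * m n * (ktrunc N k n j t * (- u t j))" for j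
          by (metis (no_types, opaque_lifting) mult.assoc mult.left_commute mult_minus_left mult_minus_right)
        then show ?thesis by (simp only: sum_distrib_left)
      qed
      also have "\<dots> \<le> (\<Sum>j=1..N. m n * Q * (K * R))"
      proof (rule sum_mono)
        fix j assume j: "j \<in> {1..N}"
        have kk: "0 \<le> ktrunc N k n j t" "ktrunc N k n j t \<le> K" using kK[of n j t] j n t by auto
        have "- u t j \<le> R" using bd[OF t, of j] j by auto
        then have "ktrunc N k n j t * (- u t j) \<le> K * R"
          using kk R by (intro order.trans[OF mult_left_mono[OF _ kk(1)] mult_right_mono]) auto
        then have "m n * m n * (ktrunc N k n j t * (- u t j)) \<le> m n * m n * (K * R)"
          using m0[of n] by (intro mult_left_mono) auto
        also have "\<dots> \<le> m n * Q * (K * R)" using mQ[OF n] m0[of n] K R by (intro mult_right_mono mult_left_mono) auto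
        finally show "m n * m n * (ktrunc N k n j t * (- u t j)) \<le> m n * Q * (K * R)" .
      qed
      finally show ?thesis by (simp add: algebra_simps)
    qed
    have 4: "- m n * Kop (ktrunc N k) t (u t) n \<le> 2 * N * K * R * m n * Q"
    proof -
      have "- m n * Kop (ktrunc N k) t (u t) n = 1/2 * (m n * - (\<Sum>j=1..n-1. ktrunc N k (n-j) j t * u t (n-j) * u t j))
          + m n * (\<Sum>j=1..N. ktrunc N k n j t * u t n * u t j)"
        unfolding trunc_Kop[OF t n1(1)] by (simp add: algebra_simps)
      also have "\<dots> \<le> 1/2 * (m n * (2 * N * K * R * Q)) + m n * (N * K * R * Q)"
        by (intro add_mono mult_left_mono 2 3 m0) auto
      also have "\<dots> = 2 * N * K * R * m n * Q" by (simp add: algebra_simps)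
      finally show ?thesis .
    qed
    have "min (u t n) 0 = - m n" by (simp add: m_def)
    then have "min (u t n) 0 * ((\<Sum>j=1..N. Gm n j * u t j) + Kop (ktrunc N k) t (u t) n)
        = - m n * (\<Sum>j=1..N. Gm n j * u t j) + - m n * Kop (ktrunc N k) t (u t) n"
      by (simp add: distrib_left)
    also have "\<dots> \<le> L1 * m n * Q + 2 * N * K * R * m n * Q" by (rule add_mono[OF 1 4])
    also have "\<dots> = L * m n * Q" by (simp add: L_def algebra_simps)
    finally show ?thesis by (simp add: m_def Q_def)
  qed
  have "0 \<le> L" unfolding L_def using L1 K R by simp
  then show thesis using that main by blast
qed

text \<open>The sum y of squared negative parts starts at 0 and satisfies y' \<le> Q y, so it stays
  0. The factor N in Q = 2 L N comes from Cauchy-Schwarz, which turns the squared sum of negative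
  parts into the sum of squares.\<close>

lemma trunc_nonneg:
  assumes pos: "\<And>n. 0 \<le> u0 n" and t: "t \<in> {0..\<tau>}"
  shows "0 \<le> u t n"
proof -
  let ?D = "\<lambda>t n. (\<Sum>j=1..N. Gm n j * u t j) + Kop (ktrunc N k) t (u t) n"
  obtain L where L: "0 \<le> L" "\<And>t n. t \<in> {0..\<tau>} \<Longrightarrow> n \<in> {1..N} \<Longrightarrow>
      min (u t n) 0 * ?D t n \<le> L * (- min (u t n) 0) * (\<Sum>j=1..N. - min (u t j) 0)"
    using trunc_negative_part_rate by blast
  define y where "y t = (\<Sum>n=1..N. (min (u t n) 0)\<^sup>2)" for t
  define y' where "y' t = (\<Sum>n=1..N. 2 * min (u t n) 0 * ?D t n)" for t
  define Q where "Q = 2 * L * N"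
  have yd: "(y has_real_derivative y' x) (at_right x)" if x: "0 \<le> x" "x < \<tau>" for x
    unfolding y_def y'_def
    by (intro DERIV_sum DERIV_chain2[OF DERIV_min_zero_square trunc_right_deriv[OF x]]) auto
  have yle: "y' x \<le> Q * y x" if x: "x \<in> {0..\<tau>}" for x
  proof -
    let ?m = "\<lambda>j. - min (u x j) 0"
    have "y' x \<le> (\<Sum>n=1..N. 2 * L * (\<Sum>j=1..N. ?m j) * ?m n)"
      unfolding y'_def
    proof (rule sum_mono)
      fix n assume "n \<in> {1..N}"
      then show "2 * min (u x n) 0 * ?D x n \<le> 2 * L * (\<Sum>j=1..N. ?m j) * ?m n"
        using L(2)[OF x, of n] by (simp add: algebra_simps)
    qed
    also have "\<dots> = 2 * L * (\<Sum>j=1..N. ?m j)\<^sup>2" by (simp only: sum_distrib_left[symmetric] power2_eq_square mult.assoc)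
    also have "\<dots> \<le> 2 * L * ((\<Sum>j=1..N. (?m j)\<^sup>2) * card {1..N})"
      using L(1) by (intro mult_left_mono sum_squared_le_sum_of_squares) auto
    also have "\<dots> = Q * y x" by (simp add: Q_def y_def)
    finally show ?thesis .
  qed
  have tt: "0 \<le> t" "t \<le> \<tau>" using t by auto
  have "exp (- Q * t) * y t \<le> exp (- Q * 0) * y 0"
  proof (rule right_deriv_nonpos_imp_le[OF tt(1), of "\<lambda>x. exp (- Q * x) * y x" "\<lambda>x. exp (- Q * x) * (y' x - Q * y x)"])
    show "continuous_on {0..t} (\<lambda>x. exp (- Q * x) * y x)"
      unfolding y_def using continuous_on_subset[OF trunc_comp_continuous, of "{0..t}"] tt by (intro continuous_intros) auto
    show "((\<lambda>x. exp (- Q * x) * y x) has_real_derivative exp (- Q * x) * (y' x - Q * y x)) (at_right x)" if x: "0 \<le> x" "x < t" for x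
      using yd[of x] x tt by (auto intro!: derivative_eq_intros simp: algebra_simps)
    show "exp (- Q * x) * (y' x - Q * y x) \<le> 0" if x: "0 \<le> x" "x < t" for x
      using yle[of x] x tt by (intro mult_nonneg_nonpos) auto
  qed
  moreover have "y 0 = 0" unfolding y_def
    using msol_init[OF u _ trunc_u0] pos t by (intro sum.neutral) auto
  ultimately have "y t \<le> 0" by (simp add: mult_le_0_iff)
  moreover have "0 \<le> y t" unfolding y_def by (intro sum_nonneg) auto
  ultimately have "y t = 0" by simp
  then have z: "(min (u t n) 0)\<^sup>2 = 0" if "n \<in> {1..N}" for n
    unfolding y_def using that by (subst (asm) sum_nonneg_eq_0_iff) auto
  show ?thesis
  proof (cases "n \<in> {1..N}")
    case True
    then have "min (u t n) 0 = 0" using z[of n] by simp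
    then show ?thesis by (simp add: min_def split: if_splits)
  next
    case False
    then have "n = 0 \<or> n > N" by auto
    then show ?thesis using trunc_zero[OF t] trunc_support[OF t] by auto
  qed
qed

text \<open>Truncated coagulation has exact mass balance, which leaves the fragmentation balance
  summed over columns.\<close>

lemma trunc_mass_right_deriv:
  assumes x: "0 \<le> x" "x < \<tau>"
  shows "((\<lambda>t. \<Sum>n=1..N. real n * u t n) has_real_derivative
     (\<Sum>j=1..N. a j * ((\<Sum>n=1..j-1. real n * b n j) - real j) * u x j)) (at_right x)"
proof -
  have xI: "x \<in> {0..\<tau>}" using x by simp
  have "((\<lambda>t. \<Sum>n=1..N. real n * u t n) has_real_derivative
     (\<Sum>n=1..N. real n * ((\<Sum>j=1..N. Gm n j * u x j) + Kop (ktrunc N k) x (u x) n))) (at_right x)"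
    by (intro DERIV_sum DERIV_cmult trunc_right_deriv[OF x]) auto
  also have "(\<Sum>n=1..N. real n * ((\<Sum>j=1..N. Gm n j * u x j) + Kop (ktrunc N k) x (u x) n))
     = (\<Sum>n=1..N. real n * (\<Sum>j=1..N. Gm n j * u x j)) + (\<Sum>n=1..N. real n * Kop (ktrunc N k) x (u x) n)"
    by (simp add: distrib_left sum.distrib)
  also have "(\<Sum>n=1..N. real n * Kop (ktrunc N k) x (u x) n) = 0"
  proof -
    let ?A = "\<lambda>i j. ktrunc N k i j x * u x i * u x j"
    have "(\<Sum>n=1..N. real n * Kop (ktrunc N k) x (u x) n)
       = (\<Sum>n=1..N. real n * ((1/2) * (\<Sum>j=1..n-1. ?A (n-j) j) - (\<Sum>j=1..N. ?A n j)))"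
      by (rule sum.cong) (use trunc_Kop[OF xI] in auto)
    also have "\<dots> = 0"
    proof (rule coagulation_mass_zero)
      fix i j
      show "?A i j = ?A j i"
      proof (cases "i = 0 \<or> j = 0")
        case False
        then have "ktrunc N k i j x = ktrunc N k j i x" using kernel_okD(4)[OF trunc_kernel _ _ xI] by simp
        then show ?thesis by simp
      qed (use trunc_zero[OF xI] in auto)
    qed (use trunc_zero[OF xI] in \<open>auto simp: ktrunc_def\<close>)
    finally show ?thesis .
  qed
  also have "(\<Sum>n=1..N. real n * (\<Sum>j=1..N. Gm n j * u x j)) = (\<Sum>j=1..N. (\<Sum>n=1..N. real n * Gm n j) * u x j)"
    by (simp add: sum_distrib_left sum_distrib_right mult.assoc) (rule sum.swap)
  also have "\<dots> = (\<Sum>j=1..N. a j * ((\<Sum>n=1..j-1. real n * b n j) - real j) * u x j)"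
    by (rule sum.cong) (use weighted_Gm_column[of _ N real] in auto)
  finally show ?thesis by simp
qed

lemma trunc_phi1: "t \<in> {0..\<tau>} \<Longrightarrow> phi1 (u t) = (\<Sum>n=1..N. real n * u t n)"
proof -
  assume t: "t \<in> {0..\<tau>}"
  show ?thesis unfolding phi1_def
  proof (rule suminf_finite)
    fix n assume "n \<notin> {1..N}"
    then have "n = 0 \<or> n > N" by auto
    then show "real n * u t n = 0" using trunc_support[OF t] by auto
  qed simp
qed

lemma trunc_mass_continuous: "t \<le> \<tau> \<Longrightarrow> continuous_on {0..t} (\<lambda>t. \<Sum>n=1..N. real n * u t n)"
  using continuous_on_subset[OF trunc_comp_continuous, of "{0..t}"] by (intro continuous_intros) auto

lemma trunc_mass_le:
  assumes pos: "\<And>n. 0 \<le> u0 n" and t: "t \<in> {0..\<tau>}" and m: "\<And>j. j \<ge> 2 \<Longrightarrow> (\<Sum>n=1..j-1. real n * b n j) \<le> real j"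
  shows "phi1 (u t) \<le> phi1 u0"
proof -
  have tt: "0 \<le> t" "t \<le> \<tau>" using t by auto
  have m': "(\<Sum>n=1..j-1. real n * b n j) \<le> real j" if "j \<ge> 1" for j
    using m[of j] that by (cases "j = 1") auto
  have "(\<Sum>n=1..N. real n * u t n) \<le> (\<Sum>n=1..N. real n * u 0 n)"
  proof (rule right_deriv_nonpos_imp_le[OF tt(1) trunc_mass_continuous[OF tt(2)] trunc_mass_right_deriv])
    fix x assume x: "0 \<le> x" "x < t"
    show "(\<Sum>j=1..N. a j * ((\<Sum>n=1..j-1. real n * b n j) - real j) * u x j) \<le> 0"
      using a_nn m' trunc_nonneg[OF pos, of x] x tt
      by (intro sum_nonpos mult_nonpos_nonneg mult_nonneg_nonpos) auto
  qed (use tt in auto)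
  then show ?thesis using trunc_phi1[OF t] trunc_phi1[of 0] t msol_init[OF u _ trunc_u0] by simp
qed

lemma trunc_mass_eq:
  assumes t: "t \<in> {0..\<tau>}" and m: "a 1 = 0" "\<And>j. j \<ge> 2 \<Longrightarrow> (\<Sum>n=1..j-1. real n * b n j) = real j"
  shows "phi1 (u t) = phi1 u0"
proof -
  have tt: "0 \<le> t" "t \<le> \<tau>" using t by auto
  \<comment> \<open>For j = 1 the sum is empty and the bracket equals -1; this is the place where
    \<open>a 1 = 0\<close> matters.\<close>
  have m': "a j * ((\<Sum>n=1..j-1. real n * b n j) - real j) = 0" if "j \<ge> 1" for j
    using m(1) m(2)[of j] that by (cases "j = 1") auto
  have "(\<Sum>n=1..N. real n * u t n) = (\<Sum>n=1..N. real n * u 0 n)"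
  proof (rule right_deriv_zero_imp_eq[OF tt(1) trunc_mass_continuous[OF tt(2)]])
    fix x assume x: "0 \<le> x" "x < t"
    have "(\<Sum>j=1..N. a j * ((\<Sum>n=1..j-1. real n * b n j) - real j) * u x j) = 0"
      using m' by (intro sum.neutral) auto
    then show "((\<lambda>t. \<Sum>n=1..N. real n * u t n) has_real_derivative 0) (at_right x)"
      using trunc_mass_right_deriv[of x] x tt by simp
  qed
  then show ?thesis using trunc_phi1[OF t] trunc_phi1[of 0] t msol_init[OF u _ trunc_u0] by simp
qed

end

section \<open>Transfer from truncated problems to mild solutions\<close>

lemma msol_approximation:
  assumes k: "kernel_ok k \<tau> c" and g: "good_step \<tau> R c" and u: "msol k u0 \<tau> u" and u0: "u0 \<in> lsp wt"
    and R0: "\<And>t. t \<in> {0..\<tau>} \<Longrightarrow> wnorm wt (u t) \<le> R0" and R: "2 * C1 * R0 \<le> R" and e: "0 < e"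
  obtains N v where "msol (ktrunc N k) (strunc N u0) \<tau> v"
    "wnorm wt (\<lambda>n. u0 n - strunc N u0 n) \<le> e" "\<And>t. t \<in> {0..\<tau>} \<Longrightarrow> wnorm wt (\<lambda>n. u t n - v t n) \<le> e"
proof -
  have \<tau>: "0 \<le> \<tau>" using g by (simp add: good_step_def)
  have c: "0 \<le> c" by (rule kernel_okD(1)[OF k])
  have ui: "u 0 = u0" by (rule msol_init[OF u \<tau> u0])
  have u00: "wnorm wt u0 \<le> R0" using R0[of 0] \<tau> ui by simp
  have R0p: "0 \<le> R0" using u00 wnorm_nonneg[OF u0 wt_pos] by linarith
  have R0R: "R0 \<le> R"
  proof -
    have "1 * R0 \<le> (2 * C1) * R0" using C1 R0p by (intro mult_right_mono) auto
    then show ?thesis using R by simp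
  qed
  have Rp: "0 \<le> R" using R0R R0p by simp
  \<comment> \<open>The comparison estimate yields the error (D - 1) e' for e' = e / D; the added 1
    also ensures e' \<le> e, which is wanted for the initial data.\<close>
  define D where "D = 2 * (C1 + dfac \<tau> * (3 * c * R)) + 1"
  have D: "D \<ge> 1" using C1 dfac_nonneg[of \<tau>] c Rp by (simp add: D_def)
  define e' where "e' = e / D"
  have e': "0 < e'" "D * e' = e" "e' \<le> e"
  proof -
    show "0 < e'" "D * e' = e" using e D by (auto simp: e'_def)
    then show "e' \<le> e" using D mult_right_mono[of 1 D e'] by simp
  qed
  obtain M where M: "\<And>t. t \<in> {0..\<tau>} \<Longrightarrow> wnorm wt (\<lambda>n. u t n - strunc M (u t) n) \<le> e'"
    using cont_wt_uniform_tail[OF msol_cont[OF u] e'(1)] by blast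
  \<comment> \<open>Doubling makes \<open>N div 2\<close> equal to M, so one uniform tail bound
    controls both the truncated kernel and the truncated data.\<close>
  define N where "N = 2 * M"
  have s0: "strunc N u0 \<in> lsp wt" by (rule strunc_lsp[OF u0])
  have t0: "wnorm wt (\<lambda>n. u0 n - strunc N u0 n) \<le> e'"
  proof -
    have "wnorm wt (\<lambda>n. u0 n - strunc N u0 n) \<le> wnorm wt (\<lambda>n. u0 n - strunc M u0 n)"
      by (rule lsp_le(2)[OF lsp_diff(1)[OF u0 strunc_lsp[OF u0] wt_pos] wt_pos])
        (use lsp_zero[OF u0] in \<open>auto simp: strunc_def N_def\<close>)
    then show ?thesis using M[of 0] \<tau> ui by simp
  qed
  have kN: "kernel_ok (ktrunc N k) \<tau> c" by (rule kernel_ok_ktrunc[OF k])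
  have "2 * C1 * wnorm wt (strunc N u0) \<le> 2 * C1 * R0"
    using C1 strunc_norm_le[OF u0 wt_pos, of N] u00 by (intro mult_left_mono) auto
  then have "2 * C1 * wnorm wt (strunc N u0) \<le> R" using R by linarith
  then obtain v where v: "msol (ktrunc N k) (strunc N u0) \<tau> v" "\<And>t. t \<in> {0..\<tau>} \<Longrightarrow> wnorm wt (v t) \<le> R"
    using msol_local_exists[OF kN g s0] by blast
  have eps: "wnorm w (\<lambda>n. Kop k s (u s) n - Kop (ktrunc N k) s (u s) n) \<le> 3 * c * R * e'" if s: "s \<in> {0..\<tau>}" for s
  proof -
    have us: "u s \<in> lsp wt" by (rule msol_lsp[OF u s])
    have "wnorm w (\<lambda>n. Kop k s (u s) n - Kop (ktrunc N k) s (u s) n) \<le> 3 * c * wnorm wt (u s) * wnorm wt (\<lambda>n. u s n - strunc (N div 2) (u s) n)"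
      by (rule Kop_ktrunc_close[OF k s us])
    also have "N div 2 = M" by (simp add: N_def)
    also have "3 * c * wnorm wt (u s) * wnorm wt (\<lambda>n. u s n - strunc M (u s) n) \<le> 3 * c * R * e'"
      using M[OF s] R0[OF s] R0R c Rp wnorm_nonneg[OF lsp_diff(1)[OF us strunc_lsp[OF us] wt_pos] wt_pos]
      by (intro mult_mono mult_left_mono) auto
    finally show ?thesis .
  qed
  have "wnorm wt (\<lambda>n. u t n - v t n) \<le> e" if t: "t \<in> {0..\<tau>}" for t
  proof -
    have "wnorm wt (\<lambda>n. u t n - v t n) \<le> 2 * (C1 * wnorm wt (\<lambda>n. u0 n - strunc N u0 n) + dfac \<tau> * (3 * c * R * e'))"
    proof (rule msol_compare[OF k kN u v(1) g Rp u0 s0 _ v(2) eps t])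
      fix s assume "s \<in> {0..\<tau>}"
      then show "wnorm wt (u s) \<le> R" using R0[of s] R0R by linarith
    qed auto
    also have "\<dots> \<le> 2 * (C1 * e' + dfac \<tau> * (3 * c * R * e'))"
      using t0 C1 by (intro mult_left_mono add_right_mono) auto
    also have "\<dots> = D * e' - e'" by (simp add: D_def algebra_simps)
    finally show ?thesis using e' by linarith
  qed
  then show thesis using that[OF v(1)] t0 e'(3) by force
qed

text \<open>On a short interval the truncated solutions converge to u in norm. Coordinates and the
  first moment are continuous for the norm, so sign and mass balance are inherited from the finite
  systems.\<close>

lemma msol_short_properties:
  assumes k: "kernel_ok k \<tau> c" and g: "good_step \<tau> R c" and u: "msol k u0 \<tau> u" and u0: "u0 \<in> lsp wt"
    and R0: "\<And>t. t \<in> {0..\<tau>} \<Longrightarrow> wnorm wt (u t) \<le> R0" and R: "2 * C1 * R0 \<le> R"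
    and pos: "nonneg_seq u0" and t: "t \<in> {0..\<tau>}"
  shows "nonneg_seq (u t)"
    and "(\<And>j. j \<ge> 2 \<Longrightarrow> (\<Sum>n=1..j-1. real n * b n j) \<le> real j) \<Longrightarrow> phi1 (u t) \<le> phi1 u0"
    and "a 1 = 0 \<Longrightarrow> (\<And>j. j \<ge> 2 \<Longrightarrow> (\<Sum>n=1..j-1. real n * b n j) = real j) \<Longrightarrow> phi1 (u t) = phi1 u0"
proof -
  have ut: "u t \<in> lsp wt" by (rule msol_lsp[OF u t])
  have wtn: "real n \<le> wt n" if "n \<ge> 1" for n using wt_ge_w[OF that] w_ge[OF that] by linarith
  have app: "\<exists>N v. msol (ktrunc N k) (strunc N u0) \<tau> v \<and> wnorm wt (\<lambda>n. u0 n - strunc N u0 n) \<le> e \<and> v t \<in> lsp wt \<and>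
      wnorm wt (\<lambda>n. u t n - v t n) \<le> e" if e: "0 < e" for e
  proof -
    obtain N v where "msol (ktrunc N k) (strunc N u0) \<tau> v"
    "wnorm wt (\<lambda>n. u0 n - strunc N u0 n) \<le> e" "\<And>t. t \<in> {0..\<tau>} \<Longrightarrow> wnorm wt (\<lambda>n. u t n - v t n) \<le> e"
      using msol_approximation[OF k g u u0 R0 R e] by blast
    then show ?thesis using msol_lsp t by blast
  qed
  have st: "strunc N u0 0 = 0" "n > N \<Longrightarrow> strunc N u0 n = 0" "0 \<le> strunc N u0 n" for N n
    using lsp_zero[OF u0] pos by (auto simp: strunc_def nonneg_seq_def)
  show "nonneg_seq (u t)" unfolding nonneg_seq_def
  proof
    fix n
    show "0 \<le> u t n"
    proof (cases "n = 0")
      case False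
      then have wn: "0 < wt n" "n \<ge> 1" using wt_pos by auto
      show ?thesis
      proof (rule ccontr)
        assume "\<not> 0 \<le> u t n"
        then have neg: "u t n < 0" by simp
        \<comment> \<open>Half the weighted size of the negative coordinate: an approximation that
          is nonnegative there would be at distance at least 2e.\<close>
        define e where "e = wt n * (- u t n) / 2"
        have e: "e > 0" using neg wn by (simp add: e_def mult_pos_neg)
        obtain N v where v: "msol (ktrunc N k) (strunc N u0) \<tau> v" "v t \<in> lsp wt" "wnorm wt (\<lambda>n. u t n - v t n) \<le> e"
          using app[OF e] by blast
        have "0 \<le> v t n" by (rule trunc_nonneg[OF k v(1) st t])
        then have "wt n * (- u t n) \<le> wt n * \<bar>u t n - v t n\<bar>" using wn by (intro mult_left_mono) auto
        also have "\<dots> \<le> e" using wnorm_comp_le[OF lsp_diff(1)[OF ut v(2) wt_pos] wt_pos, of n] v(3) by linarith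
        finally have "2 * e \<le> e" by (simp add: e_def)
        then show False using e by simp
      qed
    qed (simp add: lsp_zero[OF ut])
  qed
  have ph: "\<exists>N v. msol (ktrunc N k) (strunc N u0) \<tau> v \<and> \<bar>phi1 (u t) - phi1 (v t)\<bar> \<le> e \<and> \<bar>phi1 u0 - phi1 (strunc N u0)\<bar> \<le> e"
    if e: "0 < e" for e
  proof -
    obtain N v where v: "msol (ktrunc N k) (strunc N u0) \<tau> v" "wnorm wt (\<lambda>n. u0 n - strunc N u0 n) \<le> e"
        "v t \<in> lsp wt" "wnorm wt (\<lambda>n. u t n - v t n) \<le> e"
      using app[OF e] by blast
    have "\<bar>phi1 (u t) - phi1 (v t)\<bar> \<le> e" using phi1_diff_le[OF wtn ut v(3)] v(4) by linarith
    moreover have "\<bar>phi1 u0 - phi1 (strunc N u0)\<bar> \<le> e" using phi1_diff_le[OF wtn u0 strunc_lsp[OF u0]] v(2) by (meson order.trans)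
    ultimately show ?thesis using v(1) by blast
  qed
  show "phi1 (u t) \<le> phi1 u0" if m: "\<And>j. j \<ge> 2 \<Longrightarrow> (\<Sum>n=1..j-1. real n * b n j) \<le> real j"
  proof (rule field_le_epsilon)
    fix e :: real assume "0 < e"
    then obtain N v where v: "msol (ktrunc N k) (strunc N u0) \<tau> v" "\<bar>phi1 (u t) - phi1 (v t)\<bar> \<le> e / 2" "\<bar>phi1 u0 - phi1 (strunc N u0)\<bar> \<le> e / 2"
      using ph[of "e / 2"] by auto
    have "phi1 (v t) \<le> phi1 (strunc N u0)" by (rule trunc_mass_le[OF k v(1) st t m])
    then show "phi1 (u t) \<le> phi1 u0 + e" using v(2,3) by linarith
  qed
  show "phi1 (u t) = phi1 u0" if m: "a 1 = 0" "\<And>j. j \<ge> 2 \<Longrightarrow> (\<Sum>n=1..j-1. real n * b n j) = real j"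
  proof -
    have "\<bar>phi1 (u t) - phi1 u0\<bar> \<le> 0 + e" if e: "0 < e" for e
    proof -
      obtain N v where v: "msol (ktrunc N k) (strunc N u0) \<tau> v" "\<bar>phi1 (u t) - phi1 (v t)\<bar> \<le> e / 2" "\<bar>phi1 u0 - phi1 (strunc N u0)\<bar> \<le> e / 2"
        using ph[of "e / 2"] e by auto
      have "phi1 (v t) = phi1 (strunc N u0)" by (rule trunc_mass_eq[OF k v(1) st(1,2) t m])
      then show ?thesis using v(2,3) by linarith
    qed
    then have "\<bar>phi1 (u t) - phi1 u0\<bar> \<le> 0" by (rule field_le_epsilon)
    then show ?thesis by simp
  qed
qed

text \<open>The step length depends only on the maximal norm of u and on c, so the short result is
  repeated up to \<tau>. The claims are carried together because each restart needs nonnegative data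
  before the mass statement can be used again.\<close>

lemma msol_properties:
  assumes k: "kernel_ok k \<tau> c" and u: "msol k u0 \<tau> u" and u0: "u0 \<in> lsp wt" and pos: "nonneg_seq u0" and t: "t \<in> {0..\<tau>}"
  shows "nonneg_seq (u t)"
    and "(\<And>j. j \<ge> 2 \<Longrightarrow> (\<Sum>n=1..j-1. real n * b n j) \<le> real j) \<Longrightarrow> phi1 (u t) \<le> phi1 u0"
    and "a 1 = 0 \<Longrightarrow> (\<And>j. j \<ge> 2 \<Longrightarrow> (\<Sum>n=1..j-1. real n * b n j) = real j) \<Longrightarrow> phi1 (u t) = phi1 u0"
proof -
  obtain R0 where R0: "0 \<le> R0" "\<And>t. t \<in> {0..\<tau>} \<Longrightarrow> wnorm wt (u t) \<le> R0" using cont_wt_bounded[OF msol_cont[OF u]] by blast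
  define R where "R = 2 * C1 * R0"
  have R: "0 \<le> R" using R0 C1 by (simp add: R_def)
  have c: "0 \<le> c" by (rule kernel_okD(1)[OF k])
  obtain \<delta> where \<delta>: "0 < \<delta>" "good_step \<delta> R c" using good_step_exists[OF R c] .
  have \<tau>: "0 \<le> \<tau>" using t by auto
  let ?sub = "\<forall>j\<ge>2. (\<Sum>n=1..j-1. real n * b n j) \<le> real j"
  let ?eq = "a 1 = 0 \<and> (\<forall>j\<ge>2. (\<Sum>n=1..j-1. real n * b n j) = real j)"
  let ?P = "\<lambda>q. \<forall>t\<in>{0..q}. nonneg_seq (u t) \<and> (?sub \<longrightarrow> phi1 (u t) \<le> phi1 u0) \<and> (?eq \<longrightarrow> phi1 (u t) = phi1 u0)"
  have "?P \<tau>"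
  proof (rule step_induct[OF \<delta>(1) \<tau>, of ?P])
    show "?P 0" using msol_init[OF u \<tau> u0] pos by simp
  next
    fix q assume q: "0 \<le> q" "q < \<tau>" and P: "?P q"
    define r where "r = min (q + \<delta>) \<tau> - q"
    have r: "0 \<le> r" "r \<le> \<delta>" "r \<le> \<tau> - q" "min (q + \<delta>) \<tau> = q + r" using q \<delta> by (auto simp: r_def)
    have uq: "u q \<in> lsp wt" by (rule msol_lsp[OF u]) (use q in auto)
    have Pq: "nonneg_seq (u q)" "?sub \<Longrightarrow> phi1 (u q) \<le> phi1 u0" "?eq \<Longrightarrow> phi1 (u q) = phi1 u0"
      using bspec[OF P, of q] q by auto
    have U: "msol (kshift q k) (u q) r (\<lambda>t. u (q + t))"
      by (rule msol_restrict[OF msol_restart[OF k u u0] r(3)]) (use q in auto)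
    have kr: "kernel_ok (kshift q k) r c" by (rule kernel_ok_restrict[OF kernel_ok_shift[OF k q(1)] r(3)])
    have gr: "good_step r R c" by (rule good_step_mono[OF \<delta>(2) r(1,2) R c])
    have bd: "wnorm wt (u (q + s)) \<le> R0" if "s \<in> {0..r}" for s using R0(2)[of "q + s"] that q r by auto
    have RR: "2 * C1 * R0 \<le> R" by (simp add: R_def)
    have p1: "nonneg_seq (u (q + s))" if "s \<in> {0..r}" for s
      by (rule msol_short_properties(1)[OF kr gr U uq bd RR Pq(1) that])
    have p2: "phi1 (u (q + s)) \<le> phi1 (u q)" if "s \<in> {0..r}" ?sub for s
      by (rule msol_short_properties(2)[OF kr gr U uq bd RR Pq(1) that(1)]) (use that(2) in auto)
    have p3: "phi1 (u (q + s)) = phi1 (u q)" if "s \<in> {0..r}" ?eq for s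
      by (rule msol_short_properties(3)[OF kr gr U uq bd RR Pq(1) that(1)]) (use that(2) in auto)
    show "?P (min (q + \<delta>) \<tau>)" unfolding r(4)
    proof
      fix x assume x: "x \<in> {0..q + r}"
      show "nonneg_seq (u x) \<and> (?sub \<longrightarrow> phi1 (u x) \<le> phi1 u0) \<and> (?eq \<longrightarrow> phi1 (u x) = phi1 u0)"
      proof (cases "x \<le> q")
        case True
        then show ?thesis using bspec[OF P, of x] x by auto
      next
        case False
        then have s: "x - q \<in> {0..r}" "q + (x - q) = x" using x by auto
        have "nonneg_seq (u x)" using p1[OF s(1)] s(2) by simp
        moreover have "phi1 (u x) \<le> phi1 u0" if ?sub
          using p2[OF s(1) that] Pq(2)[OF that] unfolding s(2) by linarith
        moreover have "phi1 (u x) = phi1 u0" if ?eq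
          using p3[OF s(1) that] Pq(3)[OF that] unfolding s(2) by linarith
        ultimately show ?thesis by blast
      qed
    qed
  qed
  from bspec[OF this t] show "nonneg_seq (u t)"
    and "(\<And>j. j \<ge> 2 \<Longrightarrow> (\<Sum>n=1..j-1. real n * b n j) \<le> real j) \<Longrightarrow> phi1 (u t) \<le> phi1 u0"
    and "a 1 = 0 \<Longrightarrow> (\<And>j. j \<ge> 2 \<Longrightarrow> (\<Sum>n=1..j-1. real n * b n j) = real j) \<Longrightarrow> phi1 (u t) = phi1 u0"
    by blast+
qed

end

subsection \<open>Maximal solutions\<close>

context coag_frag
begin

lemma msol_cong:
  assumes "msol k u0 \<tau> u" "\<And>t. t \<in> {0..\<tau>} \<Longrightarrow> v t = u t"
  shows "msol k u0 \<tau> v"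
proof -
  have "duh (\<lambda>s. Kop k s (v s)) t n = duh (\<lambda>s. Kop k s (u s)) t n" if "t \<in> {0..\<tau>}" for t n
    unfolding duh_def by (rule integral_cong) (use assms(2) that in auto)
  moreover have "cont_wt \<tau> v"
    using msol_cont[OF assms(1)] assms(2) unfolding cont_wt_def by simp
  ultimately show ?thesis using assms unfolding msol_def by simp
qed

context
  fixes T :: ereal and k :: "nat \<Rightarrow> nat \<Rightarrow> real \<Rightarrow> real"
  assumes kok: "\<And>\<tau>. 0 < \<tau> \<Longrightarrow> ereal \<tau> < T \<Longrightarrow> \<exists>c. kernel_ok k \<tau> c"
begin

lemma between_real:
  assumes "0 \<le> t" "ereal t < t1"
  obtains \<tau> where "t < \<tau>" "0 < \<tau>" "ereal \<tau> < t1"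
proof -
  obtain \<tau> where "ereal t < ereal \<tau>" "ereal \<tau> < t1" using ereal_dense2[OF assms(2)] by blast
  then show thesis using that[of \<tau>] assms(1) by simp
qed

text \<open>A solution on a half-open interval is a solution on each closed subinterval [0, \<tau>].
  In the backward direction the kernel hypothesis on [0, \<tau>] is what recovers integrability of
  the Duhamel integrand.\<close>

lemma mild_sol_iff:
  assumes u0: "u0 \<in> lsp wt"
  shows "mild_sol S k wt T u0 t1 u \<longleftrightarrow> 0 < t1 \<and> t1 \<le> T \<and> (\<forall>\<tau>. 0 < \<tau> \<and> ereal \<tau> < t1 \<longrightarrow> msol k u0 \<tau> u)"
proof (intro iffI conjI allI impI)
  assume m: "mild_sol S k wt T u0 t1 u"
  show "0 < t1" "t1 \<le> T" using m by (auto simp: mild_sol_def)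
  fix \<tau> assume \<tau>: "0 < \<tau> \<and> ereal \<tau> < t1"
  have sub: "{0..\<tau>} \<subseteq> tint t1" using \<tau> by (auto simp: tint_def intro: le_less_trans[of _ "ereal \<tau>"])
  show "msol k u0 \<tau> u" unfolding msol_def
  proof (intro conjI ballI allI)
    show "cont_wt \<tau> u"
    proof (rule cont_wtI_tendsto)
      fix t assume "t \<in> {0..\<tau>}"
      then have t: "t \<in> tint t1" using sub by auto
      show "u t \<in> lsp wt" using m t by (simp add: mild_sol_def)
      have "((\<lambda>s. wnorm wt (\<lambda>n. u s n - u t n)) \<longlongrightarrow> 0) (at t within tint t1)"
        using m t unfolding mild_sol_def ssub_def by blast
      then show "((\<lambda>s. wnorm wt (\<lambda>n. u s n - u t n)) \<longlongrightarrow> 0) (at t within {0..\<tau>})"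
        using sub by (rule tendsto_within_subset)
    qed
    fix t n assume "t \<in> {0..\<tau>}"
    then have t: "t \<in> tint t1" using sub by auto
    then show "u t n = S t u0 n + duh (\<lambda>s. Kop k s (u s)) t n"
      using m by (simp add: mild_sol_def duh_def)
  qed
next
  assume A: "0 < t1 \<and> t1 \<le> T \<and> (\<forall>\<tau>. 0 < \<tau> \<and> ereal \<tau> < t1 \<longrightarrow> msol k u0 \<tau> u)"
  have ex: "\<exists>\<tau>>t. 0 < \<tau> \<and> ereal \<tau> < t1 \<and> t \<in> {0..\<tau>} \<and> msol k u0 \<tau> u" if t: "t \<in> tint t1" for t
  proof -
    obtain \<tau> where "t < \<tau>" "0 < \<tau>" "ereal \<tau> < t1" using between_real[of t t1] t by (auto simp: tint_def)
    then show ?thesis using A t by (auto simp: tint_def)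
  qed
  show "mild_sol S k wt T u0 t1 u" unfolding mild_sol_def
  proof (intro conjI ballI allI)
    fix t assume t: "t \<in> tint t1"
    obtain \<tau> where \<tau>: "t < \<tau>" "0 < \<tau>" "ereal \<tau> < t1" "t \<in> {0..\<tau>}" "msol k u0 \<tau> u" using ex[OF t] by blast
    show "u t \<in> lsp wt" by (rule msol_lsp[OF \<tau>(5,4)])
    \<comment> \<open>Since t < \<tau>, both intervals coincide in a neighbourhood of t, so they
      define the same one- or two-sided limits.\<close>
    have "at t within tint t1 = at t within {0..\<tau>}"
    proof (rule at_within_nhd[of _ "{..<\<tau>}"])
      show "tint t1 \<inter> {..<\<tau>} - {t} = {0..\<tau>} \<inter> {..<\<tau>} - {t}"
        using \<tau>(3) by (auto simp: tint_def intro: less_trans[of _ "ereal \<tau>"])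
    qed (use \<tau> in auto)
    then show "((\<lambda>s. wnorm wt (ssub (u s) (u t))) \<longlongrightarrow> 0) (at t within tint t1)"
      using cont_wt_imp_tendsto[OF msol_cont[OF \<tau>(5)] \<tau>(4)] by (simp add: ssub_def)
    fix n
    have "ereal \<tau> < T" using \<tau>(3) A by (auto intro: less_le_trans)
    then obtain c where c: "kernel_ok k \<tau> c" using kok[OF \<tau>(2)] by blast
    obtain \<Phi> where "adm \<tau> \<Phi> (\<lambda>s. Kop k s (u s))" using msol_adm[OF \<tau>(5) c] by blast
    then show "(\<lambda>s. S (t - s) (Kop k s (u s)) n) integrable_on {0..t}"
      by (rule duh_integrable(1)) (use \<tau>(4) in auto)
    show "u t n = S t u0 n + integral {0..t} (\<lambda>s. S (t - s) (Kop k s (u s)) n)"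
      using msol_eq[OF \<tau>(5,4), of n] by (simp add: duh_def)
  qed (use A in auto)
qed

lemma mild_sol_msol:
  assumes "mild_sol S k wt T u0 t1 u" "u0 \<in> lsp wt" "0 < \<tau>" "ereal \<tau> < t1"
  shows "msol k u0 \<tau> u" "ereal \<tau> < T"
  using assms mild_sol_iff[OF assms(2)] by (auto intro: less_le_trans)

lemma mild_sol_agree:
  assumes u0: "u0 \<in> lsp wt" and u: "mild_sol S k wt T u0 t1 u" and v: "mild_sol S k wt T u0 t2 v"
    and t: "t \<in> tint t1" "t \<in> tint t2"
  shows "u t = v t"
proof -
  have "0 \<le> t" "ereal t < min t1 t2" using t by (auto simp: tint_def)
  then obtain \<tau> where \<tau>: "t < \<tau>" "0 < \<tau>" "ereal \<tau> < min t1 t2" using between_real by blast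
  have U: "msol k u0 \<tau> u" and V: "msol k u0 \<tau> v" and "ereal \<tau> < T"
    using mild_sol_msol[OF u u0 \<tau>(2)] mild_sol_msol[OF v u0 \<tau>(2)] \<tau>(3) by auto
  then obtain c where "kernel_ok k \<tau> c" using kok[OF \<tau>(2)] by blast
  then show ?thesis by (rule msol_unique[OF _ U V u0]) (use t \<tau> in \<open>auto simp: tint_def\<close>)
qed

lemma msol_imp_mild_sol:
  assumes u0: "u0 \<in> lsp wt" and u: "msol k u0 \<tau> u" and \<tau>: "0 < \<tau>" "ereal \<tau> < T"
  shows "mild_sol S k wt T u0 (ereal \<tau>) u"
  unfolding mild_sol_iff[OF u0] using msol_restrict[OF u] \<tau> by auto

lemma mild_sol_extend:
  assumes u0: "u0 \<in> lsp wt" and u: "mild_sol S k wt T u0 (ereal r) u" and rT: "ereal r < T"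
    and nb: "\<not> filterlim (\<lambda>t. wnorm wt (u t)) at_top (at_left r)"
  shows "\<exists>t2 v. ereal r < t2 \<and> t2 \<le> T \<and> mild_sol S k wt T u0 t2 v \<and> (\<forall>t\<in>tint (ereal r). v t = u t)"
proof -
  have r: "0 < r" using u by (simp add: mild_sol_def)
  obtain B where B: "\<not> (\<forall>\<^sub>F t in at_left r. B \<le> wnorm wt (u t))" using nb by (auto simp: filterlim_at_top)
  obtain \<tau>1 where \<tau>1: "r < \<tau>1" "0 < \<tau>1" "ereal \<tau>1 < T" using between_real[of r T] r rT by auto
  obtain c where k: "kernel_ok k \<tau>1 c" using kok[OF \<tau>1(2,3)] by blast
  define R where "R = 2 * C1 * max B 0"
  have R: "0 \<le> R" using C1 by (simp add: R_def)
  have c: "0 \<le> c" by (rule kernel_okD(1)[OF k])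
  obtain \<delta>0 where \<delta>0: "0 < \<delta>0" "good_step \<delta>0 R c" using good_step_exists[OF R c] .
  define \<delta> where "\<delta> = min \<delta>0 (\<tau>1 - r)"
  have \<delta>: "0 < \<delta>" "\<delta> \<le> \<tau>1 - r" "good_step \<delta> R c"
    using \<delta>0 \<tau>1 good_step_mono[OF \<delta>0(2) _ _ R c, of \<delta>] by (auto simp: \<delta>_def)
  have "\<exists>q. max 0 (r - \<delta>) < q \<and> q < r \<and> wnorm wt (u q) < B"
  proof (rule ccontr)
    assume "\<not> ?thesis"
    then have "\<forall>q>max 0 (r - \<delta>). q < r \<longrightarrow> B \<le> wnorm wt (u q)" by (meson not_less)
    moreover have "max 0 (r - \<delta>) < r" using r \<delta> by simp
    ultimately show False using B unfolding eventually_at_left_field by blast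
  qed
  then obtain q where q: "0 < q" "r - \<delta> < q" "q < r" "wnorm wt (u q) < B" by auto
  have U: "msol k u0 q u" using mild_sol_msol[OF u u0, of q] q by simp
  have uq: "u q \<in> lsp wt" by (rule msol_lsp[OF U]) (use q in auto)
  have "2 * C1 * wnorm wt (u q) \<le> R" unfolding R_def using C1 q by (intro mult_left_mono) auto
  moreover have "kernel_ok (kshift q k) \<delta> c"
    by (rule kernel_ok_restrict[OF kernel_ok_shift[OF k]]) (use q \<delta> in auto)
  ultimately obtain z where z: "msol (kshift q k) (u q) \<delta> z"
    using msol_local_exists[OF _ \<delta>(3) uq] by blast
  let ?x = "\<lambda>t. if t \<le> q then u t else z (t - q)"
  have X: "msol k u0 (q + \<delta>) ?x"
    by (rule msol_concat[OF kernel_ok_restrict[OF k] U u0 _ _ z]) (use q \<delta> in auto)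
  have qT: "ereal (q + \<delta>) < T" by (rule le_less_trans[OF _ \<tau>1(3)]) (use q \<delta> in auto)
  have XM: "mild_sol S k wt T u0 (ereal (q + \<delta>)) ?x"
    by (rule msol_imp_mild_sol[OF u0 X _ qT]) (use q \<delta> in auto)
  have "\<forall>t\<in>tint (ereal r). ?x t = u t"
  proof
    fix t assume "t \<in> tint (ereal r)"
    then show "?x t = u t" by (intro mild_sol_agree[OF u0 XM u]) (use q \<delta> in \<open>auto simp: tint_def\<close>)
  qed
  then show ?thesis using XM qT q \<delta> by (intro exI[of _ "ereal (q + \<delta>)"] exI[of _ ?x]) auto
qed

text \<open>The lifetime is the supremum of all existence times on closed intervals, and uniqueness
  glues the pieces. The last clause bounds the lifetime of every mild solution, positive or not,
  which also yields maximality.\<close>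

lemma maximal_mild_solution:
  assumes T: "0 < T" and u0: "u0 \<in> lsp wt" and pos: "nonneg_seq u0"
  obtains tmax u where "0 < tmax" "tmax \<le> T" "max_pos_mild_sol S k wt T u0 tmax u"
    "\<And>t1 v. mild_sol S k wt T u0 t1 v \<Longrightarrow> t1 \<le> tmax"
proof -
  define E where "E = {\<tau>. 0 < \<tau> \<and> ereal \<tau> < T \<and> (\<exists>u. msol k u0 \<tau> u)}"
  define tmax where "tmax = (SUP \<tau>\<in>E. ereal \<tau>)"
  have "ereal 0 < T" using T by (simp add: zero_ereal_def)
  then obtain \<tau>1 where \<tau>1: "0 < \<tau>1" "ereal \<tau>1 < T" using between_real[of 0 T] by auto
  obtain c where k: "kernel_ok k \<tau>1 c" using kok[OF \<tau>1] by blast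
  define R where "R = 2 * C1 * wnorm wt u0"
  have R: "0 \<le> R" using C1 wnorm_nonneg[OF u0 wt_pos] by (simp add: R_def)
  have c: "0 \<le> c" by (rule kernel_okD(1)[OF k])
  obtain \<delta>0 where \<delta>0: "0 < \<delta>0" "good_step \<delta>0 R c" using good_step_exists[OF R c] .
  define \<delta> where "\<delta> = min \<delta>0 \<tau>1"
  have \<delta>: "0 < \<delta>" "\<delta> \<le> \<tau>1" "good_step \<delta> R c"
    using \<delta>0 \<tau>1 good_step_mono[OF \<delta>0(2) _ _ R c, of \<delta>] by (auto simp: \<delta>_def)
  obtain z where "msol k u0 \<delta> z"
    using msol_local_exists[OF kernel_ok_restrict[OF k \<delta>(2)] \<delta>(3) u0] unfolding R_def by blast
  then have \<delta>E: "\<delta> \<in> E" using \<delta> \<tau>1 by (auto simp: E_def intro: le_less_trans[of _ "ereal \<tau>1"])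
  have t0: "0 < tmax"
  proof -
    have "ereal \<delta> \<le> tmax" unfolding tmax_def by (rule SUP_upper[OF \<delta>E])
    moreover have "0 < ereal \<delta>" using \<delta> by simp
    ultimately show ?thesis by (rule less_le_trans[rotated])
  qed
  have tT: "tmax \<le> T" unfolding tmax_def by (rule SUP_least) (auto simp: E_def)
  have upper: "t1 \<le> tmax" if m: "mild_sol S k wt T u0 t1 v" for t1 v
  proof (rule ccontr)
    assume "\<not> t1 \<le> tmax"
    then have "tmax < t1" by simp
    then obtain \<tau> where \<tau>: "tmax < ereal \<tau>" "ereal \<tau> < t1" using ereal_dense2 by blast
    have "0 < ereal \<tau>" using t0 \<tau>(1) by (rule less_trans)
    then have "\<tau> \<in> E" using mild_sol_msol[OF m u0 _ \<tau>(2)] by (auto simp: E_def)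
    then have "ereal \<tau> \<le> tmax" unfolding tmax_def by (rule SUP_upper)
    then show False using \<tau>(1) by simp
  qed
  \<comment> \<open>Any solution living strictly beyond t may supply the value at t;
    \<open>ueq\<close> shows by uniqueness that the choice is immaterial.\<close>
  define u where "u t = (SOME f. \<exists>\<tau> z. \<tau> \<in> E \<and> t < \<tau> \<and> msol k u0 \<tau> z \<and> f = z t)" for t
  have ueq: "u t = z t" if z: "msol k u0 \<sigma> z" "\<sigma> \<in> E" and t: "0 \<le> t" "t < \<sigma>" for t \<sigma> z
  proof -
    have "\<exists>\<tau> z. \<tau> \<in> E \<and> t < \<tau> \<and> msol k u0 \<tau> z \<and> u t = z t"
      unfolding u_def
      by (rule someI_ex[of "\<lambda>f. \<exists>\<tau> z. \<tau> \<in> E \<and> t < \<tau> \<and> msol k u0 \<tau> z \<and> f = z t"]) (use z t in blast)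
    then obtain \<tau> y where y: "\<tau> \<in> E" "t < \<tau>" "msol k u0 \<tau> y" "u t = y t" by blast
    have Y: "mild_sol S k wt T u0 (ereal \<tau>) y" and Z: "mild_sol S k wt T u0 (ereal \<sigma>) z"
      using msol_imp_mild_sol[OF u0] y z by (auto simp: E_def)
    show ?thesis unfolding y(4)
      by (rule mild_sol_agree[OF u0 Y Z]) (use t y in \<open>auto simp: tint_def\<close>)
  qed
  have um: "mild_sol S k wt T u0 tmax u" unfolding mild_sol_iff[OF u0]
  proof (intro conjI allI impI t0 tT)
    fix \<tau> assume \<tau>: "0 < \<tau> \<and> ereal \<tau> < tmax"
    then obtain \<sigma> where \<sigma>: "\<sigma> \<in> E" "\<tau> < \<sigma>" unfolding tmax_def less_SUP_iff by auto
    then obtain z where z: "msol k u0 \<sigma> z" by (auto simp: E_def)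
    show "msol k u0 \<tau> u"
      by (rule msol_cong[OF msol_restrict[OF z]]) (use ueq[OF z \<sigma>(1)] \<sigma> in auto)
  qed
  have "max_mild_sol S k wt T u0 tmax u" unfolding max_mild_sol_def
    using um upper by (auto simp: not_less dest: leD)
  moreover have "nonneg_seq (u t)" if t: "t \<in> tint tmax" for t
  proof -
    obtain \<tau> where \<tau>: "t < \<tau>" "0 < \<tau>" "ereal \<tau> < tmax" using between_real[of t tmax] t by (auto simp: tint_def)
    obtain c where c: "kernel_ok k \<tau> c" using kok[OF \<tau>(2) mild_sol_msol(2)[OF um u0 \<tau>(2,3)]] by blast
    show ?thesis
      by (rule msol_properties(1)[OF c mild_sol_msol(1)[OF um u0 \<tau>(2,3)] u0 pos]) (use t \<tau> in \<open>auto simp: tint_def\<close>)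
  qed
  ultimately have "max_pos_mild_sol S k wt T u0 tmax u" by (simp add: max_pos_mild_sol_def)
  then show thesis using that t0 tT upper by blast
qed

lemma max_mild_sol_blow_up:
  assumes u0: "u0 \<in> lsp wt" and u: "max_mild_sol S k wt T u0 t1 u" and "t1 < T"
  shows "filterlim (\<lambda>t. wnorm wt (u t)) at_top (at_left (real_of_ereal t1))"
proof -
  have m: "mild_sol S k wt T u0 t1 u" using u by (simp add: max_mild_sol_def)
  have "0 < t1" using m by (simp add: mild_sol_def)
  \<comment> \<open>Being positive and below T, the lifetime is a finite real.\<close>
  then obtain r where r: "t1 = ereal r" using \<open>t1 < T\<close> by (cases t1) auto
  show ?thesis
  proof (rule ccontr)
    assume "\<not> ?thesis"
    then have "\<not> filterlim (\<lambda>t. wnorm wt (u t)) at_top (at_left r)" by (simp add: r)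
    from mild_sol_extend[OF u0 m[unfolded r] \<open>t1 < T\<close>[unfolded r] this]
    show False using u unfolding max_mild_sol_def r by blast
  qed
qed

text \<open>Stability is applied up to some \<tau>' > \<tau>. A maximal solution v cannot stop
  before \<tau>', since the solution produced by stability would extend it; hence v exists strictly
  beyond \<tau>, thus on all of the closed interval.\<close>

lemma max_mild_sol_stable:
  assumes u0: "u0 \<in> lsp wt" and u: "mild_sol S k wt T u0 tmax u" and \<tau>: "0 < \<tau>" "ereal \<tau> < tmax"
  shows "\<exists>r>0. \<exists>M>0. \<forall>v0 tv v. v0 \<in> lsp wt \<and> wnorm wt (ssub v0 u0) \<le> r \<and> max_mild_sol S k wt T v0 tv v \<longrightarrow>
     ereal \<tau> < tv \<and> (\<forall>t\<in>{0..\<tau>}. wnorm wt (ssub (v t) (u t)) \<le> M * wnorm wt (ssub v0 u0))"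
proof -
  obtain \<tau>' where \<tau>': "\<tau> < \<tau>'" "0 < \<tau>'" "ereal \<tau>' < tmax" using between_real[of \<tau> tmax] \<tau> by auto
  have U: "msol k u0 \<tau>' u" and T': "ereal \<tau>' < T" using mild_sol_msol[OF u u0 \<tau>'(2,3)] by auto
  obtain c where c: "kernel_ok k \<tau>' c" using kok[OF \<tau>'(2) T'] by blast
  obtain r M where rM: "r > 0" "M > 0" "\<And>v0. v0 \<in> lsp wt \<Longrightarrow> wnorm wt (\<lambda>n. v0 n - u0 n) \<le> r \<Longrightarrow>
       \<exists>v. msol k v0 \<tau>' v \<and> (\<forall>t\<in>{0..\<tau>'}. wnorm wt (\<lambda>n. v t n - u t n) \<le> M * wnorm wt (\<lambda>n. v0 n - u0 n))"
    using msol_stable[OF c U u0 less_imp_le[OF \<tau>'(2)]] by blast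
  have "ereal \<tau> < tv \<and> (\<forall>t\<in>{0..\<tau>}. wnorm wt (ssub (v t) (u t)) \<le> M * wnorm wt (ssub v0 u0))"
    if v0: "v0 \<in> lsp wt" and d: "wnorm wt (ssub v0 u0) \<le> r" and v: "max_mild_sol S k wt T v0 tv v" for v0 tv v
  proof -
    obtain z where z: "msol k v0 \<tau>' z" "\<And>t. t \<in> {0..\<tau>'} \<Longrightarrow> wnorm wt (\<lambda>n. z t n - u t n) \<le> M * wnorm wt (\<lambda>n. v0 n - u0 n)"
      using rM(3)[OF v0] d by (auto simp: ssub_def)
    have Z: "mild_sol S k wt T v0 (ereal \<tau>') z" by (rule msol_imp_mild_sol[OF v0 z(1) \<tau>'(2) T'])
    have V: "mild_sol S k wt T v0 tv v" using v by (simp add: max_mild_sol_def)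
    have tv: "ereal \<tau>' \<le> tv"
    proof (rule ccontr)
      assume "\<not> ereal \<tau>' \<le> tv"
      then have lt: "tv < ereal \<tau>'" by simp
      have "\<forall>t\<in>tint tv. z t = v t"
      proof
        fix t assume t: "t \<in> tint tv"
        then have "t \<in> tint (ereal \<tau>')" using less_trans[OF _ lt] unfolding tint_def by blast
        then show "z t = v t" using t by (rule mild_sol_agree[OF v0 Z V])
      qed
      then show False using v lt less_imp_le[OF T'] Z unfolding max_mild_sol_def by blast
    qed
    have lt: "ereal \<tau> < tv" by (rule less_le_trans[OF _ tv]) (use \<tau>' in simp)
    have "wnorm wt (ssub (v t) (u t)) \<le> M * wnorm wt (ssub v0 u0)" if t: "t \<in> {0..\<tau>}" for t
    proof -
      have "v t = z t"
        by (rule mild_sol_agree[OF v0 V Z]) (use t lt \<tau>' in \<open>auto simp: tint_def intro: le_less_trans[of _ "ereal \<tau>"]\<close>)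
      then show ?thesis using z(2)[of t] t \<tau>' by (simp add: ssub_def)
    qed
    then show ?thesis using lt by blast
  qed
  then show ?thesis using rM(1,2) by blast
qed

lemma mild_sol_mass:
  assumes u0: "u0 \<in> lsp wt" and pos: "nonneg_seq u0" and u: "mild_sol S k wt T u0 tmax u" and t: "t \<in> tint tmax"
  shows "(\<And>j. j \<ge> 2 \<Longrightarrow> (\<Sum>n=1..j-1. real n * b n j) \<le> real j) \<Longrightarrow> phi1 (u t) \<le> phi1 u0"
    and "a 1 = 0 \<Longrightarrow> (\<And>j. j \<ge> 2 \<Longrightarrow> (\<Sum>n=1..j-1. real n * b n j) = real j) \<Longrightarrow> phi1 (u t) = phi1 u0"
proof -
  obtain \<tau> where \<tau>: "t < \<tau>" "0 < \<tau>" "ereal \<tau> < tmax" using between_real[of t tmax] t by (auto simp: tint_def)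
  obtain c where c: "kernel_ok k \<tau> c" using kok[OF \<tau>(2) mild_sol_msol(2)[OF u u0 \<tau>(2,3)]] by blast
  have tI: "t \<in> {0..\<tau>}" using t \<tau> by (auto simp: tint_def)
  note P = msol_properties[OF c mild_sol_msol(1)[OF u u0 \<tau>(2,3)] u0 pos tI]
  show "phi1 (u t) \<le> phi1 u0" if "\<And>j. j \<ge> 2 \<Longrightarrow> (\<Sum>n=1..j-1. real n * b n j) \<le> real j"
    by (rule P(2)[OF that])
  show "phi1 (u t) = phi1 u0" if "a 1 = 0" "\<And>j. j \<ge> 2 \<Longrightarrow> (\<Sum>n=1..j-1. real n * b n j) = real j"
    by (rule P(3)[OF that])
qed

end

end

theorem theorem4p11:
  fixes T :: ereal and a :: "nat \<Rightarrow> real" and b :: "nat \<Rightarrow> nat \<Rightarrow> real"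
    and k :: "nat \<Rightarrow> nat \<Rightarrow> real \<Rightarrow> real" and w :: "nat \<Rightarrow> real"
    and \<kappa> \<alpha> :: real and S :: "real \<Rightarrow> (nat \<Rightarrow> real) \<Rightarrow> (nat \<Rightarrow> real)"
    and u0 :: "nat \<Rightarrow> real"
  assumes T_pos: "0 < T"
    and a_nonneg: "\<forall>n\<ge>1. 0 \<le> a n"
    and b_nonneg: "\<forall>n\<ge>1. \<forall>j\<ge>1. 0 \<le> b n j"
    and b_zero: "\<forall>n\<ge>1. \<forall>j. j \<le> n \<longrightarrow> b n j = 0"
    and k_nonneg: "\<forall>n\<ge>1. \<forall>j\<ge>1. \<forall>t\<in>tint T. 0 \<le> k n j t"
    and k_sym: "\<forall>n\<ge>1. \<forall>j\<ge>1. \<forall>t\<in>tint T. k n j t = k j n t"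
    and w_ge: "\<forall>n\<ge>1. real n \<le> w n"
    and w_mono: "\<forall>n\<ge>1. \<forall>m. n \<le> m \<longrightarrow> w n \<le> w m"
    and kappa: "0 < \<kappa>" "\<kappa> \<le> 1"
    and w_frag: "\<forall>j\<ge>2. (\<Sum>n=1..j-1. w n * b n j) \<le> \<kappa> * w j"
    and cases: "\<alpha> = 0 \<or> (\<kappa> < 1 \<and> 0 < \<alpha> \<and> \<alpha> < 1)"
    and k_cont: "\<forall>n\<ge>1. \<forall>j\<ge>1. continuous_on (tint T) (k n j)"
    and k_bound: "\<forall>t'. 0 < t' \<and> ereal t' < T \<longrightarrow> (\<exists>c>0. \<forall>n\<ge>1. \<forall>j\<ge>1. \<forall>t. 0 \<le> t \<and> t \<le> t' \<longrightarrow>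
         k n j t \<le> c * wtil \<alpha> a w n * wtil \<alpha> a w j / w (n + j))"
    and S_gen: "frag_semigroup w a b S"
    and u0_in: "u0 \<in> lsp (wtil \<alpha> a w)" and u0_pos: "nonneg_seq u0"
  shows "\<exists>tmax u.
     0 < tmax \<and> tmax \<le> T \<and>
     max_pos_mild_sol S k (wtil \<alpha> a w) T u0 tmax u \<and>
     (\<forall>t1 v. max_pos_mild_sol S k (wtil \<alpha> a w) T u0 t1 v \<longrightarrow>
         t1 = tmax \<and> (\<forall>t\<in>tint tmax. v t = u t)) \<and>
     (tmax < T \<longrightarrow> filterlim (\<lambda>t. wnorm (wtil \<alpha> a w) (u t)) at_top (at_left (real_of_ereal tmax))) \<and>
     (\<forall>\<tau>. 0 < \<tau> \<and> ereal \<tau> < tmax \<longrightarrow>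
        (\<exists>r>0. \<exists>M>0. \<forall>v0 tv v. v0 \<in> lsp (wtil \<alpha> a w) \<and> nonneg_seq v0 \<and>
            wnorm (wtil \<alpha> a w) (ssub v0 u0) \<le> r \<and>
            max_pos_mild_sol S k (wtil \<alpha> a w) T v0 tv v \<longrightarrow>
            ereal \<tau> < tv \<and>
            (\<forall>t\<in>{0..\<tau>}. wnorm (wtil \<alpha> a w) (ssub (v t) (u t)) \<le> M * wnorm (wtil \<alpha> a w) (ssub v0 u0)))) \<and>
     ((\<forall>j\<ge>2. (\<Sum>n=1..j-1. real n * b n j) \<le> real j) \<longrightarrow>
        (\<forall>t\<in>tint tmax. phi1 (u t) \<le> phi1 u0)) \<and>
     ((a 1 = 0 \<and> (\<forall>j\<ge>2. (\<Sum>n=1..j-1. real n * b n j) = real j)) \<longrightarrow>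
        (\<forall>t\<in>tint tmax. phi1 (u t) = phi1 u0))"
proof -
  have wpos: "0 < w n" if "n \<ge> 1" for n
  proof -
    have "real n \<le> w n" using w_ge that by blast
    then show ?thesis using that by linarith
  qed
  \<comment> \<open>Two interpretations are made in turn: the column bounds that supply
    \<open>C1\<close> for the second one speak about \<open>col\<close>, which the first one
    provides.\<close>
  interpret frag_columns w S a b \<kappa>
    by unfold_locales
      (use wpos S_gen a_nonneg b_nonneg b_zero kappa w_frag in \<open>auto simp: frag_semigroup_def\<close>)
  obtain C1 where C1: "C1 \<ge> 1"
    "\<forall>j\<ge>1. \<forall>t\<ge>0. (\<Sum>n=1..j. wtil \<alpha> a w n * col n j t) \<le> C1 * wtil \<alpha> a w j"
    "\<forall>j\<ge>1. \<forall>t. 0 < t \<and> t \<le> 1 \<longrightarrow> (\<Sum>n=1..j. wtil \<alpha> a w n * col n j t) \<le> C1 * t powr (-\<alpha>) * w j"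
    using wtil_col_bounds[OF cases] by blast
  interpret coag_frag w S a b \<kappa> \<alpha> C1
    by unfold_locales (use cases w_mono w_ge C1 in auto)
  have kok: "\<exists>c. kernel_ok k \<tau> c" if \<tau>: "0 < \<tau>" "ereal \<tau> < T" for \<tau>
  proof -
    obtain c where c: "c > 0" "\<forall>n\<ge>1. \<forall>j\<ge>1. \<forall>t. 0 \<le> t \<and> t \<le> \<tau> \<longrightarrow>
         k n j t \<le> c * wtil \<alpha> a w n * wtil \<alpha> a w j / w (n + j)"
      using k_bound \<tau> by blast
    have sub: "{0..\<tau>} \<subseteq> tint T" using \<tau> by (auto simp: tint_def intro: le_less_trans[of _ "ereal \<tau>"])
    have "kernel_ok k \<tau> c" unfolding kernel_ok_def
    proof (intro conjI allI impI ballI)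
      fix n j :: nat assume nj: "n \<ge> 1" "j \<ge> 1"
      show "continuous_on {0..\<tau>} (k n j)" using k_cont nj continuous_on_subset[OF _ sub] by blast
      fix t assume t: "t \<in> {0..\<tau>}"
      then have tT: "t \<in> tint T" using sub by blast
      show "0 \<le> k n j t" using k_nonneg nj tT by blast
      show "k n j t = k j n t" using k_sym nj tT by blast
      show "k n j t \<le> c * wt n * wt j / w (n + j)" using c(2) nj t by simp
    qed (use c in simp)
    then show ?thesis by blast
  qed
  obtain tmax u where M: "0 < tmax" "tmax \<le> T" "max_pos_mild_sol S k wt T u0 tmax u"
    "\<And>t1 v. mild_sol S k wt T u0 t1 v \<Longrightarrow> t1 \<le> tmax"
    using maximal_mild_solution[OF kok T_pos u0_in u0_pos] by blast
  have mx: "max_mild_sol S k wt T u0 tmax u" and um: "mild_sol S k wt T u0 tmax u"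
    using M(3) by (auto simp: max_pos_mild_sol_def max_mild_sol_def)
  \<comment> \<open>No mild solution outlives \<open>tmax\<close>, and a maximal one that stopped
    earlier would be extended by u, with which it agrees.\<close>
  have uniq: "t1 = tmax \<and> (\<forall>t\<in>tint tmax. v t = u t)" if v: "max_pos_mild_sol S k wt T u0 t1 v" for t1 v
  proof -
    have vm: "mild_sol S k wt T u0 t1 v" using v by (simp add: max_pos_mild_sol_def max_mild_sol_def)
    have le: "t1 \<le> tmax" by (rule M(4)[OF vm])
    have agree: "u t = v t" if "t \<in> tint t1" for t
      by (rule mild_sol_agree[OF kok u0_in um vm]) (use that le in \<open>auto simp: tint_def intro: less_le_trans\<close>)
    have "t1 = tmax"
    proof (rule ccontr)
      assume "t1 \<noteq> tmax"
      then have "t1 < tmax" using le by simp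
      then show False using v um M(2) agree unfolding max_pos_mild_sol_def max_mild_sol_def by blast
    qed
    then show ?thesis using agree by simp
  qed
  have stab: "\<exists>r>0. \<exists>M>0. \<forall>v0 tv v. v0 \<in> lsp wt \<and> nonneg_seq v0 \<and> wnorm wt (ssub v0 u0) \<le> r \<and>
      max_pos_mild_sol S k wt T v0 tv v \<longrightarrow> ereal \<tau> < tv \<and>
      (\<forall>t\<in>{0..\<tau>}. wnorm wt (ssub (v t) (u t)) \<le> M * wnorm wt (ssub v0 u0))" if "0 < \<tau> \<and> ereal \<tau> < tmax" for \<tau>
    using max_mild_sol_stable[OF kok u0_in um, of \<tau>] that unfolding max_pos_mild_sol_def by blast
  have blow: "tmax < T \<Longrightarrow> filterlim (\<lambda>t. wnorm wt (u t)) at_top (at_left (real_of_ereal tmax))"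
    by (rule max_mild_sol_blow_up[OF kok u0_in mx])
  have m1: "\<forall>t\<in>tint tmax. phi1 (u t) \<le> phi1 u0" if "\<forall>j\<ge>2. (\<Sum>n=1..j-1. real n * b n j) \<le> real j"
  proof
    fix t assume "t \<in> tint tmax"
    from mild_sol_mass(1)[OF kok u0_in u0_pos um this] that show "phi1 (u t) \<le> phi1 u0" by blast
  qed
  have m2: "\<forall>t\<in>tint tmax. phi1 (u t) = phi1 u0" if "a 1 = 0 \<and> (\<forall>j\<ge>2. (\<Sum>n=1..j-1. real n * b n j) = real j)"
  proof
    fix t assume "t \<in> tint tmax"
    from mild_sol_mass(2)[OF kok u0_in u0_pos um this] that show "phi1 (u t) = phi1 u0" by blast
  qed
  show ?thesis
  proof (intro exI[of _ tmax] exI[of _ u] conjI)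
    show "\<forall>t1 v. max_pos_mild_sol S k wt T u0 t1 v \<longrightarrow> t1 = tmax \<and> (\<forall>t\<in>tint tmax. v t = u t)" using uniq by blast
    show "tmax < T \<longrightarrow> filterlim (\<lambda>t. wnorm wt (u t)) at_top (at_left (real_of_ereal tmax))" using blow by blast
    show "\<forall>\<tau>. 0 < \<tau> \<and> ereal \<tau> < tmax \<longrightarrow>
        (\<exists>r>0. \<exists>M>0. \<forall>v0 tv v. v0 \<in> lsp wt \<and> nonneg_seq v0 \<and> wnorm wt (ssub v0 u0) \<le> r \<and>
            max_pos_mild_sol S k wt T v0 tv v \<longrightarrow> ereal \<tau> < tv \<and>
            (\<forall>t\<in>{0..\<tau>}. wnorm wt (ssub (v t) (u t)) \<le> M * wnorm wt (ssub v0 u0)))"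
      using stab by (intro allI impI)
    show "(\<forall>j\<ge>2. (\<Sum>n=1..j-1. real n * b n j) \<le> real j) \<longrightarrow> (\<forall>t\<in>tint tmax. phi1 (u t) \<le> phi1 u0)"
      using m1 by (rule impI)
    show "(a 1 = 0 \<and> (\<forall>j\<ge>2. (\<Sum>n=1..j-1. real n * b n j) = real j)) \<longrightarrow> (\<forall>t\<in>tint tmax. phi1 (u t) = phi1 u0)"
      using m2 by (rule impI)
  qed (use M in auto)
qed

end
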